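(* Let $k$ be a field of characteristic $0$, let $\varphi \colon \mathbf P^1 \times \operatorname{Sym}^2(\mathbf P^1) \to \operatorname{Sym}^3(\mathbf P^1)$ be the map $(p,\{q,r\}) \mapsto \{p,q,r\}$, where $\operatorname{Sym}^2(\mathbf P^1) \cong \mathbf P^2$ and $\operatorname{Sym}^3(\mathbf P^1) \cong \mathbf P^3$. Let $R \subseteq \mathbf P^1 \times \mathbf P^2$ be the ramification divisor of $\varphi$, and let $H \subseteq \operatorname{Sym}^3(\mathbf P^1) \cong \mathbf P^3$ be a hyperplane. Then the complement $U = (\mathbf P^1 \times \mathbf P^2) \setminus (R \cup \varphi^{-1}(H))$ is isomorphic to $\mathbf A^3$ if and only if $H$ is tangent but not osculating to the small diagonal.
   Context: All varieties are over $k$. The identification $\operatorname{Sym}^n(\mathbf P^1) \cong \mathbf P^n$ is via elementary symmetric polynomials: the quotient map is $\pi = [\bar\sigma_n : \ldots : \bar\sigma_0] \colon (\mathbf P^1)^n \to \mathbf P^n$, where $\bar\sigma_i([x_1:y_1],\ldots,[x_n:y_n]) = \sum_{I \subseteq \{1,\ldots,n\},\, |I| = i} \prod_{j \in I} x_j \prod_{j \notin I} y_j$. The small diagonal in $\operatorname{Sym}^3(\mathbf P^1) \cong \mathbf P^3$ is the image of the diagonal of $(\mathbf P^1)^3$, i.e. the image $C$ of $\iota \colon \mathbf P^1 \to \mathbf P^3$, $p \mapsto \{p,p,p\}$ (a twisted cubic). A hyperplane $H$ is tangent to the small diagonal to order $i$ at $p \in \mathbf P^1$ if the divisor $\iota^*H$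 on $\mathbf P^1$ (of degree $3$) has multiplicity exactly $i$ at $p$. "Tangent but not osculating" means tangent to order exactly $2$ at some point $p$; "osculating" means tangent to order $3$ at some point. *)

theory Defs
  imports
    "HOL-Analysis.Cartesian_Space"
    "HOL-Library.Poly_Mapping"
    "HOL-Algebra.Algebraic_Closure_Type"
begin

unbundle no fps_syntax

text \<open>
  Varieties over a field \<open>k\<close> (a type \<open>'k\<close> of characteristic 0, hence perfect) are treated in the
  classical way: the points are the geometric points, with coordinates in \<open>'k alg_closure\<close>, while
  open sets and regular functions are given by polynomials with coefficients in \<open>'k\<close>.  As \<open>k\<close> is
  perfect, morphisms in this sense are the same as morphisms of the corresponding reduced
  \<open>k\<close>-schemes.
\<close>

subsection \<open>Polynomials over \<open>k\<close>\<close>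

type_synonym ('v, 'k) mpoly = "('v \<Rightarrow>\<^sub>0 nat) \<Rightarrow>\<^sub>0 'k"

definition mpoly_eval :: "('v, 'k::field) mpoly \<Rightarrow> ('v \<Rightarrow> 'k alg_closure) \<Rightarrow> 'k alg_closure" where
  "mpoly_eval F x =
     (\<Sum>m\<in>Poly_Mapping.keys F. to_ac (Poly_Mapping.lookup F m) *
        (\<Prod>i\<in>Poly_Mapping.keys m. x i ^ Poly_Mapping.lookup m i))"

definition homogeneous_in :: "'v set \<Rightarrow> nat \<Rightarrow> ('v, 'k::zero) mpoly \<Rightarrow> bool" where
  "homogeneous_in S d F \<longleftrightarrow>
     (\<forall>m\<in>Poly_Mapping.keys F. (\<Sum>i\<in>S. Poly_Mapping.lookup m i) = d)"


subsection \<open>Spaces with functions\<close>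

text \<open>
  \<open>stalk V x\<close> is the set of all (total) functions which coincide near \<open>x\<close> with a regular function;
  values away from \<open>x\<close> are unconstrained, so its elements represent germs at \<open>x\<close>.
\<close>

record ('p, 'c) fun_space =
  points :: "'p set"
  stalk :: "'p \<Rightarrow> ('p \<Rightarrow> 'c) set"

text \<open>Only meant for \<open>U\<close> open, where the regular germs of \<open>U\<close> are those of the ambient space.\<close>

definition open_subspace :: "('p, 'c) fun_space \<Rightarrow> 'p set \<Rightarrow> ('p, 'c) fun_space" where
  "open_subspace V U = V\<lparr>points := points V \<inter> U\<rparr>"

text \<open>
  Continuity is implied by the condition on stalks: the indicator function \<open>g\<close> of an open
  neighbourhood \<open>N\<close> of \<open>f x\<close> belongs to the stalk at \<open>f x\<close>, and if \<open>g \<circ> f\<close> agrees near \<open>x\<close> with a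
  quotient of polynomials, then that quotient is nonzero near \<open>x\<close>, that is, \<open>f\<close> maps a
  neighbourhood of \<open>x\<close> to \<open>N\<close>.
\<close>

definition variety_morphism ::
    "('p, 'c) fun_space \<Rightarrow> ('q, 'c) fun_space \<Rightarrow> ('p \<Rightarrow> 'q) \<Rightarrow> bool" where
  "variety_morphism V W f \<longleftrightarrow>
     f \<in> points V \<rightarrow> points W \<and>
     (\<forall>x\<in>points V. \<forall>g\<in>stalk W (f x). g \<circ> f \<in> stalk V x)"

definition isomorphic_varieties :: "('p, 'c) fun_space \<Rightarrow> ('q, 'c) fun_space \<Rightarrow> bool" where
  "isomorphic_varieties V W \<longleftrightarrow>
     (\<exists>f g. variety_morphism V W f \<and> variety_morphism W V g \<and>
        (\<forall>x\<in>points V. g (f x) = x) \<and> (\<forall>y\<in>points W. f (g y) = y))"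

text \<open>
  A tangent vector at a geometric point is a \<open>k\<close>-derivation of the local ring.  It depends
  only on germs: if \<open>f = f'\<close> near \<open>x\<close>, then multiply with the indicator function of a neighbourhood
  of \<open>x\<close>.
\<close>

definition tangent_vector ::
    "('p, 'k::field alg_closure) fun_space \<Rightarrow> 'p \<Rightarrow> (('p \<Rightarrow> 'k alg_closure) \<Rightarrow> 'k alg_closure) \<Rightarrow> bool"
  where
  "tangent_vector V x \<delta> \<longleftrightarrow>
     (\<forall>f\<in>stalk V x. \<forall>g\<in>stalk V x.
        \<delta> (\<lambda>z. f z + g z) = \<delta> f + \<delta> g \<and>
        \<delta> (\<lambda>z. f z * g z) = f x * \<delta> g + g x * \<delta> f) \<and>
     (\<forall>c. \<delta> (\<lambda>_. to_ac c) = 0)"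

text \<open>
  The points where the differential of \<open>f\<close> is not injective on tangent spaces.  For a finite
  morphism of smooth varieties of the same dimension in characteristic 0, this is the support of
  the ramification divisor, the zero locus of the Jacobian determinant.
\<close>

definition ramification_locus ::
    "('p, 'k::field alg_closure) fun_space \<Rightarrow> ('q, 'k alg_closure) fun_space \<Rightarrow> ('p \<Rightarrow> 'q) \<Rightarrow> 'p set"
  where
  "ramification_locus V W f =
     {x \<in> points V. \<exists>\<delta>. tangent_vector V x \<delta> \<and> (\<exists>h\<in>stalk V x. \<delta> h \<noteq> 0) \<and>
        (\<forall>g\<in>stalk W (f x). \<delta> (g \<circ> f) = 0)}"


subsection \<open>Affine and projective spaces\<close>

definition proj_rel :: "'c::field^'n \<Rightarrow> 'c^'n \<Rightarrow> bool" where
  "proj_rel v w \<longleftrightarrow> v \<noteq> 0 \<and> w \<noteq> 0 \<and> (\<exists>c. w = c *s v)"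

text \<open>The index type has one more element than the dimension of the projective space.\<close>

quotient_type (overloaded) ('c, 'n) proj = "'c::field^'n::finite" / partial: proj_rel
proof (rule part_equivpI)
  show "\<exists>v::'c^'n. proj_rel v v"
    by (rule exI[of _ "1"], auto simp: proj_rel_def intro: exI[of _ 1])
  show "symp (proj_rel :: 'c^'n \<Rightarrow> _)"
  proof (rule sympI)
    fix v w :: "'c^'n"
    assume "proj_rel v w"
    then obtain c where c: "v \<noteq> 0" "w \<noteq> 0" "w = c *s v"
      by (auto simp: proj_rel_def)
    from c have "c \<noteq> 0" by auto
    with c have "v = inverse c *s w" by simp
    with c show "proj_rel w v" unfolding proj_rel_def by blast
  qed
  show "transp (proj_rel :: 'c^'n \<Rightarrow> _)"
    by (rule transpI) (auto simp: proj_rel_def)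
qed

definition affine_space :: "('k::field alg_closure^'n, 'k alg_closure) fun_space" where
  "affine_space = \<lparr>points = UNIV, stalk = (\<lambda>x. {f. \<exists>F G :: ('n, 'k) mpoly.
      mpoly_eval G (vec_nth x) \<noteq> 0 \<and>
      (\<forall>z. mpoly_eval G (vec_nth z) \<noteq> 0 \<longrightarrow>
         f z = mpoly_eval F (vec_nth z) / mpoly_eval G (vec_nth z))})\<rparr>"

definition proj_space :: "(('k::field alg_closure, 'n::finite) proj, 'k alg_closure) fun_space" where
  "proj_space = \<lparr>points = UNIV, stalk = (\<lambda>x. {f. \<exists>d. \<exists>F G :: ('n, 'k) mpoly.
      homogeneous_in UNIV d F \<and> homogeneous_in UNIV d G \<and>
      mpoly_eval G (vec_nth (rep_proj x)) \<noteq> 0 \<and>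
      (\<forall>z. mpoly_eval G (vec_nth (rep_proj z)) \<noteq> 0 \<longrightarrow>
         f z = mpoly_eval F (vec_nth (rep_proj z)) / mpoly_eval G (vec_nth (rep_proj z)))})\<rparr>"

definition proj_prod_coords ::
    "('c::field, 'm::finite) proj \<times> ('c, 'n::finite) proj \<Rightarrow> 'm + 'n \<Rightarrow> 'c" where
  "proj_prod_coords x = case_sum (vec_nth (rep_proj (fst x))) (vec_nth (rep_proj (snd x)))"

definition bihomogeneous :: "nat \<Rightarrow> nat \<Rightarrow> ('m::finite + 'n::finite, 'k::zero) mpoly \<Rightarrow> bool" where
  "bihomogeneous d e F \<longleftrightarrow> homogeneous_in (range Inl) d F \<and> homogeneous_in (range Inr) e F"

definition proj_prod ::
    "(('k::field alg_closure, 'm::finite) proj \<times> ('k alg_closure, 'n::finite) proj,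
      'k alg_closure) fun_space" where
  "proj_prod = \<lparr>points = UNIV, stalk = (\<lambda>x. {f. \<exists>d e. \<exists>F G :: ('m + 'n, 'k) mpoly.
      bihomogeneous d e F \<and> bihomogeneous d e G \<and>
      mpoly_eval G (proj_prod_coords x) \<noteq> 0 \<and>
      (\<forall>z. mpoly_eval G (proj_prod_coords z) \<noteq> 0 \<longrightarrow>
         f z = mpoly_eval F (proj_prod_coords z) / mpoly_eval G (proj_prod_coords z))})\<rparr>"


subsection \<open>Symmetric powers of the projective line\<close>

definition bihom_sym :: "nat \<Rightarrow> ('c::comm_semiring_1^2) list \<Rightarrow> 'c" where
  "bihom_sym i vs = (\<Sum>I | I \<subseteq> {..<length vs} \<and> card I = i.
     (\<Prod>j\<in>I. (vs ! j) $ 1) * (\<Prod>j\<in>{..<length vs} - I. (vs ! j) $ 2))"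

text \<open>
  For \<open>n = length vs\<close>, the coordinates \<open>[\<sigma>\<^sub>n : \<dots> : \<sigma>\<^sub>0]\<close>, in this order; only meant for index types
  with \<open>n + 1\<close> elements.
\<close>

definition sym_coords :: "('c::comm_semiring_1^2) list \<Rightarrow> 'c^'m::{finite,numeral}" where
  "sym_coords vs = vector (map (\<lambda>i. bihom_sym i vs) (rev [0..<Suc (length vs)]))"

definition sym_quot :: "('c::field, 2) proj list \<Rightarrow> ('c, 'm::{finite,numeral}) proj" where
  "sym_quot ps = abs_proj (sym_coords (map rep_proj ps))"

text \<open>Over an algebraically closed field, every point of \<open>P\<^sup>2\<close> is the image of a unique \<open>{q, r}\<close>.\<close>

definition add_point :: "('c::field, 2) proj \<times> ('c, 3) proj \<Rightarrow> ('c, 4) proj" where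
  "add_point = (\<lambda>(p, D). THE E. \<exists>q r. D = sym_quot [q, r] \<and> E = sym_quot [p, q, r])"


subsection \<open>Hyperplanes and tangency to the small diagonal\<close>

definition hyperplane :: "'k::field^'n \<Rightarrow> ('k alg_closure, 'n::finite) proj set" where
  "hyperplane a = {P. (\<Sum>i\<in>UNIV. to_ac (a $ i) * rep_proj P $ i) = 0}"

text \<open>
  A local equation of the pullback of the hyperplane along \<open>p \<mapsto> {p, p, p}\<close>, when the homogeneous
  coordinates \<open>u\<close> of \<open>p\<close> are given as polynomials in a parameter of an affine chart.
\<close>

definition diag_pullback :: "'k::field^4 \<Rightarrow> 'k alg_closure poly^2 \<Rightarrow> 'k alg_closure poly" where
  "diag_pullback a u = (\<Sum>i\<in>UNIV. [:to_ac (a $ i):] * (sym_coords [u, u, u] :: _^4) $ i)"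

text \<open>The multiplicity at \<open>p\<close> of the pullback divisor, computed in the standard charts.\<close>

definition contact_order :: "'k::field^4 \<Rightarrow> ('k alg_closure, 2) proj \<Rightarrow> nat" where
  "contact_order a p =
     (let v = rep_proj p in
      if v $ 2 \<noteq> 0 then Polynomial.order (v $ 1 / v $ 2) (diag_pullback a (vector [[:0, 1:], 1]))
      else Polynomial.order 0 (diag_pullback a (vector [1, [:0, 1:]])))"

definition tangent_to_order :: "'k::field^4 \<Rightarrow> nat \<Rightarrow> ('k alg_closure, 2) proj \<Rightarrow> bool" where
  "tangent_to_order a i p \<longleftrightarrow> contact_order a p = i"

definition tangent_not_osculating :: "'k::field^4 \<Rightarrow> bool" where
  "tangent_not_osculating a \<longleftrightarrow> (\<exists>p. tangent_to_order a 2 p)"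

end

theory Submission
  imports Defs "HOL-Analysis.Analysis"
begin

no_notation fps_nth (infixl "$" 75)

text \<open>
  Identify points of \<open>P\<^sup>1\<close> and \<open>P\<^sup>2\<close> with binary linear forms \<open>u\<close> and binary quadratic forms \<open>w\<close>.
  Then \<open>\<phi>\<close> is multiplication, \<open>R\<close> is the zero locus of the resultant \<open>Q(u, w)\<close>, of bidegree \<open>(2, 1)\<close>,
  and \<open>\<phi>\<^sup>-\<^sup>1(H)\<close> that of a bilinear form \<open>L(u, w)\<close>.  As \<open>(2, 1)\<close> and \<open>(1, 1)\<close> form a basis of \<open>\<int>\<^sup>2\<close>,
  \<open>U\<close> is the affine threefold \<open>{L = Q = 1}\<close> in the space of all \<open>(u, w)\<close>.  The binary cubic that
  corresponds to \<open>H\<close> has one of three normal forms.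

  If it has a double and a simple root, both are rational, and the equations can be solved
  explicitly by polynomials in three free parameters.

  If it has a triple root, then \<open>Q\<close> divided by a product of linear forms is a nonconstant unit on
  \<open>U\<close>, whereas units on \<open>A\<^sup>3\<close> are constant.

  If it has three distinct roots, then it is a sum of two cubes over the algebraic closure.  In
  suitable coordinates \<open>U\<close> is \<open>{X A + Y B = 1, Y\<^sup>2 A + X\<^sup>2 B - X Y N = 1}\<close>, a bundle of affine lines
  over \<open>A\<^sup>2 - {0}\<close>.  An isomorphism with \<open>A\<^sup>3\<close> is given by polynomials, whose finitely many
  coefficients generate a ring with a homomorphism to \<open>\<complex>\<close>.  Over \<open>\<complex>\<close> the identity of the 3-sphere
  then factors through the contractible space \<open>\<complex>\<^sup>3\<close>.
\<close>

subsection \<open>Polynomial functions\<close>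

text \<open>An isomorphism is given only as a pair of maps on points, with local quotients of
  polynomials as the sole control. So two things must be built before topology can act. First,
  functions regular on 3-space and on the threefold have to be shown polynomial; this is done along
  coordinate lines with interpolation, so that no factorisation in several variables is needed.
  Second, the closure of \<open>k\<close> may be larger than \<complex>, so the maps cannot simply
  be regarded as complex ones. Only finitely many coefficients are moved, hence polynomials are kept
  as syntactic expressions. An identity known at all points over the closure reaches \<complex>
  through points with rational coordinates: they are common to both fields, and dense in 3-space as
  well as in the charts X \<noteq> 0 and Y \<noteq> 0 of the threefold, which have rational
  parametrisations.\<close>

datatype 'a expr = Const 'a | Var nat | Add "'a expr" "'a expr" | Mul "'a expr" "'a expr"

text \<open>Constants pass through \<open>\<phi>\<close>, so one expression can be evaluated over
  its own field with \<open>id\<close>, and over another field after its coefficients have been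
  mapped. Variables are numbered by \<nat> to let inductions run over how many are free.\<close>

primrec ev :: "('a \<Rightarrow> 'b::comm_ring_1) \<Rightarrow> (nat \<Rightarrow> 'b) \<Rightarrow> 'a expr \<Rightarrow> 'b" where
  "ev \<phi> x (Const c) = \<phi> c"
| "ev \<phi> x (Var i) = x i"
| "ev \<phi> x (Add e f) = ev \<phi> x e + ev \<phi> x f"
| "ev \<phi> x (Mul e f) = ev \<phi> x e * ev \<phi> x f"

definition polyfun :: "((nat \<Rightarrow> 'a::comm_ring_1) \<Rightarrow> 'a) \<Rightarrow> bool" where
  "polyfun f \<longleftrightarrow> (\<exists>e. \<forall>x. f x = ev id x e)"

named_theorems polyfun_intros

lemma polyfun_const [polyfun_intros]: "polyfun (\<lambda>_. c)"
  unfolding polyfun_def by (rule exI[of _ "Const c"]) simp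

lemma polyfun_var [polyfun_intros]: "polyfun (\<lambda>x. x i)"
  unfolding polyfun_def by (rule exI[of _ "Var i"]) simp

lemma polyfun_add [polyfun_intros]: "polyfun f \<Longrightarrow> polyfun g \<Longrightarrow> polyfun (\<lambda>x. f x + g x)"
  unfolding polyfun_def by (metis ev.simps(3))

lemma polyfun_mult [polyfun_intros]: "polyfun f \<Longrightarrow> polyfun g \<Longrightarrow> polyfun (\<lambda>x. f x * g x)"
  unfolding polyfun_def by (metis ev.simps(4))

lemma polyfun_uminus [polyfun_intros]: "polyfun f \<Longrightarrow> polyfun (\<lambda>x. - f x)"
  using polyfun_mult[OF polyfun_const[of "- 1"]] by fastforce

lemma polyfun_diff [polyfun_intros]: "polyfun f \<Longrightarrow> polyfun g \<Longrightarrow> polyfun (\<lambda>x. f x - g x)"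
  using polyfun_add[OF _ polyfun_uminus, of f g] by simp

lemma polyfun_power [polyfun_intros]: "polyfun f \<Longrightarrow> polyfun (\<lambda>x. f x ^ n)"
  by (induction n) (auto intro: polyfun_intros)

lemma polyfun_sum [polyfun_intros]:
  "(\<And>a. a \<in> A \<Longrightarrow> polyfun (f a)) \<Longrightarrow> polyfun (\<lambda>x. \<Sum>a\<in>A. f a x)"
  by (induction A rule: infinite_finite_induct) (auto intro: polyfun_intros)

lemma polyfun_poly [polyfun_intros]: "polyfun f \<Longrightarrow> polyfun (\<lambda>x. poly p (f x))"
  by (induction p) (auto intro!: polyfun_intros)

lemma polyfun_subst:
  assumes "polyfun f" "\<And>i. polyfun (g i)"
  shows "polyfun (\<lambda>x. f (\<lambda>i. g i x))"
proof -
  obtain e where "\<And>x. f x = ev id x e"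
    using assms(1) by (auto simp: polyfun_def)
  moreover have "polyfun (\<lambda>x. ev id (\<lambda>i. g i x) e)"
    by (induction e) (auto intro: polyfun_intros assms(2))
  ultimately show ?thesis by simp
qed

lemma polyfun_upd:
  assumes "polyfun f" "polyfun g"
  shows "polyfun (\<lambda>x. f (x(n := g x)))"
proof -
  have "polyfun (\<lambda>x. f (\<lambda>i. (if i = n then g x else x i)))"
  proof (rule polyfun_subst[OF assms(1)])
    show "polyfun (\<lambda>x. if i = n then g x else x i)" for i
      by (cases "i = n") (auto intro: polyfun_intros assms(2))
  qed
  then show ?thesis by (simp add: fun_upd_def)
qed

text \<open>The degree bound depends on the expression only, not on the base point or the axis. This
  uniformity later allows interpolation with a fixed number of nodes.\<close>

lemma ev_axis:
  fixes \<phi> :: "'a \<Rightarrow> 'b::idom"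
  shows "\<exists>N. \<forall>x n. \<exists>p. degree p \<le> N \<and> (\<forall>t. ev \<phi> (x(n := t)) e = poly p t)"
proof (induction e)
  case (Const c)
  show ?case by (rule exI[of _ 0]) (auto intro!: exI[of _ "[:\<phi> c:]"])
next
  case (Var i)
  have "\<exists>p. degree p \<le> 1 \<and> (\<forall>t. ev \<phi> (x(n := t)) (Var i) = poly p t)" for x and n :: nat
  proof (cases "i = n")
    case True
    then show ?thesis by (intro exI[of _ "[:0, 1:]"]) simp
  next
    case False
    then show ?thesis by (intro exI[of _ "[:x i:]"]) simp
  qed
  then show ?case by blast
next
  case (Add e f)
  then obtain N M where NM:
    "\<And>x n. \<exists>p. degree p \<le> N \<and> (\<forall>t. ev \<phi> (x(n := t)) e = poly p t)"
    "\<And>x n. \<exists>p. degree p \<le> M \<and> (\<forall>t. ev \<phi> (x(n := t)) f = poly p t)"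
    by blast
  have "\<exists>p. degree p \<le> max N M \<and> (\<forall>t. ev \<phi> (x(n := t)) (Add e f) = poly p t)" for x n
  proof -
    obtain p q where "degree p \<le> N" "\<And>t. ev \<phi> (x(n := t)) e = poly p t"
      "degree q \<le> M" "\<And>t. ev \<phi> (x(n := t)) f = poly q t"
      using NM[of x n] by auto
    then show ?thesis
      by (intro exI[of _ "p + q"]) (auto intro: degree_add_le)
  qed
  then show ?case by blast
next
  case (Mul e f)
  then obtain N M where NM:
    "\<And>x n. \<exists>p. degree p \<le> N \<and> (\<forall>t. ev \<phi> (x(n := t)) e = poly p t)"
    "\<And>x n. \<exists>p. degree p \<le> M \<and> (\<forall>t. ev \<phi> (x(n := t)) f = poly p t)"
    by blast
  have "\<exists>p. degree p \<le> N + M \<and> (\<forall>t. ev \<phi> (x(n := t)) (Mul e f) = poly p t)" for x n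
  proof -
    obtain p q where "degree p \<le> N" "\<And>t. ev \<phi> (x(n := t)) e = poly p t"
      "degree q \<le> M" "\<And>t. ev \<phi> (x(n := t)) f = poly q t"
      using NM[of x n] by auto
    then show ?thesis
      using degree_mult_le[of p q] by (intro exI[of _ "p * q"]) (auto intro: degree_add_le)
  qed
  then show ?case by blast
qed

lemma polyfun_axis:
  fixes f :: "(nat \<Rightarrow> 'a::idom) \<Rightarrow> 'a"
  assumes "polyfun f"
  shows "\<exists>N. \<forall>x n. \<exists>p. degree p \<le> N \<and> (\<forall>t. f (x(n := t)) = poly p t)"
  using assms ev_axis[of id] by (auto simp: polyfun_def)


subsection \<open>Regular functions on affine space are polynomial\<close>

lemma poly_eqI_cofinite:
  fixes p q r :: "'a::{idom, ring_char_0} poly"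
  assumes "r \<noteq> 0" "\<And>x. poly r x \<noteq> 0 \<Longrightarrow> poly p x = poly q x"
  shows "p = q"
proof -
  have "(p - q) * r = 0"
    unfolding poly_all_0_iff_0[symmetric] using assms(2) by auto
  with assms(1) show ?thesis by simp
qed

text \<open>\<open>p\<close> splits into linear factors and each of them divides \<open>q\<close>;
  the exponent counts the factors, so repeated roots are covered.\<close>

lemma dvd_power_if_roots:
  fixes p q :: "'a::alg_closed_field poly"
  assumes "p \<noteq> 0" "\<And>x. poly p x = 0 \<Longrightarrow> poly q x = 0"
  shows "\<exists>m. p dvd q ^ m"
  using assms
proof (induction "degree p" arbitrary: p)
  case 0
  then show ?case by (intro exI[of _ 0]) (simp add: is_unit_iff_degree)
next
  case (Suc d)
  then obtain r where r: "poly p r = 0"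
    using alg_closed_imp_poly_has_root[of p] by auto
  obtain p' where p': "p = [:-r, 1:] * p'"
    using r by (auto simp: poly_eq_0_iff_dvd)
  with Suc.prems(1) have nz: "p' \<noteq> 0" by auto
  have "degree p' = d"
    using Suc.hyps(2) nz unfolding p' by (subst (asm) degree_mult_eq) auto
  then obtain m where "p' dvd q ^ m"
    using Suc.hyps(1)[of p'] nz Suc.prems(2) unfolding p' by auto
  moreover have "[:-r, 1:] dvd q"
    using Suc.prems(2)[OF r] by (simp add: poly_eq_0_iff_dvd)
  ultimately have "p dvd q ^ Suc m"
    unfolding p' power_Suc by (intro mult_dvd_mono)
  then show ?case ..
qed

text \<open>Membership in the localisation at \<open>q\<close>, with no condition at the zeros of
  \<open>q\<close>. The cases that matter are \<open>q = 1\<close>, a plain polynomial, and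
  \<open>q = [:0, 1:]\<close>, a Laurent polynomial.\<close>

definition laurent :: "'a::comm_ring_1 poly \<Rightarrow> ('a \<Rightarrow> 'a) \<Rightarrow> bool" where
  "laurent q g \<longleftrightarrow> (\<exists>p m. \<forall>t. poly q t \<noteq> 0 \<longrightarrow> poly q t ^ m * g t = poly p t)"

named_theorems laurent_intros

lemma laurent_poly: "laurent q (\<lambda>t. poly p t)"
  unfolding laurent_def by (rule exI[of _ p], rule exI[of _ 0]) simp

lemma laurent_const [laurent_intros]: "laurent q (\<lambda>_. c)"
  using laurent_poly[of q "[:c:]"] by simp

lemma laurent_id [laurent_intros]: "laurent q (\<lambda>t. t)"
  using laurent_poly[of q "[:0, 1:]"] by simp

lemma laurent_inverse [laurent_intros]:
  fixes q :: "'a::field poly"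
  shows "q = [:0, 1:] \<Longrightarrow> laurent q inverse"
  unfolding laurent_def by (intro exI[of _ 1]) simp

lemma laurent_add [laurent_intros]:
  assumes "laurent q f" "laurent q g"
  shows "laurent q (\<lambda>t. f t + g t)"
proof -
  obtain p m where p: "\<And>t. poly q t \<noteq> 0 \<Longrightarrow> poly q t ^ m * f t = poly p t"
    using assms(1) by (auto simp: laurent_def)
  obtain p' m' where p': "\<And>t. poly q t \<noteq> 0 \<Longrightarrow> poly q t ^ m' * g t = poly p' t"
    using assms(2) by (auto simp: laurent_def)
  have "poly q t ^ (m + m') * (f t + g t) = poly (q ^ m' * p + q ^ m * p') t"
    if "poly q t \<noteq> 0" for t
    by (simp add: power_add p[OF that, symmetric] p'[OF that, symmetric] algebra_simps)
  then show ?thesis unfolding laurent_def by blast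
qed

lemma laurent_mult [laurent_intros]:
  assumes "laurent q f" "laurent q g"
  shows "laurent q (\<lambda>t. f t * g t)"
proof -
  obtain p m where p: "\<And>t. poly q t \<noteq> 0 \<Longrightarrow> poly q t ^ m * f t = poly p t"
    using assms(1) by (auto simp: laurent_def)
  obtain p' m' where p': "\<And>t. poly q t \<noteq> 0 \<Longrightarrow> poly q t ^ m' * g t = poly p' t"
    using assms(2) by (auto simp: laurent_def)
  have "poly q t ^ (m + m') * (f t * g t) = poly (p * p') t" if "poly q t \<noteq> 0" for t
    by (simp add: power_add p[OF that, symmetric] p'[OF that, symmetric] mult_ac)
  then show ?thesis unfolding laurent_def by blast
qed

lemma laurent_uminus [laurent_intros]: "laurent q f \<Longrightarrow> laurent q (\<lambda>t. - f t)"
  using laurent_mult[OF laurent_const[of q "- 1"]] by simp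

lemma laurent_diff [laurent_intros]: "laurent q f \<Longrightarrow> laurent q g \<Longrightarrow> laurent q (\<lambda>t. f t - g t)"
  using laurent_add[OF _ laurent_uminus, of q f g] by simp

lemma laurent_power [laurent_intros]: "laurent q f \<Longrightarrow> laurent q (\<lambda>t. f t ^ n)"
  by (induction n) (auto intro: laurent_intros)

lemma laurent_ev:
  assumes "\<And>i. laurent q (\<lambda>t. x t i)"
  shows "laurent q (\<lambda>t. ev \<phi> (x t) e)"
  by (induction e) (auto intro: laurent_intros assms)

text \<open>The natural numbers are infinitely many rational arguments in characteristic 0, so
  \<open>p * q\<close> has too many roots; the factor \<open>q\<close> takes care of the arguments
  where nothing is assumed.\<close>

lemma laurent_eq_0:
  fixes g :: "'a::field_char_0 \<Rightarrow> 'a"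
  assumes "laurent q g" "q \<noteq> 0" "\<And>t. t \<in> \<rat> \<Longrightarrow> poly q t \<noteq> 0 \<Longrightarrow> g t = 0" "poly q t \<noteq> 0"
  shows "g t = 0"
proof -
  obtain p m where p: "\<And>t. poly q t \<noteq> 0 \<Longrightarrow> poly q t ^ m * g t = poly p t"
    using assms(1) by (auto simp: laurent_def)
  have "poly (p * q) t = 0" if "t \<in> \<rat>" for t
    using p[of t] assms(3)[OF that] by (cases "poly q t = 0") auto
  then have "poly (p * q) (of_nat n) = 0" for n by (metis Rats_of_nat)
  then have "range of_nat \<subseteq> {t. poly (p * q) t = 0}" by blast
  then have "infinite {t. poly (p * q) t = 0}"
    using infinite_super range_inj_infinite inj_of_nat by metis
  then have "p * q = 0" using poly_roots_finite by blast
  then show ?thesis using assms(2,4) p[of t] by simp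
qed

text \<open>Among all global fractions for \<open>h\<close>, one with a denominator of least degree
  is taken. If this denominator had a root away from the zeros of \<open>q\<close>, comparison with
  a fraction valid near the root would show that the numerator vanishes there too, and a linear
  factor would cancel. So its roots are roots of \<open>q\<close>, and it divides a power of
  \<open>q\<close>.\<close>

lemma locally_rational_line:
  fixes h :: "'a::{alg_closed_field, field_char_0} \<Rightarrow> 'a"
  assumes q: "q \<noteq> 0"
    and h: "\<And>x. poly q x \<noteq> 0 \<Longrightarrow>
      \<exists>F G. poly G x \<noteq> 0 \<and> (\<forall>z. poly q z \<noteq> 0 \<longrightarrow> poly G z \<noteq> 0 \<longrightarrow> h z = poly F z / poly G z)"
  shows "laurent q h"
proof -
  define P where "P G \<longleftrightarrow> G \<noteq> 0 \<and>
    (\<exists>F. \<forall>z. poly q z \<noteq> 0 \<longrightarrow> poly G z \<noteq> 0 \<longrightarrow> h z = poly F z / poly G z)" for G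
  obtain x where "poly q x \<noteq> 0"
    using q poly_all_0_iff_0 by blast
  then have "\<exists>G. P G"
    using h[of x] unfolding P_def by (metis poly_0)
  then obtain G where "P G" and min: "\<And>G'. P G' \<Longrightarrow> degree G \<le> degree G'"
    using ex_has_least_nat[of P _ degree] by blast
  then obtain F where G0: "G \<noteq> 0"
    and F: "\<And>z. poly q z \<noteq> 0 \<Longrightarrow> poly G z \<noteq> 0 \<Longrightarrow> h z = poly F z / poly G z"
    by (auto simp: P_def)
  have roots: "poly q r = 0" if r: "poly G r = 0" for r
  proof (rule ccontr)
    assume qr: "poly q r \<noteq> 0"
    then obtain F2 G2 where G2: "poly G2 r \<noteq> 0"
      and F2: "\<And>z. poly q z \<noteq> 0 \<Longrightarrow> poly G2 z \<noteq> 0 \<Longrightarrow> h z = poly F2 z / poly G2 z"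
      using h by blast
    have eq: "F * G2 = F2 * G"
    proof (rule poly_eqI_cofinite[of "q * G * G2"])
      show "q * G * G2 \<noteq> 0" using q G0 G2 by auto
      show "poly (F * G2) x = poly (F2 * G) x" if "poly (q * G * G2) x \<noteq> 0" for x
        using that F[of x] F2[of x] by (auto simp: field_simps)
    qed
    then have "poly F r * poly G2 r = 0"
      using r by (metis mult_zero_right poly_mult)
    with G2 have "poly F r = 0" by simp
    then obtain F' where F': "F = [:-r, 1:] * F'"
      by (auto simp: poly_eq_0_iff_dvd)
    obtain G' where G': "G = [:-r, 1:] * G'"
      using r by (auto simp: poly_eq_0_iff_dvd)
    with G0 have nz: "G' \<noteq> 0" by auto
    from eq have "[:-r, 1:] * (F' * G2) = [:-r, 1:] * (F2 * G')"
      unfolding F' G' by (simp only: mult.assoc mult.left_commute)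
    then have eq': "F' * G2 = F2 * G'"
      by (subst (asm) mult_left_cancel) auto
    have "h z = poly F' z / poly G' z" if z: "poly q z \<noteq> 0" "poly G' z \<noteq> 0" for z
    proof (cases "z = r")
      \<comment> \<open>The shortened fraction may be defined at \<open>r\<close> itself, where the
        old one said nothing; its value is checked against the local fraction.\<close>
      case True
      have "poly F' z * poly G2 z = poly F2 z * poly G' z"
        using eq' by (metis poly_mult)
      moreover have "h z * poly G2 z = poly F2 z"
        using F2[of z] G2 z True by simp
      ultimately have "poly G2 z * (h z * poly G' z - poly F' z) = 0"
        by (simp add: algebra_simps)
      then show ?thesis
        using G2 z True by (simp add: field_simps)
    next
      case False
      then show ?thesis
        using F[of z] z unfolding F' G' by (simp flip: left_diff_distrib)
    qed
    with nz have "P G'" by (auto simp: P_def)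
    moreover have "degree G = Suc (degree G')"
      unfolding G' using nz by (subst degree_mult_eq) auto
    ultimately show False using min[of G'] by simp
  qed
  then obtain m s where s: "q ^ m = G * s"
    using dvd_power_if_roots[OF G0] by (metis dvdE)
  have "poly q t ^ m * h t = poly (F * s) t" if t: "poly q t \<noteq> 0" for t
  proof -
    have *: "poly q t ^ m = poly G t * poly s t"
      using s by (metis poly_mult poly_power)
    then have "poly G t \<noteq> 0" using t by auto
    then show ?thesis using F[OF t] * by simp
  qed
  then show ?thesis unfolding laurent_def by blast
qed

lemma lagrange_interpolation:
  fixes p :: "'a::field poly"
  assumes "finite T" "degree p < card T"
  shows "poly p s = (\<Sum>t\<in>T. poly p t * poly (\<Prod>u\<in>T - {t}. smult (1 / (t - u)) [:-u, 1:]) s)"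
proof -
  define l where "l t = (\<Prod>u\<in>T - {t}. smult (1 / (t - u)) [:-u, 1:])" for t
  define r where "r = p - (\<Sum>t\<in>T. smult (poly p t) (l t))"
  have "degree (l t) < card T" if "t \<in> T" for t
  proof -
    have "degree (l t) \<le> (\<Sum>u\<in>T - {t}. degree (smult (1 / (t - u)) [:-u, 1:]))"
      unfolding l_def using assms(1) by (intro degree_prod_sum_le[unfolded o_def]) auto
    also have "\<dots> \<le> (\<Sum>u\<in>T - {t}. 1)"
      by (intro sum_mono) (auto intro: le_trans[OF degree_smult_le])
    finally show ?thesis
      using that assms by (auto simp: card_Diff_singleton)
  qed
  moreover have "card T > 0" using assms by linarith
  ultimately have deg: "degree r < card T"
    unfolding r_def using assms
    by (intro degree_diff_less degree_sum_less) (auto intro: le_less_trans[OF degree_smult_le])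
  have "poly r v = 0" if "v \<in> T" for v
  proof -
    have "poly (l t) v = (if t = v then 1 else 0)" if "t \<in> T" for t
    proof -
      have "poly (smult (1 / (t - u)) [:-u, 1:]) v = (v - u) / (t - u)" for u
        by (simp add: diff_divide_distrib)
      then have "poly (l t) v = (\<Prod>u\<in>T - {t}. (v - u) / (t - u))"
        by (simp only: l_def poly_prod)
      then show ?thesis
        using that \<open>v \<in> T\<close> assms(1) by (auto intro!: prod.neutral)
    qed
    then have "(\<Sum>t\<in>T. poly p t * poly (l t) v) = (\<Sum>t\<in>T. if t = v then poly p t else 0)"
      by (intro sum.cong) auto
    then show ?thesis
      using that assms(1) by (simp add: r_def poly_sum)
  qed
  have "r = 0"
  proof (rule ccontr)
    assume "r \<noteq> 0"
    have "card T \<le> card {x. poly r x = 0}"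
      using \<open>\<And>v. v \<in> T \<Longrightarrow> poly r v = 0\<close> poly_roots_finite[OF \<open>r \<noteq> 0\<close>] by (intro card_mono) auto
    then show False using card_poly_roots_bound[OF \<open>r \<noteq> 0\<close>] deg by simp
  qed
  then have "poly p s = poly (\<Sum>t\<in>T. smult (poly p t) (l t)) s" by (simp add: r_def)
  then show ?thesis by (simp add: poly_sum l_def)
qed

section \<open>From one variable to several: functions that are polynomial along coordinate
  lines\<close>

definition axis_poly :: "'a::comm_ring_1 poly \<Rightarrow> nat \<Rightarrow> 'a poly" where
  "axis_poly q i = (if i = 0 then q else 1)"

text \<open>Only coordinate 0 is ever inverted. With \<open>q = 1\<close> this is the whole space,
  with \<open>q = [:0, 1:]\<close> the chart where coordinate 0 is nonzero. Lines in the other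
  directions lie entirely inside or outside, so they need no denominators.\<close>

definition basic_open :: "'a::comm_ring_1 poly \<Rightarrow> (nat \<Rightarrow> 'a) set" where
  "basic_open q = {x. poly q (x 0) \<noteq> 0}"

definition polynomial_on_axes where
  "polynomial_on_axes q h \<longleftrightarrow> (\<forall>x i. (i \<noteq> 0 \<longrightarrow> x \<in> basic_open q) \<longrightarrow>
     laurent (axis_poly q i) (\<lambda>t. h (x(i := t))))"

lemma polynomial_on_axesE:
  assumes "polynomial_on_axes q h" "i \<noteq> 0 \<Longrightarrow> x \<in> basic_open q"
  obtains p m where "\<And>t. poly (axis_poly q i) t \<noteq> 0 \<Longrightarrow>
    poly (axis_poly q i) t ^ m * h (x(i := t)) = poly p t"
  using assms unfolding polynomial_on_axes_def laurent_def by blast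

text \<open>An identity theorem for functions known to be polynomial on each axis line only.
  Variables are freed one at a time: a slice in direction \<open>n\<close> is settled by induction
  if \<open>G\<close> is nonzero at its base point, and all but finitely many slices are of this
  kind.\<close>

lemma axis_zero_lemma:
  fixes G h :: "(nat \<Rightarrow> 'a::{alg_closed_field, field_char_0}) \<Rightarrow> 'a"
  assumes "q \<noteq> 0" "polyfun G" "polynomial_on_axes q h"
    and "x0 \<in> basic_open q" "G x0 \<noteq> 0"
    and "\<And>x. x \<in> basic_open q \<Longrightarrow> (\<And>i. i \<ge> n \<Longrightarrow> x i = x0 i) \<Longrightarrow> G x \<noteq> 0 \<Longrightarrow> h x = 0"
    and "x \<in> basic_open q" "\<And>i. i \<ge> n \<Longrightarrow> x i = x0 i"
  shows "h x = 0"
  using assms(4-)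
proof (induction n arbitrary: x0 x)
  case 0
  then have "x = x0" by auto
  with 0 show ?case by auto
next
  case (Suc n)
  obtain g where g: "\<And>t. G (x0(n := t)) = poly g t"
    using polyfun_axis[OF assms(2)] by meson
  obtain p m where p: "\<And>t. poly (axis_poly q n) t \<noteq> 0 \<Longrightarrow>
      poly (axis_poly q n) t ^ m * h (x(n := t)) = poly p t"
    using polynomial_on_axesE[OF assms(3), of n x] Suc.prems(4) by blast
  have "g \<noteq> 0" using g[of "x0 n"] Suc.prems(2) by auto
  moreover have ax: "axis_poly q n \<noteq> 0" using assms(1) by (auto simp: axis_poly_def)
  ultimately have nz: "axis_poly q n * g \<noteq> 0" by simp
  have "p = 0"
  proof (rule poly_eqI_cofinite[OF nz])
    fix t assume "poly (axis_poly q n * g) t \<noteq> 0"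
    then have t: "poly (axis_poly q n) t \<noteq> 0" "G (x0(n := t)) \<noteq> 0" by (auto simp: g)
    have "h (x(n := t)) = 0"
    proof (rule Suc.IH[of "x0(n := t)"])
      show "x0(n := t) \<in> basic_open q" "x(n := t) \<in> basic_open q"
        using t(1) Suc.prems(1,4) by (auto simp: basic_open_def axis_poly_def split: if_splits)
      show "h y = 0" if "y \<in> basic_open q" "\<And>i. n \<le> i \<Longrightarrow> y i = (x0(n := t)) i" "G y \<noteq> 0" for y
        using that by (intro Suc.prems(3)) auto
      show "(x(n := t)) i = (x0(n := t)) i" if "n \<le> i" for i
        using that Suc.prems(5) by auto
    qed (fact t(2))
    then show "poly p t = poly 0 t" using p[OF t(1)] by simp
  qed
  moreover have "poly (axis_poly q n) (x n) \<noteq> 0"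
    using Suc.prems(4) by (auto simp: basic_open_def axis_poly_def)
  ultimately show ?case using p[of "x n"] by simp
qed

lemma polynomial_on_axes_polyfun:
  fixes f :: "(nat \<Rightarrow> 'a::idom) \<Rightarrow> 'a"
  assumes "polyfun f"
  shows "polynomial_on_axes q f"
  unfolding polynomial_on_axes_def
proof (intro allI impI)
  fix x i
  obtain p where "\<And>t. f (x(i := t)) = poly p t"
    using polyfun_axis[OF assms] by meson
  then show "laurent (axis_poly q i) (\<lambda>t. f (x(i := t)))" by (simp add: laurent_poly)
qed

lemma polynomial_on_axes_mult:
  "polynomial_on_axes q f \<Longrightarrow> polynomial_on_axes q g \<Longrightarrow> polynomial_on_axes q (\<lambda>x. f x * g x)"
  and polynomial_on_axes_diff:
  "polynomial_on_axes q f \<Longrightarrow> polynomial_on_axes q g \<Longrightarrow> polynomial_on_axes q (\<lambda>x. f x - g x)"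
  by (simp_all add: polynomial_on_axes_def laurent_mult laurent_diff)

text \<open>
  Induction on the number of variables: a rational function which is polynomial along the last
  axis, of bounded degree, is recovered by interpolation from finitely many of its values.
\<close>

lemma rational_axis_polynomial:
  fixes F G h :: "(nat \<Rightarrow> 'a::{alg_closed_field, field_char_0}) \<Rightarrow> 'a"
  assumes q: "q \<noteq> 0" and "polyfun F" "polyfun G" and ax: "polynomial_on_axes q h"
    and "x0 \<in> basic_open q" "G x0 \<noteq> 0"
    and rep: "\<And>x. x \<in> basic_open q \<Longrightarrow> G x \<noteq> 0 \<Longrightarrow> h x * G x = F x"
  shows "\<exists>m E. polyfun E \<and>
    (\<forall>x\<in>basic_open q. (\<forall>i\<ge>n. x i = x0 i) \<longrightarrow> poly q (x 0) ^ m * h x = E x)"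
  using assms(5,6)
proof (induction n arbitrary: x0)
  case 0
  have "x = x0" if "\<forall>i\<ge>0. x i = x0 i" for x
    using that by auto
  then show ?case
    by (intro exI[of _ 0] exI[of _ "\<lambda>_. h x0"]) (auto intro: polyfun_intros)
next
  case (Suc n)
  show ?case
  proof (cases "n = 0")
    \<comment> \<open>Direction 0 is the only one with denominators, and there the axis hypothesis
      alone gives the claim.\<close>
    case True
    obtain p m where p: "\<And>t. poly q t \<noteq> 0 \<Longrightarrow> poly q t ^ m * h (x0(0 := t)) = poly p t"
      using ax[unfolded polynomial_on_axes_def, rule_format, of 0 x0] by (auto simp: axis_poly_def laurent_def)
    have "poly q (x 0) ^ m * h x = poly p (x 0)"
      if "x \<in> basic_open q" "\<forall>i\<ge>Suc n. x i = x0 i" for x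
    proof -
      have "x = x0(0 := x 0)" using that(2) True by (auto simp: Suc_le_eq)
      then show ?thesis using p[of "x 0"] that(1) by (auto simp: basic_open_def)
    qed
    then show ?thesis
      by (intro exI[of _ m] exI[of _ "\<lambda>x. poly p (x 0)"]) (auto intro: polyfun_intros)
  next
    case n: False
    obtain N where N: "\<And>x k. \<exists>p. degree p \<le> N \<and> (\<forall>t. F (x(k := t)) = poly p t)"
      using polyfun_axis[OF assms(2)] by blast
    obtain g where g: "\<And>t. G (x0(n := t)) = poly g t"
      using polyfun_axis[OF assms(3)] by meson
    have "g \<noteq> 0" using g[of "x0 n"] Suc.prems(2) by auto
    \<comment> \<open>The nodes avoid the zeros of \<open>G\<close> on the line through
      \<open>x0\<close>, so each slice has a base point to which the induction hypothesis
      applies.\<close>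
    then have "infinite (- {t. poly g t = 0})"
      using poly_roots_finite infinite_UNIV_char_0 by (metis finite_compl)
    then obtain T where T: "T \<subseteq> - {t. poly g t = 0}" "finite T" "card T = Suc N"
      by (metis infinite_arbitrarily_large)
    have "\<forall>t\<in>T. \<exists>m E. polyfun E \<and> (\<forall>x\<in>basic_open q. (\<forall>i\<ge>n. x i = (x0(n := t)) i) \<longrightarrow>
        poly q (x 0) ^ m * h x = E x)"
    proof
      fix t assume "t \<in> T"
      then have "G (x0(n := t)) \<noteq> 0" using T g by auto
      moreover have "x0(n := t) \<in> basic_open q"
        using Suc.prems(1) n by (simp add: basic_open_def)
      ultimately show "\<exists>m E. polyfun E \<and> (\<forall>x\<in>basic_open q. (\<forall>i\<ge>n. x i = (x0(n := t)) i) \<longrightarrow>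
          poly q (x 0) ^ m * h x = E x)"
        by (rule Suc.IH[rotated])
    qed
    then obtain m E where E: "\<And>t. t \<in> T \<Longrightarrow> polyfun (E t)"
      "\<And>t x. t \<in> T \<Longrightarrow> x \<in> basic_open q \<Longrightarrow> (\<And>i. i \<ge> n \<Longrightarrow> x i = (x0(n := t)) i) \<Longrightarrow>
        poly q (x 0) ^ m t * h x = E t x"
      by metis
    define M where "M = sum m T"
    define l where "l t = (\<Prod>u\<in>T - {t}. smult (1 / (t - u)) [:-u, 1:])" for t
    define E' where "E' x = (\<Sum>t\<in>T. poly q (x 0) ^ (M - m t) * E t (x(n := t)) * poly (l t) (x n))"
      for x
    have pE': "polyfun E'"
      unfolding E'_def by (intro polyfun_intros polyfun_upd E)
    have "poly q (x 0) ^ M * h x = E' x" if x: "x \<in> basic_open q" "\<forall>i\<ge>Suc n. x i = x0 i" for x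
    proof -
      \<comment> \<open>The degree of \<open>h\<close> along the axis is under control only at
        points where \<open>G\<close> is nonzero; the identity theorem extends the formula to the
        rest.\<close>
      have "poly q (x 0) ^ M * h x - E' x = 0"
      proof (rule axis_zero_lemma[OF q assms(3) _ Suc.prems _ x(1), of _ "Suc n"])
        show "polynomial_on_axes q (\<lambda>x. poly q (x 0) ^ M * h x - E' x)"
          by (intro polynomial_on_axes_diff polynomial_on_axes_mult ax polynomial_on_axes_polyfun pE'
              polyfun_intros)
        fix y assume y: "y \<in> basic_open q" "\<And>i. Suc n \<le> i \<Longrightarrow> y i = x0 i" "G y \<noteq> 0"
        have yo: "y(n := s) \<in> basic_open q" for s
          using y(1) n by (simp add: basic_open_def)
        obtain p where p: "\<And>s. h (y(n := s)) = poly p s"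
          using ax[unfolded polynomial_on_axes_def, rule_format, of n y] n y(1)
          by (auto simp: axis_poly_def laurent_def)
        obtain f where f: "degree f \<le> N" "\<And>s. F (y(n := s)) = poly f s"
          using N by meson
        obtain g' where g': "\<And>s. G (y(n := s)) = poly g' s"
          using polyfun_axis[OF assms(3)] by meson
        have g0: "g' \<noteq> 0" using g'[of "y n"] y(3) by auto
        \<comment> \<open>\<open>p\<close> divides the numerator, so the degree bound for
          \<open>F\<close> also bounds \<open>p\<close>, whatever the denominator is.\<close>
        have "p * g' = f"
        proof (rule poly_eqI_cofinite[OF g0])
          show "poly (p * g') s = poly f s" if "poly g' s \<noteq> 0" for s
            using rep[OF yo, of s] that by (simp add: p f(2) g')
        qed
        then have "degree p \<le> N"
          using f(1) g0 by (metis degree_0 degree_mult_eq le_add1 le_trans zero_le)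
        then have "poly p (y n) = (\<Sum>t\<in>T. poly p t * poly (l t) (y n))"
          unfolding l_def using T by (intro lagrange_interpolation) auto
        then have "poly q (y 0) ^ M * h y = (\<Sum>t\<in>T. poly q (y 0) ^ M * h (y(n := t)) * poly (l t) (y n))"
          using p[of "y n"] by (simp add: p sum_distrib_left mult_ac)
        also have "\<dots> = E' y"
          unfolding E'_def
        proof (intro sum.cong refl)
          fix t assume t: "t \<in> T"
          have "m t \<le> M" unfolding M_def using t T(2) by (intro member_le_sum) auto
          then have "poly q (y 0) ^ M = poly q (y 0) ^ (M - m t) * poly q (y 0) ^ m t"
            by (simp flip: power_add)
          moreover have "poly q ((y(n := t)) 0) ^ m t * h (y(n := t)) = E t (y(n := t))"
            using y(2) by (intro E(2) t yo) auto
          ultimately show "poly q (y 0) ^ M * h (y(n := t)) * poly (l t) (y n) =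
              poly q (y 0) ^ (M - m t) * E t (y(n := t)) * poly (l t) (y n)"
            using n by simp
        qed
        finally show "poly q (y 0) ^ M * h y - E' y = 0" by simp
      qed (use x in auto)
      then show ?thesis by simp
    qed
    then show ?thesis using pE' by blast
  qed
qed

text \<open>Local fractions restrict to local fractions on every axis line, where the one-variable
  result applies. The fraction at one point then serves as the global rational representation needed
  by \<open>rational_axis_polynomial\<close>.\<close>

lemma locally_rational_polynomial:
  fixes h :: "(nat \<Rightarrow> 'a::{alg_closed_field, field_char_0}) \<Rightarrow> 'a"
  assumes q: "q \<noteq> 0" and n: "n > 0"
    and h: "\<And>x. x \<in> basic_open q \<Longrightarrow> \<exists>F G. polyfun F \<and> polyfun G \<and> G x \<noteq> 0 \<and>
      (\<forall>z\<in>basic_open q. G z \<noteq> 0 \<longrightarrow> h z = F z / G z)"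
  shows "\<exists>m E. polyfun E \<and>
    (\<forall>x\<in>basic_open q. (\<forall>i\<ge>n. x i = 0) \<longrightarrow> poly q (x 0) ^ m * h x = E x)"
proof -
  have ax: "polynomial_on_axes q h"
    unfolding polynomial_on_axes_def
  proof (intro allI impI)
    fix x and i :: nat assume *: "i \<noteq> 0 \<longrightarrow> x \<in> basic_open q"
    have upd: "x(i := t) \<in> basic_open q" if "poly (axis_poly q i) t \<noteq> 0" for t
      using that * by (auto simp: axis_poly_def basic_open_def split: if_splits)
    show "laurent (axis_poly q i) (\<lambda>t. h (x(i := t)))"
    proof (rule locally_rational_line)
      show "axis_poly q i \<noteq> 0" using q by (simp add: axis_poly_def)
      fix t assume t: "poly (axis_poly q i) t \<noteq> 0"
      obtain F G where FG: "polyfun F" "polyfun G" "G (x(i := t)) \<noteq> 0"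
        "\<And>z. z \<in> basic_open q \<Longrightarrow> G z \<noteq> 0 \<Longrightarrow> h z = F z / G z"
        using h[OF upd[OF t]] by metis
      obtain f where f: "\<And>t. F (x(i := t)) = poly f t"
        using polyfun_axis[OF FG(1)] by meson
      obtain g where g: "\<And>t. G (x(i := t)) = poly g t"
        using polyfun_axis[OF FG(2)] by meson
      show "\<exists>F G. poly G t \<noteq> 0 \<and> (\<forall>z. poly (axis_poly q i) z \<noteq> 0 \<longrightarrow> poly G z \<noteq> 0 \<longrightarrow>
          h (x(i := z)) = poly F z / poly G z)"
        using FG(3) FG(4)[OF upd] by (intro exI[of _ f] exI[of _ g]) (simp add: f g)
    qed
  qed
  obtain c where c: "poly q c \<noteq> 0"
    using q poly_all_0_iff_0 by blast
  \<comment> \<open>Coordinate 0 must avoid the zeros of \<open>q\<close>. As \<open>n > 0\<close>,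
    agreeing with \<open>x0\<close> from index \<open>n\<close> on means vanishing there.\<close>
  define x0 where "x0 = (\<lambda>i::nat. 0)(0 := c)"
  have x0: "x0 \<in> basic_open q" using c by (simp add: x0_def basic_open_def)
  obtain F G where FG: "polyfun F" "polyfun G" "G x0 \<noteq> 0"
    "\<And>z. z \<in> basic_open q \<Longrightarrow> G z \<noteq> 0 \<Longrightarrow> h z = F z / G z"
    using h[OF x0] by metis
  have "\<exists>m E. polyfun E \<and>
    (\<forall>x\<in>basic_open q. (\<forall>i\<ge>n. x i = x0 i) \<longrightarrow> poly q (x 0) ^ m * h x = E x)"
    by (rule rational_axis_polynomial[OF q FG(1,2) ax x0 FG(3)]) (simp add: FG(4))
  then show ?thesis using n by (simp add: x0_def)
qed


subsection \<open>Embedding finitely generated rings into the complex numbers\<close>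

definition rational_subalgebra :: "'a::field_char_0 set \<Rightarrow> bool" where
  "rational_subalgebra R \<longleftrightarrow> range of_rat \<subseteq> R \<and> (\<forall>x\<in>R. \<forall>y\<in>R. x + y \<in> R \<and> x * y \<in> R)"

definition rational_hom :: "'a::field_char_0 set \<Rightarrow> ('a \<Rightarrow> 'b::field_char_0) \<Rightarrow> bool" where
  "rational_hom R \<phi> \<longleftrightarrow> (\<forall>r. \<phi> (of_rat r) = of_rat r) \<and>
     (\<forall>x\<in>R. \<forall>y\<in>R. \<phi> (x + y) = \<phi> x + \<phi> y \<and> \<phi> (x * y) = \<phi> x * \<phi> y)"

definition polys_over :: "'a::zero set \<Rightarrow> 'a poly set" where
  "polys_over R = {p. \<forall>i. coeff p i \<in> R}"

context
  fixes R :: "'a::field_char_0 set"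
  assumes R: "rational_subalgebra R"
begin

lemma rational_subalgebra_of_rat: "of_rat r \<in> R"
  using R by (auto simp: rational_subalgebra_def)

lemma rational_subalgebra_0: "0 \<in> R" and rational_subalgebra_1: "1 \<in> R"
  using rational_subalgebra_of_rat[of 0] rational_subalgebra_of_rat[of 1] by simp_all

lemma rational_subalgebra_add: "x \<in> R \<Longrightarrow> y \<in> R \<Longrightarrow> x + y \<in> R"
  and rational_subalgebra_mult: "x \<in> R \<Longrightarrow> y \<in> R \<Longrightarrow> x * y \<in> R"
  using R by (auto simp: rational_subalgebra_def)

lemma rational_subalgebra_diff: "x \<in> R \<Longrightarrow> y \<in> R \<Longrightarrow> x - y \<in> R"
  using rational_subalgebra_add[OF _ rational_subalgebra_mult[OF rational_subalgebra_of_rat[of "-1"]], of x y]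
  by simp

lemma rational_subalgebra_sum: "(\<And>i. i \<in> I \<Longrightarrow> f i \<in> R) \<Longrightarrow> sum f I \<in> R"
  by (induction I rule: infinite_finite_induct)
    (auto intro: rational_subalgebra_0 rational_subalgebra_add)

lemma polys_over_0: "0 \<in> polys_over R" and polys_over_1: "1 \<in> polys_over R"
  by (auto simp: polys_over_def coeff_1 rational_subalgebra_0 rational_subalgebra_1)

lemma polys_over_add: "p \<in> polys_over R \<Longrightarrow> q \<in> polys_over R \<Longrightarrow> p + q \<in> polys_over R"
  and polys_over_diff: "p \<in> polys_over R \<Longrightarrow> q \<in> polys_over R \<Longrightarrow> p - q \<in> polys_over R"
  and polys_over_smult: "c \<in> R \<Longrightarrow> q \<in> polys_over R \<Longrightarrow> smult c q \<in> polys_over R"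
  and polys_over_monom: "c \<in> R \<Longrightarrow> monom c n \<in> polys_over R"
  by (auto simp: polys_over_def rational_subalgebra_0 rational_subalgebra_add
      rational_subalgebra_diff rational_subalgebra_mult)

lemma polys_over_mult: "p \<in> polys_over R \<Longrightarrow> q \<in> polys_over R \<Longrightarrow> p * q \<in> polys_over R"
  by (auto simp: polys_over_def coeff_mult intro!: rational_subalgebra_sum rational_subalgebra_mult)

lemma polys_over_const: "c \<in> R \<Longrightarrow> [:c:] \<in> polys_over R"
  using polys_over_monom[of c 0] by (simp add: monom_0)

lemma polys_over_X: "[:0, 1:] \<in> polys_over R"
  using polys_over_monom[of 1 1] by (simp add: monom_altdef rational_subalgebra_1)

text \<open>\<open>R\<close> is a ring only, so each division step is preceded by multiplication
  with the leading coefficient of \<open>m\<close>; \<open>c\<close> collects these factors.\<close>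

lemma polys_over_pseudo_division:
  assumes "m \<in> polys_over R" "m \<noteq> 0" "p \<in> polys_over R"
  obtains c q r where "c \<in> R" "c \<noteq> 0" "q \<in> polys_over R" "r \<in> polys_over R"
    "smult c p = q * m + r" "r = 0 \<or> degree r < degree m"
proof -
  have "\<exists>c q r. c \<in> R \<and> c \<noteq> 0 \<and> q \<in> polys_over R \<and> r \<in> polys_over R \<and>
    smult c p = q * m + r \<and> (r = 0 \<or> degree r < degree m)"
    using assms(3)
  proof (induction "degree p" arbitrary: p rule: less_induct)
    case less
    show ?case
    proof (cases "p = 0 \<or> degree p < degree m")
      case True
      then show ?thesis using less.prems
        by (intro exI[of _ 1] exI[of _ 0] exI[of _ p]) (auto simp: rational_subalgebra_1 polys_over_0)
    next
      case False
      define s where "s = monom (lead_coeff p) (degree p - degree m)"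
      define p' where "p' = smult (lead_coeff m) p - s * m"
      have lc: "lead_coeff m \<in> R" "lead_coeff p \<in> R"
        using assms less.prems by (auto simp: polys_over_def)
      then have s: "s \<in> polys_over R" by (simp add: s_def polys_over_monom)
      then have p': "p' \<in> polys_over R"
        unfolding p'_def using assms less.prems lc
        by (intro polys_over_diff polys_over_smult polys_over_mult)
      have "degree s \<le> degree p - degree m"
        by (simp add: s_def degree_monom_le)
      then have "degree (s * m) \<le> degree p"
        using degree_mult_le[of s m] False by linarith
      then have "degree p' \<le> degree p"
        unfolding p'_def by (intro degree_diff_le) (auto intro: degree_smult_le)
      moreover have "coeff p' (degree p) = 0"
        using False by (simp add: p'_def s_def coeff_monom_mult)
      ultimately have "p' = 0 \<or> degree p' < degree p"
        using eq_zero_or_degree_less by blast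
      then obtain c q r where IH: "c \<in> R" "c \<noteq> 0" "q \<in> polys_over R" "r \<in> polys_over R"
        "smult c p' = q * m + r" "r = 0 \<or> degree r < degree m"
      proof
        assume "p' = 0"
        then show thesis
          using that[of 1 0 0] by (simp add: rational_subalgebra_1 polys_over_0)
      next
        assume "degree p' < degree p"
        then show thesis using less.hyps[OF _ p'] that by blast
      qed
      have "smult (c * lead_coeff m) p = (q + smult c s) * m + r"
      proof -
        have "smult c p' = smult (c * lead_coeff m) p - smult c s * m"
          by (simp add: p'_def smult_diff_right)
        with IH(5) show ?thesis by (simp add: algebra_simps)
      qed
      then show ?thesis
        using IH lc s assms(2)
        by (intro exI[of _ "c * lead_coeff m"] exI[of _ "q + smult c s"] exI[of _ r])
          (auto intro: polys_over_add polys_over_smult rational_subalgebra_mult)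
    qed
  qed
  then show thesis using that by blast
qed

lemma countable_polys_over:
  assumes "countable R"
  shows "countable (polys_over R)"
proof (rule countable_subset)
  show "polys_over R \<subseteq> Poly ` lists R"
  proof
    fix p assume "p \<in> polys_over R"
    then have "coeffs p \<in> lists R"
      by (auto simp: polys_over_def coeffs_def)
    then show "p \<in> Poly ` lists R"
      by (metis Poly_coeffs image_eqI)
  qed
  show "countable (Poly ` lists R)" using assms by simp
qed

context
  fixes \<phi> :: "'a \<Rightarrow> 'b::field_char_0"
  assumes \<phi>: "rational_hom R \<phi>" and inj: "inj_on \<phi> R"
begin

lemma rational_hom_of_rat: "\<phi> (of_rat r) = of_rat r"
  and rational_hom_add: "x \<in> R \<Longrightarrow> y \<in> R \<Longrightarrow> \<phi> (x + y) = \<phi> x + \<phi> y"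
  and rational_hom_mult: "x \<in> R \<Longrightarrow> y \<in> R \<Longrightarrow> \<phi> (x * y) = \<phi> x * \<phi> y"
  using \<phi> by (auto simp: rational_hom_def)

lemma rational_hom_0: "\<phi> 0 = 0"
  using rational_hom_of_rat[of 0] by simp

lemma rational_hom_eq_0: "x \<in> R \<Longrightarrow> \<phi> x = 0 \<longleftrightarrow> x = 0"
  using inj rational_hom_0 rational_subalgebra_0 by (metis inj_onD)

lemma rational_hom_sum: "(\<And>i. i \<in> I \<Longrightarrow> f i \<in> R) \<Longrightarrow> \<phi> (sum f I) = (\<Sum>i\<in>I. \<phi> (f i))"
  by (induction I rule: infinite_finite_induct)
    (auto simp: rational_hom_0 rational_hom_add rational_subalgebra_sum)

lemma map_poly_add_over: "p \<in> polys_over R \<Longrightarrow> q \<in> polys_over R \<Longrightarrow>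
    map_poly \<phi> (p + q) = map_poly \<phi> p + map_poly \<phi> q"
  by (rule poly_eqI) (simp add: coeff_map_poly rational_hom_0 rational_hom_add polys_over_def)

lemma map_poly_mult_over: "p \<in> polys_over R \<Longrightarrow> q \<in> polys_over R \<Longrightarrow>
    map_poly \<phi> (p * q) = map_poly \<phi> p * map_poly \<phi> q"
  by (rule poly_eqI) (simp add: coeff_map_poly rational_hom_0 rational_hom_mult polys_over_def
      coeff_mult rational_hom_sum rational_subalgebra_mult)

lemma map_poly_smult_over: "c \<in> R \<Longrightarrow> q \<in> polys_over R \<Longrightarrow>
    map_poly \<phi> (smult c q) = smult (\<phi> c) (map_poly \<phi> q)"
  by (rule poly_eqI) (simp add: coeff_map_poly rational_hom_0 rational_hom_mult polys_over_def)

lemma map_poly_eq_0_over: "p \<in> polys_over R \<Longrightarrow> map_poly \<phi> p = 0 \<longleftrightarrow> p = 0"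
  by (simp add: poly_eq_iff coeff_map_poly rational_hom_0 rational_hom_eq_0 polys_over_def)

lemma degree_map_poly_over: "p \<in> polys_over R \<Longrightarrow> degree (map_poly \<phi> p) = degree p"
proof (cases "p = 0")
  case False
  assume p: "p \<in> polys_over R"
  then have "coeff (map_poly \<phi> p) (degree p) \<noteq> 0"
    using False by (simp add: coeff_map_poly rational_hom_0 rational_hom_eq_0 polys_over_def)
  then show ?thesis
    by (intro antisym le_degree degree_le) (auto simp: coeff_map_poly rational_hom_0 coeff_eq_0)
qed simp

text \<open>Over the fraction field of \<open>R\<close>, \<open>m\<close> is a minimal polynomial of
  \<open>c\<close> and hence irreducible, so sending \<open>c\<close> to any root of its image is
  well defined and injective. Both directions are shown by pseudo-division over \<open>R\<close>,
  without passing to the fraction field.\<close>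

lemma generic_root_algebraic:
  assumes m: "m \<in> polys_over R" "m \<noteq> 0" "poly m c = 0"
    and min: "\<And>p. p \<in> polys_over R \<Longrightarrow> p \<noteq> 0 \<Longrightarrow> poly p c = 0 \<Longrightarrow> degree m \<le> degree p"
    and \<tau>: "poly (map_poly \<phi> m) \<tau> = 0" and p: "p \<in> polys_over R"
  shows "poly (map_poly \<phi> p) \<tau> = 0 \<longleftrightarrow> poly p c = 0"
proof
  assume pc: "poly p c = 0"
  obtain a q r where d: "a \<in> R" "a \<noteq> 0" "q \<in> polys_over R" "r \<in> polys_over R"
    "smult a p = q * m + r" "r = 0 \<or> degree r < degree m"
    using polys_over_pseudo_division[OF m(1,2) p] .
  have "poly (smult a p) c = poly (q * m + r) c" using d(5) by simp
  then have "poly r c = 0" using pc m(3) by simp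
  then have "r = 0" using min[OF d(4)] d(6) by fastforce
  with d have "smult (\<phi> a) (map_poly \<phi> p) = map_poly \<phi> q * map_poly \<phi> m"
    using p m(1) by (metis add.right_neutral map_poly_mult_over map_poly_smult_over)
  then have "\<phi> a * poly (map_poly \<phi> p) \<tau> = poly (map_poly \<phi> q) \<tau> * poly (map_poly \<phi> m) \<tau>"
    by (metis poly_mult poly_smult)
  then show "poly (map_poly \<phi> p) \<tau> = 0"
    using \<tau> d(1,2) by (simp add: rational_hom_eq_0)
next
  show "poly p c = 0" if "poly (map_poly \<phi> p) \<tau> = 0"
  proof (rule ccontr)
    assume "poly p c \<noteq> 0"
    \<comment> \<open>A counterexample \<open>s\<close> of least degree is shorter than
      \<open>m\<close>, by reduction modulo \<open>m\<close>. Dividing \<open>m\<close> by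
      \<open>s\<close> then leaves a remainder that vanishes at \<open>c\<close>, so the quotient
      vanishes at \<open>c\<close> as well and contradicts the choice of \<open>m\<close>.\<close>
    define P where "P p \<longleftrightarrow> p \<in> polys_over R \<and> poly (map_poly \<phi> p) \<tau> = 0 \<and> poly p c \<noteq> 0" for p
    have "P p" using that p \<open>poly p c \<noteq> 0\<close> by (simp add: P_def)
    then obtain s where s: "P s" and smin: "\<And>s'. P s' \<Longrightarrow> degree s \<le> degree s'"
      using ex_has_least_nat[of P p degree] by blast
    have sR: "s \<in> polys_over R" and s\<tau>: "poly (map_poly \<phi> s) \<tau> = 0" and sc: "poly s c \<noteq> 0"
      using s by (auto simp: P_def)
    then have s0: "s \<noteq> 0" by auto
    have less: "degree s < degree m"
    proof -
      obtain a q r where d: "a \<in> R" "a \<noteq> 0" "q \<in> polys_over R" "r \<in> polys_over R"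
        "smult a s = q * m + r" "r = 0 \<or> degree r < degree m"
        using polys_over_pseudo_division[OF m(1,2) sR] .
      have "poly (smult a s) c = poly (q * m + r) c" using d(5) by simp
      then have rc: "poly r c \<noteq> 0" using m(3) d(2) sc by auto
      have "smult (\<phi> a) (map_poly \<phi> s) = map_poly \<phi> q * map_poly \<phi> m + map_poly \<phi> r"
        using d sR m(1) by (metis map_poly_add_over map_poly_mult_over map_poly_smult_over polys_over_mult)
      then have "\<phi> a * poly (map_poly \<phi> s) \<tau> =
          poly (map_poly \<phi> q) \<tau> * poly (map_poly \<phi> m) \<tau> + poly (map_poly \<phi> r) \<tau>"
        by (metis poly_mult poly_smult poly_add)
      then have "P r" using s\<tau> \<tau> rc d(4) by (simp add: P_def)
      then show ?thesis using smin[of r] d(6) rc by auto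
    qed
    have deg_s: "degree s > 0"
    proof (rule ccontr)
      assume "\<not> degree s > 0"
      then obtain a where a: "s = [:a:]" by (meson degree_eq_zeroE neq0_conv)
      then have "a \<in> R" "a \<noteq> 0" using sR s0 by (auto simp: polys_over_def) (metis coeff_pCons_0)
      then show False using s\<tau> a by (simp add: map_poly_pCons rational_hom_0 rational_hom_eq_0)
    qed
    obtain a q r where d: "a \<in> R" "a \<noteq> 0" "q \<in> polys_over R" "r \<in> polys_over R"
      "smult a m = q * s + r" "r = 0 \<or> degree r < degree s"
      using polys_over_pseudo_division[OF sR s0 m(1)] .
    have "smult (\<phi> a) (map_poly \<phi> m) = map_poly \<phi> q * map_poly \<phi> s + map_poly \<phi> r"
      using d sR m(1) by (metis map_poly_add_over map_poly_mult_over map_poly_smult_over polys_over_mult)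
    then have "\<phi> a * poly (map_poly \<phi> m) \<tau> =
        poly (map_poly \<phi> q) \<tau> * poly (map_poly \<phi> s) \<tau> + poly (map_poly \<phi> r) \<tau>"
      by (metis poly_mult poly_smult poly_add)
    then have "poly (map_poly \<phi> r) \<tau> = 0" using s\<tau> \<tau> by simp
    then have "poly r c = 0"
      using smin[of r] d(4,6) unfolding P_def by fastforce
    moreover have "poly (smult a m) c = poly (q * s + r) c" using d(5) by simp
    ultimately have qc: "poly q c = 0" using m(3) sc by simp
    have rm: "degree r < degree m" using d(6) less deg_s by auto
    have "q \<noteq> 0"
    proof
      assume "q = 0"
      then have "degree r = degree m" using d(2,5) by (metis add_0 degree_smult_eq mult_zero_left)
      then show False using rm by simp
    qed
    moreover have "degree q < degree m"
    proof -
      have "degree (q * s) = degree (smult a m - r)" using d(5) by simp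
      also have "\<dots> \<le> degree m" using rm by (intro degree_diff_le) (auto intro: degree_smult_le)
      finally show ?thesis using \<open>q \<noteq> 0\<close> s0 deg_s by (simp add: degree_mult_eq)
    qed
    ultimately show False using min[OF d(3) _ qc] by simp
  qed
qed

end

text \<open>The new ring consists of the polynomial values at \<open>c\<close>. In the algebraic
  case \<open>c\<close> goes to a root of the image of its minimal polynomial; in the transcendental
  case its image avoids the roots of countably many nonzero polynomials. Either way
  \<open>\<tau>\<close> satisfies the same polynomial relations as \<open>c\<close>, which makes the
  extension well defined and injective.\<close>

lemma rational_hom_extend:
  fixes \<phi> :: "'a \<Rightarrow> complex"
  assumes "countable R" and \<phi>: "rational_hom R \<phi>" "inj_on \<phi> R"
  obtains R' and \<phi>' :: "'a \<Rightarrow> complex" where "insert c R \<subseteq> R'" "rational_subalgebra R'"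
    "countable R'" "rational_hom R' \<phi>'" "inj_on \<phi>' R'"
proof -
  note hom = map_poly_add_over[OF \<phi>] map_poly_mult_over[OF \<phi>]
  have "\<exists>\<tau>. \<forall>p\<in>polys_over R. poly (map_poly \<phi> p) \<tau> = 0 \<longleftrightarrow> poly p c = 0"
  proof (cases "\<exists>m\<in>polys_over R. m \<noteq> 0 \<and> poly m c = 0")
    case True
    then obtain m where m: "m \<in> polys_over R" "m \<noteq> 0" "poly m c = 0"
      and min: "\<And>p. p \<in> polys_over R \<Longrightarrow> p \<noteq> 0 \<Longrightarrow> poly p c = 0 \<Longrightarrow> degree m \<le> degree p"
      using ex_has_least_nat[of "\<lambda>m. m \<in> polys_over R \<and> m \<noteq> 0 \<and> poly m c = 0" _ degree] by blast
    have "degree m > 0"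
    proof (rule ccontr)
      assume "\<not> degree m > 0"
      then obtain a where "m = [:a:]" by (meson degree_eq_zeroE neq0_conv)
      with m show False by auto
    qed
    then have "degree (map_poly \<phi> m) > 0"
      by (simp add: degree_map_poly_over[OF \<phi>] m(1))
    then obtain \<tau> where "poly (map_poly \<phi> m) \<tau> = 0"
      using alg_closed_imp_poly_has_root by blast
    then show ?thesis
      using generic_root_algebraic[OF \<phi> m min] by blast
  next
    case False
    let ?B = "\<Union>p\<in>polys_over R - {0}. {x. poly (map_poly \<phi> p) x = 0}"
    have "countable ?B"
    proof (rule countable_UN)
      show "countable (polys_over R - {0})" using countable_polys_over assms(1) by simp
      show "countable {x. poly (map_poly \<phi> p) x = 0}" if "p \<in> polys_over R - {0}" for p
        using that poly_roots_finite[of "map_poly \<phi> p"] map_poly_eq_0_over[OF \<phi>, of p]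
        by (auto intro: countable_finite)
    qed
    then have "?B \<noteq> UNIV"
      using uncountable_UNIV_complex by metis
    then obtain \<tau> where "\<tau> \<notin> ?B" by blast
    then show ?thesis using False by (intro exI[of _ \<tau>]) auto
  qed
  then obtain \<tau> where \<tau>: "\<And>p. p \<in> polys_over R \<Longrightarrow> poly (map_poly \<phi> p) \<tau> = 0 \<longleftrightarrow> poly p c = 0"
    by blast
  define R' where "R' = (\<lambda>p. poly p c) ` polys_over R"
  \<comment> \<open>The value is read off from an arbitrary polynomial representing
    \<open>y\<close>; two such polynomials differ by one that vanishes at \<open>c\<close>, hence at
    \<open>\<tau>\<close> after mapping.\<close>
  define \<phi>' where "\<phi>' y = poly (map_poly \<phi> (SOME p. p \<in> polys_over R \<and> poly p c = y)) \<tau>" for y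
  have \<phi>': "\<phi>' (poly p c) = poly (map_poly \<phi> p) \<tau>" if p: "p \<in> polys_over R" for p
  proof -
    define p' where "p' = (SOME p'. p' \<in> polys_over R \<and> poly p' c = poly p c)"
    have p': "p' \<in> polys_over R" "poly p' c = poly p c"
      using someI[of "\<lambda>p'. p' \<in> polys_over R \<and> poly p' c = poly p c" p] p by (auto simp: p'_def)
    have "p' = p + (p' - p)" by simp
    then have "map_poly \<phi> p' = map_poly \<phi> p + map_poly \<phi> (p' - p)"
      using hom(1)[OF p polys_over_diff[OF p'(1) p]] by simp
    moreover have "poly (map_poly \<phi> (p' - p)) \<tau> = 0"
      using \<tau>[OF polys_over_diff[OF p'(1) p]] p'(2) by simp
    ultimately have "poly (map_poly \<phi> p') \<tau> = poly (map_poly \<phi> p) \<tau>" by simp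
    then show ?thesis by (simp add: \<phi>'_def p'_def)
  qed
  show thesis
  proof
    have "poly [:x:] c \<in> R'" if "x \<in> R" for x
      using polys_over_const[OF that] unfolding R'_def by blast
    moreover have "poly [:0, 1:] c \<in> R'"
      using polys_over_X unfolding R'_def by blast
    ultimately show sub: "insert c R \<subseteq> R'" by auto
    have "x + y \<in> R' \<and> x * y \<in> R'" if xy: "x \<in> R'" "y \<in> R'" for x y
    proof -
      obtain p q where "x = poly p c" "y = poly q c" "p \<in> polys_over R" "q \<in> polys_over R"
        using xy by (auto simp: R'_def)
      then have "x + y = poly (p + q) c" "x * y = poly (p * q) c" "p + q \<in> polys_over R"
        "p * q \<in> polys_over R"
        by (simp_all add: polys_over_add polys_over_mult)
      then show ?thesis
        unfolding R'_def by (intro conjI image_eqI[of _ _ "p + q"] image_eqI[of _ _ "p * q"]) auto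
    qed
    then show "rational_subalgebra R'"
      using sub rational_subalgebra_of_rat unfolding rational_subalgebra_def by blast
    show "countable R'" using countable_polys_over assms(1) by (simp add: R'_def)
    have "\<phi>' (of_rat r) = of_rat r" for r
      using \<phi>'[OF polys_over_const[OF rational_subalgebra_of_rat[of r]]]
      by (simp add: map_poly_pCons rational_hom_0[OF \<phi>] rational_hom_of_rat[OF \<phi>])
    moreover have "\<phi>' (x + y) = \<phi>' x + \<phi>' y \<and> \<phi>' (x * y) = \<phi>' x * \<phi>' y" if xy: "x \<in> R'" "y \<in> R'" for x y
    proof -
      obtain p q where pq: "x = poly p c" "y = poly q c" "p \<in> polys_over R" "q \<in> polys_over R"
        using xy by (auto simp: R'_def)
      then show ?thesis
        using \<phi>'[OF polys_over_add[OF pq(3,4)]] \<phi>'[OF polys_over_mult[OF pq(3,4)]]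
        by (simp add: \<phi>' hom)
    qed
    ultimately show "rational_hom R' \<phi>'" by (simp add: rational_hom_def)
    show "inj_on \<phi>' R'"
    proof (rule inj_onI)
      fix x y assume "x \<in> R'" "y \<in> R'" and eq: "\<phi>' x = \<phi>' y"
      then obtain p q where pq: "x = poly p c" "y = poly q c" "p \<in> polys_over R" "q \<in> polys_over R"
        by (auto simp: R'_def)
      have "p = q + (p - q)" by simp
      then have "map_poly \<phi> p = map_poly \<phi> q + map_poly \<phi> (p - q)"
        using hom(1)[OF pq(4) polys_over_diff[OF pq(3,4)]] by simp
      then have "poly (map_poly \<phi> (p - q)) \<tau> = 0"
        using eq pq \<phi>' by simp
      then show "x = y" using \<tau>[OF polys_over_diff[OF pq(3,4)]] pq by simp
    qed
  qed
qed

end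

text \<open>Induction over \<open>S\<close>, starting from the rationals. Countability and
  injectivity accompany the induction, as adjoining the next element relies on both.\<close>

theorem rational_hom_to_complex:
  fixes S :: "'a::field_char_0 set"
  assumes "finite S"
  obtains R and \<phi> :: "'a \<Rightarrow> complex" where "S \<subseteq> R" "rational_subalgebra R" "rational_hom R \<phi>"
proof -
  have "\<exists>R (\<phi> :: 'a \<Rightarrow> complex). S \<subseteq> R \<and> rational_subalgebra R \<and> countable R \<and>
      rational_hom R \<phi> \<and> inj_on \<phi> R"
    using assms
  proof induction
    case empty
    define \<phi> :: "'a \<Rightarrow> complex" where "\<phi> x = of_rat (inv_into UNIV of_rat x)" for x
    have \<phi>: "\<phi> (of_rat r) = of_rat r" for r
      by (simp add: \<phi>_def inv_f_f inj_def)
    have "rational_subalgebra (range of_rat :: 'a set)"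
      by (auto simp: rational_subalgebra_def simp flip: of_rat_add of_rat_mult)
    moreover have "rational_hom (range of_rat) \<phi>"
      by (auto simp: rational_hom_def \<phi> simp flip: of_rat_add of_rat_mult)
    moreover have "inj_on \<phi> (range of_rat)"
      by (auto simp: inj_on_def \<phi>)
    moreover have "countable (range of_rat :: 'a set)" by simp
    ultimately show ?case by blast
  next
    case (insert c S)
    then obtain R and \<phi> :: "'a \<Rightarrow> complex" where R: "S \<subseteq> R" "rational_subalgebra R" "countable R"
      "rational_hom R \<phi>" "inj_on \<phi> R"
      by blast
    from rational_hom_extend[OF R(2-5), of c] show ?case
      using R(1) by (metis (no_types, lifting) insert_subset order_trans)
  qed
  then show thesis using that by blast
qed


subsection \<open>The generic threefold is not affine space\<close>

text \<open>Composition stays on the level of expressions, as its coefficients must remain in the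
  ring on which \<open>\<phi>\<close> is a homomorphism.\<close>

primrec subst_expr :: "(nat \<Rightarrow> 'a expr) \<Rightarrow> 'a expr \<Rightarrow> 'a expr" where
  "subst_expr s (Const c) = Const c"
| "subst_expr s (Var i) = s i"
| "subst_expr s (Add e f) = Add (subst_expr s e) (subst_expr s f)"
| "subst_expr s (Mul e f) = Mul (subst_expr s e) (subst_expr s f)"

lemma ev_subst_expr: "ev \<phi> x (subst_expr s e) = ev \<phi> (\<lambda>i. ev \<phi> x (s i)) e"
  by (induction e) auto

lemma set_subst_expr: "set_expr (subst_expr s e) \<subseteq> set_expr e \<union> (\<Union>i. set_expr (s i))"
  by (induction e) auto

lemma continuous_on_ev [continuous_intros]:
  fixes x :: "'s::topological_space \<Rightarrow> nat \<Rightarrow> 'b::{comm_ring_1, real_normed_algebra}"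
  assumes "\<And>i. continuous_on S (\<lambda>s. x s i)"
  shows "continuous_on S (\<lambda>s. ev \<phi> (x s) e)"
  by (induction e) (auto intro!: continuous_intros assms)

text \<open>The variables are \<open>(X, Y, A, N, B)\<close>.\<close>

definition generic_threefold :: "(nat \<Rightarrow> 'a::comm_ring_1) set" where
  "generic_threefold = {v. v 0 * v 2 + v 1 * v 4 = 1 \<and>
     v 1 ^ 2 * v 2 + v 0 ^ 2 * v 4 - v 0 * v 1 * v 3 = 1 \<and> (\<forall>i\<ge>5. v i = 0)}"

text \<open>Eliminating A from the two equations gives X^3 B - X = Y c with c = X^2 N - Y + Y^2 B.
  Hence for X \<noteq> 0 first B, then N and A are determined by X, Y, c, and c is free even where Y
  = 0.\<close>

definition generic_chart :: "'a::field \<Rightarrow> 'a \<Rightarrow> 'a \<Rightarrow> nat \<Rightarrow> 'a" where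
  "generic_chart x y c =
     (let ix = inverse x; B = ix ^ 2 + y * c * ix ^ 3
      in ((((\<lambda>_. 0)(0 := x))(1 := y))(2 := (1 - y * B) * ix))
        (3 := (y - y ^ 2 * ix ^ 2 + (1 - y ^ 3 * ix ^ 3) * c) * ix ^ 2, 4 := B))"

lemma generic_chart_in:
  assumes "x \<noteq> 0"
  shows "generic_chart x y c \<in> generic_threefold"
proof -
  define ix where "ix = inverse x"
  have ix: "x * ix = 1" using assms by (simp add: ix_def)
  define B where "B = ix ^ 2 + y * c * ix ^ 3"
  define A where "A = (1 - y * B) * ix"
  define N where "N = (y - y ^ 2 * ix ^ 2 + (1 - y ^ 3 * ix ^ 3) * c) * ix ^ 2"
  have "x * A + y * B = 1"
    unfolding A_def using ix by Groebner_Basis.algebra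
  moreover have "y ^ 2 * A + x ^ 2 * B - x * y * N = 1"
    unfolding A_def N_def B_def using ix by Groebner_Basis.algebra
  moreover have "generic_chart x y c = ((((\<lambda>_. 0)(0 := x))(1 := y))(2 := A))(3 := N, 4 := B)"
    by (simp add: generic_chart_def Let_def A_def N_def B_def ix_def)
  ultimately show ?thesis by (simp add: generic_threefold_def)
qed

lemma generic_chart_coords:
  assumes "v \<in> generic_threefold" "v 0 \<noteq> 0"
  shows "v = generic_chart (v 0) (v 1) (v 0 ^ 2 * v 3 - v 1 + v 1 ^ 2 * v 4)"
proof -
  define c where "c = v 0 ^ 2 * v 3 - v 1 + v 1 ^ 2 * v 4"
  have 1: "v 0 * v 2 = 1 - v 1 * v 4"
    and 2: "v 0 * v 1 * v 3 = v 1 ^ 2 * v 2 + v 0 ^ 2 * v 4 - 1"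
    and 5: "\<And>i. i \<ge> 5 \<Longrightarrow> v i = 0"
    using assms(1) by (auto simp: generic_threefold_def algebra_simps)
  have "v 1 * c = v 0 ^ 3 * v 4 - v 0"
    unfolding c_def using 1 2 by Groebner_Basis.algebra
  then have B: "v 4 = inverse (v 0) ^ 2 + v 1 * c * inverse (v 0) ^ 3"
    using assms(2) by (simp add: field_simps power2_eq_square power3_eq_cube)
  have A: "v 2 = (1 - v 1 * v 4) * inverse (v 0)"
    using 1 assms(2) by (simp add: field_simps)
  have "v 3 = (v 0 ^ 2 * v 3) * inverse (v 0) ^ 2"
    using assms(2) by (simp add: power_inverse)
  also have "v 0 ^ 2 * v 3 = v 1 - v 1 ^ 2 * v 4 + c"
    by (simp add: c_def)
  also have "\<dots> = v 1 - v 1 ^ 2 * inverse (v 0) ^ 2 + (1 - v 1 ^ 3 * inverse (v 0) ^ 3) * c"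
    by (subst B) (simp add: algebra_simps power2_eq_square power3_eq_cube)
  finally have N: "v 3 = (v 1 - v 1 ^ 2 * inverse (v 0) ^ 2 + (1 - v 1 ^ 3 * inverse (v 0) ^ 3) * c)
      * inverse (v 0) ^ 2" .
  have "v i = generic_chart (v 0) (v 1) c i" for i
  proof -
    consider "i = 0" | "i = 1" | "i = 2" | "i = 3" | "i = 4" | "i \<ge> 5" by linarith
    then show ?thesis
      using A B N 5 by cases (auto simp: generic_chart_def Let_def)
  qed
  then show ?thesis unfolding c_def by blast
qed

lemma laurent_generic_chart [laurent_intros]:
  "laurent [:0, 1:] (\<lambda>x. generic_chart x y c i)"
  "laurent 1 (\<lambda>y. generic_chart x y c i)"
  "laurent 1 (\<lambda>c. generic_chart x y c i)"
proof -
  have upd: "laurent q (\<lambda>t. ((f t)(j := g t)) i)" if "laurent q (\<lambda>t. f t i)" "laurent q g"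
    for q and f :: "'a \<Rightarrow> nat \<Rightarrow> 'a" and g j
    using that by (cases "i = j") auto
  show "laurent [:0, 1:] (\<lambda>x. generic_chart x y c i)" "laurent 1 (\<lambda>y. generic_chart x y c i)"
    "laurent 1 (\<lambda>c. generic_chart x y c i)"
    unfolding generic_chart_def Let_def
    by ((rule upd)+, (rule laurent_const), (intro laurent_intros refl)+)+
qed

section \<open>Transfer of identities through rational points\<close>

context
  fixes R :: "'a::field_char_0 set" and \<phi> :: "'a \<Rightarrow> 'b::field_char_0"
  assumes R: "rational_subalgebra R" and \<phi>: "rational_hom R \<phi>"
begin

lemma rational_hom_ev:
  assumes "set_expr e \<subseteq> R" "\<And>i. x i \<in> R"
  shows "ev id x e \<in> R \<and> \<phi> (ev id x e) = ev \<phi> (\<lambda>i. \<phi> (x i)) e"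
  using assms(1)
proof (induction e)
  case (Add e f)
  then show ?case using \<phi> rational_subalgebra_add[OF R] by (simp add: rational_hom_def)
next
  case (Mul e f)
  then show ?case using \<phi> rational_subalgebra_mult[OF R] by (simp add: rational_hom_def)
qed (auto simp: assms(2))

text \<open>A point with rational coordinates exists over both fields and is fixed by
  \<open>\<phi>\<close>; this is the bridge between them.\<close>

lemma ev_eq_0_rational:
  assumes "set_expr e \<subseteq> R" "ev id (\<lambda>i. of_rat (r i)) e = 0"
  shows "ev \<phi> (\<lambda>i. of_rat (r i)) e = 0"
  using rational_hom_ev[OF assms(1), of "\<lambda>i. of_rat (r i)"] assms(2) \<phi> R
  by (simp add: rational_hom_def rational_subalgebra_of_rat) (metis of_rat_0)

lemma ev_eq_0_transfer:
  assumes "set_expr e \<subseteq> R" "\<And>x. ev id x e = 0" "\<And>i. i \<ge> n \<Longrightarrow> x i = 0"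
  shows "ev \<phi> x e = 0"
proof -
  \<comment> \<open>Weakening 0 to rational makes the induction possible: at stage \<open>n\<close>
    the coordinates below \<open>n\<close> are already arbitrary, and the next one is freed because
    a polynomial vanishing at all rationals is 0.\<close>
  have "ev \<phi> x e = 0" if "\<And>i. i \<ge> n \<Longrightarrow> x i \<in> \<rat>" for x
    using that
  proof (induction n arbitrary: x)
    case 0
    have "\<exists>q. x i = of_rat q" for i
      using 0[of i] by (auto elim: Rats_cases)
    then obtain r where "\<And>i. x i = of_rat (r i)" by metis
    then have "x = (\<lambda>i. of_rat (r i))" by auto
    then show ?case using ev_eq_0_rational[OF assms(1)] assms(2) by simp
  next
    case (Suc n)
    have "ev \<phi> (x(n := x n)) e = 0"
    proof (rule laurent_eq_0[of 1 "\<lambda>t. ev \<phi> (x(n := t)) e"])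
      show "laurent 1 (\<lambda>t. ev \<phi> (x(n := t)) e)"
      proof (intro laurent_ev)
        show "laurent 1 (\<lambda>t. (x(n := t)) i)" for i
          by (cases "i = n") (auto intro: laurent_intros)
      qed
      show "ev \<phi> (x(n := t)) e = 0" if "t \<in> \<rat>" for t
        using that Suc.prems by (intro Suc.IH) auto
    qed auto
    then show ?case by simp
  qed
  then show ?thesis using assms(3) by simp
qed

lemma generic_chart_of_rat:
  fixes x y c :: rat
  shows "generic_chart (of_rat x) (of_rat y) (of_rat c) i = (of_rat (generic_chart x y c i) :: 'c::field_char_0)"
  by (auto simp: generic_chart_def Let_def of_rat_add of_rat_mult of_rat_diff of_rat_power of_rat_inverse)

text \<open>Rational parameters give rational points of the chart. The parameters c, y, x are then
  freed in this order; only the last occurs with a denominator, hence \<open>[:0, 1:]\<close> for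
  it.\<close>

lemma ev_eq_0_transfer_chart:
  assumes "set_expr e \<subseteq> R" "\<And>v. v \<in> generic_threefold \<Longrightarrow> ev id v e = 0"
    and v: "v \<in> generic_threefold" "v 0 \<noteq> 0"
  shows "ev \<phi> v e = 0"
proof -
  have 1: "ev \<phi> (generic_chart (of_rat x) (of_rat y) (of_rat c)) e = 0" if "x \<noteq> 0" for x y c
  proof -
    have eq: "generic_chart (of_rat x) (of_rat y) (of_rat c) = (\<lambda>i. of_rat (generic_chart x y c i))"
      by (rule ext) (rule generic_chart_of_rat)
    have "ev id (\<lambda>i. of_rat (generic_chart x y c i)) e = 0"
      unfolding eq[symmetric] using that by (intro assms(2) generic_chart_in) simp
    then show ?thesis
      unfolding eq by (rule ev_eq_0_rational[OF assms(1)])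
  qed
  have 2: "ev \<phi> (generic_chart (of_rat x) (of_rat y) c) e = 0" if "x \<noteq> 0" for x y c
    by (rule laurent_eq_0[of 1 "\<lambda>c. ev \<phi> (generic_chart (of_rat x) (of_rat y) c) e"])
      (use 1 that in \<open>auto intro: laurent_ev laurent_intros elim!: Rats_cases\<close>)
  have 3: "ev \<phi> (generic_chart (of_rat x) y c) e = 0" if "x \<noteq> 0" for x y c
    by (rule laurent_eq_0[of 1 "\<lambda>y. ev \<phi> (generic_chart (of_rat x) y c) e"])
      (use 2 that in \<open>auto intro: laurent_ev laurent_intros elim!: Rats_cases\<close>)
  have 4: "ev \<phi> (generic_chart x y c) e = 0" if "x \<noteq> 0" for x y c
    by (rule laurent_eq_0[of "[:0, 1:]" "\<lambda>x. ev \<phi> (generic_chart x y c) e"])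
      (use 3 that in \<open>auto intro: laurent_ev laurent_intros elim!: Rats_cases\<close>)
  then show ?thesis
    using generic_chart_coords[OF v] v(2) by metis
qed

text \<open>Where X = 0, the equation X A + Y B = 1 forces Y \<noteq> 0, and the symmetry exchanging
  X with Y and A with B leads back to the first chart.\<close>

lemma ev_eq_0_transfer_threefold:
  assumes "set_expr e \<subseteq> R" "\<And>v. v \<in> generic_threefold \<Longrightarrow> ev id v e = 0"
    and v: "v \<in> generic_threefold"
  shows "ev \<phi> v e = 0"
proof (cases "v 0 = 0")
  case False
  then show ?thesis using ev_eq_0_transfer_chart[OF assms] by simp
next
  case True
  define \<pi> :: "nat \<Rightarrow> nat" where "\<pi> = id(0 := 1, 1 := 0, 2 := 4, 4 := 2)"
  have \<pi>\<pi>: "\<pi> (\<pi> i) = i" for i by (auto simp: \<pi>_def)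
  have \<pi>_in: "(\<lambda>i. w (\<pi> i)) \<in> generic_threefold" if "w \<in> generic_threefold" for w :: "nat \<Rightarrow> 'c::comm_ring_1"
    using that by (auto simp: generic_threefold_def \<pi>_def algebra_simps)
  have "ev \<phi> (\<lambda>i. v (\<pi> i)) (subst_expr (\<lambda>i. Var (\<pi> i)) e) = 0"
  proof (rule ev_eq_0_transfer_chart)
    show "set_expr (subst_expr (\<lambda>i. Var (\<pi> i)) e) \<subseteq> R"
      using set_subst_expr[of "\<lambda>i. Var (\<pi> i)" e] assms(1) by auto
    show "ev id w (subst_expr (\<lambda>i. Var (\<pi> i)) e) = 0" if "w \<in> generic_threefold" for w
      using assms(2)[OF \<pi>_in[OF that]] by (simp add: ev_subst_expr)
    show "(\<lambda>i. v (\<pi> i)) \<in> generic_threefold" by (rule \<pi>_in) fact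
    show "v (\<pi> 0) \<noteq> 0"
      using v True by (auto simp: \<pi>_def generic_threefold_def)
  qed
  then show ?thesis by (simp add: ev_subst_expr \<pi>\<pi>)
qed

end

text \<open>
  Projecting to \<open>(X, Y)\<close> makes the complex threefold a bundle of affine lines over
  \<open>\<complex>\<^sup>2 - {0}\<close>; this is a section over the unit sphere.
\<close>

definition generic_section :: "complex \<times> complex \<Rightarrow> nat \<Rightarrow> complex" where
  "generic_section s =
    (let x = fst s; y = snd s; f = x ^ 3 - y ^ 3;
         c = (1 - y ^ 2 * cnj x - x ^ 2 * cnj y) / (f * cnj f + x * y * cnj (x * y));
         w = c * cnj f
     in ((((\<lambda>_. 0)(0 := x))(1 := y))(2 := cnj x - y * w))(3 := - c * cnj (x * y), 4 := cnj y + x * w))"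

text \<open>The summands are |x^3 - y^3|^2 and |x y|^2, which vanish together only at the
  origin.\<close>

lemma generic_section_denominator:
  fixes x y :: complex
  assumes "norm (x, y) = 1"
  shows "(x ^ 3 - y ^ 3) * cnj (x ^ 3 - y ^ 3) + x * y * cnj (x * y) \<noteq> 0"
proof
  let ?f = "x ^ 3 - y ^ 3"
  assume "?f * cnj ?f + x * y * cnj (x * y) = 0"
  then have "complex_of_real ((cmod ?f)\<^sup>2 + (cmod (x * y))\<^sup>2) = 0"
    by (simp only: of_real_add complex_norm_square)
  then have "(cmod ?f)\<^sup>2 + (cmod (x * y))\<^sup>2 = 0"
    by (simp only: of_real_eq_0_iff)
  then have "cmod ?f = 0" "cmod (x * y) = 0"
    by (simp_all only: sum_power2_eq_zero_iff)
  then have "x = 0" "y = 0" by auto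
  with assms show False by simp
qed

text \<open>On the sphere (cnj x, cnj y) solves the first equation for (A, B), and the other
  solutions differ from it by w (-y, x). The second equation becomes (x^3 - y^3) w - x y N = 1 - y^2
  cnj x - x^2 cnj y, linear in (w, N); the section takes the solution proportional to the conjugated
  coefficient vector, with factor c.\<close>

lemma generic_section_in:
  assumes "s \<in> sphere 0 1"
  shows "generic_section s \<in> generic_threefold"
proof -
  obtain x y where s: "s = (x, y)" by (cases s)
  define f where "f = x ^ 3 - y ^ 3"
  define c where "c = (1 - y ^ 2 * cnj x - x ^ 2 * cnj y) / (f * cnj f + x * y * cnj (x * y))"
  have "norm (x, y) = 1" using assms s by simp
  then have n: "x * cnj x + y * cnj y = 1"
    using complex_norm_square[of x] complex_norm_square[of y]
    by (simp add: norm_Pair flip: of_real_power) (metis of_real_1 of_real_add)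
  have c: "c * (f * cnj f + x * y * cnj (x * y)) = 1 - y ^ 2 * cnj x - x ^ 2 * cnj y"
    using generic_section_denominator[OF \<open>norm (x, y) = 1\<close>] by (simp add: c_def f_def)
  have "y ^ 2 * (cnj x - y * (c * cnj f)) + x ^ 2 * (cnj y + x * (c * cnj f)) - x * y * (- c * cnj (x * y)) =
    y ^ 2 * cnj x + x ^ 2 * cnj y + c * (f * cnj f + x * y * cnj (x * y))"
    by (simp add: f_def algebra_simps power2_eq_square power3_eq_cube)
  also have "\<dots> = 1" unfolding c by simp
  finally have "y ^ 2 * (cnj x - y * (c * cnj f)) + x ^ 2 * (cnj y + x * (c * cnj f)) - x * y * (- c * cnj (x * y)) = 1" .
  moreover have "x * (cnj x - y * (c * cnj f)) + y * (cnj y + x * (c * cnj f)) = 1"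
    using n by (simp add: algebra_simps)
  moreover have "generic_section s = ((((\<lambda>_. 0)(0 := x))(1 := y))(2 := cnj x - y * (c * cnj f)))
      (3 := - c * cnj (x * y), 4 := cnj y + x * (c * cnj f))"
    by (simp add: generic_section_def Let_def s c_def f_def)
  ultimately show ?thesis by (simp add: generic_threefold_def)
qed

lemma continuous_on_generic_section:
  "continuous_on (sphere 0 1) (\<lambda>s. generic_section s i)"
proof -
  have upd: "continuous_on S (\<lambda>s. ((f s)(j := g s)) i)"
    if "continuous_on S (\<lambda>s. f s i)" "continuous_on S g"
    for S and f :: "complex \<times> complex \<Rightarrow> nat \<Rightarrow> complex" and g and j
    using that by (cases "i = j") auto
  show ?thesis
    unfolding generic_section_def Let_def
    by (intro upd continuous_intros) (use generic_section_denominator in force)+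
qed


section \<open>The contradiction on the 3-sphere\<close>

lemma finite_set_expr: "finite (set_expr e)"
  by (induction e) auto

text \<open>\<open>fX\<close> and \<open>fY\<close> are X and Y as functions of the affine
  coordinates, and \<open>fA\<close>, \<open>fB\<close> certify that they have no common zero.
  \<open>g\<close> expresses the affine coordinates on the threefold; they are padded by 0 from
  index 3 on.\<close>

theorem generic_threefold_not_affine_space:
  fixes fX fY fA fB :: "(nat \<Rightarrow> 'a::field_char_0) \<Rightarrow> 'a" and g :: "nat \<Rightarrow> (nat \<Rightarrow> 'a) \<Rightarrow> 'a"
  assumes poly: "polyfun fX" "polyfun fY" "polyfun fA" "polyfun fB" "\<And>i. polyfun (g i)"
    and unimodular: "\<And>x. fX x * fA x + fY x * fB x = 1"
    and inv: "\<And>v. v \<in> generic_threefold \<Longrightarrow> fX (\<lambda>i. if i < 3 then g i v else 0) = v 0"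
      "\<And>v. v \<in> generic_threefold \<Longrightarrow> fY (\<lambda>i. if i < 3 then g i v else 0) = v 1"
  shows False
proof -
  obtain eX eY eA eB where e: "\<And>x. fX x = ev id x eX" "\<And>x. fY x = ev id x eY"
    "\<And>x. fA x = ev id x eA" "\<And>x. fB x = ev id x eB"
    using poly(1-4) unfolding polyfun_def by blast
  obtain G where G: "\<And>i x. g i x = ev id x (G i)"
    using poly(5) unfolding polyfun_def by metis
  define s where "s i = (if i < 3 then G i else Const 0)" for i :: nat
  define S where "S = set_expr eX \<union> set_expr eY \<union> set_expr eA \<union> set_expr eB \<union> (\<Union>i<3. set_expr (G i))"
  have "finite S" by (simp add: S_def finite_set_expr)
  then obtain R and \<phi> :: "'a \<Rightarrow> complex" where SR: "S \<subseteq> R" and R: "rational_subalgebra R"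
    and \<phi>: "rational_hom R \<phi>"
    using rational_hom_to_complex by blast
  have const: "\<phi> 0 = 0" "\<phi> (- 1) = - 1" "- 1 \<in> R" "0 \<in> R"
    using \<phi> rational_subalgebra_of_rat[OF R, of 0] rational_subalgebra_of_rat[OF R, of "- 1"]
      of_rat_minus[of 1] of_rat_0 of_rat_1 unfolding rational_hom_def by metis+
  have sub: "set_expr (subst_expr s e) \<subseteq> R" if "set_expr e \<subseteq> R" for e
  proof -
    have "set_expr (s i) \<subseteq> R" for i
      using SR const by (auto simp: s_def S_def)
    then show ?thesis using set_subst_expr[of s e] that by blast
  qed
  have sg: "ev id v (subst_expr s e) = ev id (\<lambda>i. if i < 3 then g i v else 0) e" for v e
    unfolding ev_subst_expr by (rule arg_cong[of _ _ "\<lambda>x. ev id x e"]) (auto simp: s_def G)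
  have unimodular': "ev \<phi> x eX * ev \<phi> x eA + ev \<phi> x eY * ev \<phi> x eB = 1"
    if "\<And>i. i \<ge> 3 \<Longrightarrow> x i = 0" for x
  proof -
    have "ev \<phi> x (Add (Mul eX eA) (Add (Mul eY eB) (Const (- 1)))) = 0"
      using SR const unimodular
      by (intro ev_eq_0_transfer[OF R \<phi> _ _ that]) (auto simp: S_def e algebra_simps)
    then show ?thesis by (simp add: const algebra_simps)
  qed
  have inv': "ev \<phi> v (subst_expr s eX) = v 0" "ev \<phi> v (subst_expr s eY) = v 1"
    if v: "v \<in> generic_threefold" for v
  proof -
    have "ev \<phi> v (Add (subst_expr s eX) (Mul (Const (- 1)) (Var 0))) = 0"
      using SR const inv(1) sub[of eX]
      by (intro ev_eq_0_transfer_threefold[OF R \<phi> _ _ v]) (auto simp: S_def sg e)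
    then show "ev \<phi> v (subst_expr s eX) = v 0" by (simp add: const)
    have "ev \<phi> v (Add (subst_expr s eY) (Mul (Const (- 1)) (Var 1))) = 0"
      using SR const inv(2) sub[of eY]
      by (intro ev_eq_0_transfer_threefold[OF R \<phi> _ _ v]) (auto simp: S_def sg e)
    then show "ev \<phi> v (subst_expr s eY) = v 1" by (simp add: const)
  qed
  define pt :: "complex \<times> complex \<times> complex \<Rightarrow> nat \<Rightarrow> complex" where
    "pt t i = (if i = 0 then fst t else if i = 1 then fst (snd t) else if i = 2 then snd (snd t) else 0)"
    for t i
  \<comment> \<open>\<open>f\<close> maps the sphere to \<complex>^3 through the section,
    \<open>h\<close> maps \<complex>^3 to \<complex>^2 - {0}, and \<open>k\<close> normalises to
    length 1. The composite of \<open>f\<close> and \<open>k\<close> is the identity of the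
    sphere.\<close>
  define f where "f p = (let w = (\<lambda>i. ev \<phi> (generic_section p) (s i)) in (w 0, w 1, w 2))" for p
  define h where "h t = (ev \<phi> (pt t) eX, ev \<phi> (pt t) eY)" for t
  define k where "k t = h t /\<^sub>R norm (h t)" for t
  have h0: "h t \<noteq> 0" for t
    using unimodular'[of "pt t"] by (auto simp: h_def pt_def zero_prod_def)
  have contpt: "continuous_on UNIV (\<lambda>t. pt t i)" for i
    unfolding pt_def by (cases "i = 0"; cases "i = 1"; cases "i = 2") (auto intro!: continuous_intros)
  have "continuous_on UNIV h"
    unfolding h_def by (intro continuous_intros contpt)
  then have contk: "continuous_on UNIV k"
    unfolding k_def using h0 by (intro continuous_intros) auto
  have contf: "continuous_on (sphere 0 1) f"
    unfolding f_def Let_def by (intro continuous_intros continuous_on_generic_section)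
  have kf: "k (f p) = p" if p: "p \<in> sphere 0 1" for p
  proof -
    have "pt (f p) = (\<lambda>i. ev \<phi> (generic_section p) (s i))"
      by (rule ext) (auto simp: pt_def f_def Let_def s_def const)
    then have "h (f p) = (generic_section p 0, generic_section p 1)"
      using inv'[OF generic_section_in[OF p]] by (simp add: h_def ev_subst_expr)
    also have "\<dots> = p" by (simp add: generic_section_def Let_def)
    finally show ?thesis using p by (simp add: k_def)
  qed
  obtain c where "homotopic_with_canon (\<lambda>_. True) (sphere 0 1) (sphere 0 1) (k \<circ> f) (\<lambda>x. c)"
  proof (rule nullhomotopic_through_contractible[OF contf _ contk])
    show "k \<in> UNIV \<rightarrow> sphere 0 1" using h0 by (auto simp: k_def)
  qed auto
  then have "homotopic_with_canon (\<lambda>_. True) (sphere 0 1) (sphere 0 1) id (\<lambda>x. c)"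
    by (rule homotopic_with_eq) (auto simp: kf)
  then have "contractible (sphere (0 :: complex \<times> complex) 1)"
    unfolding contractible_def by blast
  then show False by (simp add: contractible_sphere)
qed


subsection \<open>Evaluation of polynomials\<close>

definition monomial_eval :: "('v \<Rightarrow>\<^sub>0 nat) \<Rightarrow> ('v \<Rightarrow> 'c::comm_semiring_1) \<Rightarrow> 'c" where
  "monomial_eval m x = (\<Prod>i\<in>Poly_Mapping.keys m. x i ^ Poly_Mapping.lookup m i)"

lemma monomial_eval_superset:
  assumes "finite A" "Poly_Mapping.keys m \<subseteq> A"
  shows "monomial_eval m x = (\<Prod>i\<in>A. x i ^ Poly_Mapping.lookup m i)"
  unfolding monomial_eval_def using assms
  by (intro prod.mono_neutral_left) (auto simp: in_keys_iff)

lemma monomial_eval_add: "monomial_eval (m + n) x = monomial_eval m x * monomial_eval n x"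
proof -
  let ?A = "Poly_Mapping.keys m \<union> Poly_Mapping.keys n"
  have "Poly_Mapping.keys (m + n) \<subseteq> ?A" by (rule Poly_Mapping.keys_add)
  then show ?thesis
    by (simp add: monomial_eval_superset[of ?A] lookup_add power_add prod.distrib)
qed

lemma monomial_eval_scale:
  fixes m :: "'v::finite \<Rightarrow>\<^sub>0 nat"
  shows "monomial_eval m (\<lambda>i. s i * x i) = (\<Prod>i\<in>UNIV. s i ^ Poly_Mapping.lookup m i) * monomial_eval m x"
  by (simp add: monomial_eval_superset[of UNIV] power_mult_distrib prod.distrib)

lemma mpoly_eval_altdef:
  "mpoly_eval F x = (\<Sum>m\<in>Poly_Mapping.keys F. to_ac (Poly_Mapping.lookup F m) * monomial_eval m x)"
  by (simp add: mpoly_eval_def monomial_eval_def)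

lemma mpoly_eval_zero: "mpoly_eval 0 x = 0"
  by (simp add: mpoly_eval_def)

lemma mpoly_eval_add: "mpoly_eval (F + G) x = mpoly_eval F x + mpoly_eval G x"
  unfolding mpoly_eval_altdef by (rule setsum_keys_plus_distrib) (simp_all add: distrib_right)

lemma mpoly_eval_sum: "mpoly_eval (sum F A) x = (\<Sum>a\<in>A. mpoly_eval (F a) x)"
  by (induction A rule: infinite_finite_induct) (simp_all add: mpoly_eval_zero mpoly_eval_add)

lemma mpoly_eval_single: "mpoly_eval (Poly_Mapping.single m c) x = to_ac c * monomial_eval m x"
  by (cases "c = 0") (simp_all add: mpoly_eval_altdef)

lemma mpoly_eval_const: "mpoly_eval (Poly_Mapping.single 0 c) x = to_ac c"
  by (simp add: mpoly_eval_single monomial_eval_def)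

lemma mpoly_eval_var: "mpoly_eval (Poly_Mapping.single (Poly_Mapping.single i 1) 1) x = x i"
  by (simp add: mpoly_eval_single monomial_eval_def)

lemma sum_single_keys: "(\<Sum>m\<in>Poly_Mapping.keys F. Poly_Mapping.single m (Poly_Mapping.lookup F m)) = F"
proof (rule poly_mapping_eqI)
  fix k
  have "(\<Sum>m\<in>Poly_Mapping.keys F. Poly_Mapping.lookup (Poly_Mapping.single m (Poly_Mapping.lookup F m)) k)
     = (\<Sum>m\<in>Poly_Mapping.keys F. if m = k then Poly_Mapping.lookup F k else 0)"
    by (intro sum.cong) (auto simp: lookup_single)
  then show "Poly_Mapping.lookup (\<Sum>m\<in>Poly_Mapping.keys F. Poly_Mapping.single m (Poly_Mapping.lookup F m)) k
      = Poly_Mapping.lookup F k"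
    by (simp add: lookup_sum in_keys_iff)
qed

lemma mpoly_eval_mult: "mpoly_eval (F * G) x = mpoly_eval F x * mpoly_eval G x"
proof -
  let ?s = "\<lambda>F m. Poly_Mapping.single m (Poly_Mapping.lookup F m)"
  have "F * G = (\<Sum>m\<in>Poly_Mapping.keys F. \<Sum>n\<in>Poly_Mapping.keys G. ?s F m * ?s G n)"
    unfolding sum_product[symmetric] sum_single_keys ..
  then have "mpoly_eval (F * G) x =
      (\<Sum>m\<in>Poly_Mapping.keys F. \<Sum>n\<in>Poly_Mapping.keys G. mpoly_eval (?s F m * ?s G n) x)"
    by (simp only: mpoly_eval_sum)
  also have "\<dots> = mpoly_eval F x * mpoly_eval G x"
    unfolding mpoly_eval_altdef[of F] mpoly_eval_altdef[of G] sum_product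
    by (simp add: mult_single mpoly_eval_single monomial_eval_add mult_ac)
  finally show ?thesis .
qed

text \<open>Evaluation is built from sums and products of constants of \<open>k\<close> and values
  of variables. With polynomial functions, germs, germs killed by a derivation, or polynomials on a
  line as \<open>C\<close>, this replaces separate inductions.\<close>

lemma mpoly_eval_closure:
  fixes F :: "('v, 'k::field) mpoly"
  assumes const: "\<And>c. C (\<lambda>_. to_ac (c :: 'k))"
    and add: "\<And>f g. C f \<Longrightarrow> C g \<Longrightarrow> C (\<lambda>z. f z + g z)"
    and mult: "\<And>f g. C f \<Longrightarrow> C g \<Longrightarrow> C (\<lambda>z. f z * g z)"
    and w: "\<And>i. C (w i)"
  shows "C (\<lambda>z. mpoly_eval F (\<lambda>i. w i z))"
proof -
  have sum: "C (\<lambda>z. \<Sum>a\<in>A. f a z)" if "\<And>a. C (f a)" for f and A :: "('v \<Rightarrow>\<^sub>0 nat) set"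
    using that const[of 0] by (induction A rule: infinite_finite_induct) (auto intro: add)
  have power: "C (\<lambda>z. f z ^ n)" if "C f" for f and n :: nat
    using that const[of 1] by (induction n) (auto intro: mult)
  have prod: "C (\<lambda>z. \<Prod>a\<in>A. f a z)" if "\<And>a. C (f a)" for f and A :: "'v set"
    using that const[of 1] by (induction A rule: infinite_finite_induct) (auto intro: mult)
  show ?thesis
    unfolding mpoly_eval_def by (intro sum mult const prod power w)
qed

lemma polyfun_mpoly_eval:
  fixes F :: "('v, 'k::field) mpoly"
  assumes "\<And>i. polyfun (w i)"
  shows "polyfun (\<lambda>x. mpoly_eval F (\<lambda>i. w i x))"
  by (rule mpoly_eval_closure[where C = polyfun]) (auto intro: polyfun_intros assms)

lemma homogeneous_in_add: "homogeneous_in S d F \<Longrightarrow> homogeneous_in S d G \<Longrightarrow> homogeneous_in S d (F + G)"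
  using Poly_Mapping.keys_add[of F G] by (auto simp: homogeneous_in_def)

lemma homogeneous_in_mult:
  assumes "homogeneous_in S d F" "homogeneous_in S e G"
  shows "homogeneous_in S (d + e) (F * G)"
  unfolding homogeneous_in_def
proof
  fix m assume "m \<in> Poly_Mapping.keys (F * G)"
  then obtain a b where "m = a + b" "a \<in> Poly_Mapping.keys F" "b \<in> Poly_Mapping.keys G"
    using keys_mult[of F G] by blast
  then show "(\<Sum>i\<in>S. Poly_Mapping.lookup m i) = d + e"
    using assms by (simp add: homogeneous_in_def lookup_add sum.distrib)
qed

lemma homogeneous_in_const: "homogeneous_in S 0 (Poly_Mapping.single 0 c)"
  by (auto simp: homogeneous_in_def split: if_splits)

lemma homogeneous_in_var:
  assumes "finite S"
  shows "homogeneous_in S (if i \<in> S then 1 else 0) (Poly_Mapping.single (Poly_Mapping.single i 1) c)"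
  using assms by (auto simp: homogeneous_in_def lookup_single when_def split: if_splits)

lemma mpoly_eval_homogeneous:
  fixes F :: "('v::finite, 'k::field) mpoly"
  assumes "homogeneous_in UNIV d F"
  shows "mpoly_eval F (\<lambda>i. c * v i) = c ^ d * mpoly_eval F v"
  unfolding mpoly_eval_altdef sum_distrib_left
proof (intro sum.cong refl)
  fix m assume "m \<in> Poly_Mapping.keys F"
  then have "(\<Prod>i\<in>UNIV. c ^ Poly_Mapping.lookup m i) = c ^ d"
    using assms by (simp add: homogeneous_in_def flip: power_sum)
  then show "to_ac (Poly_Mapping.lookup F m) * monomial_eval m (\<lambda>i. c * v i) =
      c ^ d * (to_ac (Poly_Mapping.lookup F m) * monomial_eval m v)"
    by (simp add: monomial_eval_scale mult_ac)
qed

lemma mpoly_eval_bihomogeneous: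
  fixes F :: "('m::finite + 'n::finite, 'k::field) mpoly"
  assumes "bihomogeneous d e F"
  shows "mpoly_eval F (case_sum (\<lambda>i. c * v i) (\<lambda>j. c' * w j)) =
    c ^ d * c' ^ e * mpoly_eval F (case_sum v w)"
  unfolding mpoly_eval_altdef sum_distrib_left
proof (intro sum.cong refl)
  fix m assume m: "m \<in> Poly_Mapping.keys F"
  define s :: "'m + 'n \<Rightarrow> 'k alg_closure" where "s = case_sum (\<lambda>_. c) (\<lambda>_. c')"
  have eq: "case_sum (\<lambda>i. c * v i) (\<lambda>j. c' * w j) = (\<lambda>i. s i * case_sum v w i)"
    by (rule ext) (simp add: s_def split: sum.splits)
  have "(\<Prod>i\<in>UNIV. s i ^ Poly_Mapping.lookup m i) =
      (\<Prod>i\<in>range Inl. s i ^ Poly_Mapping.lookup m i) * (\<Prod>i\<in>range Inr. s i ^ Poly_Mapping.lookup m i)"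
    unfolding UNIV_sum by (rule prod.union_disjoint) auto
  also have "\<dots> = (\<Prod>i\<in>range Inl. c ^ Poly_Mapping.lookup m i) * (\<Prod>i\<in>range Inr. c' ^ Poly_Mapping.lookup m i)"
    by (intro arg_cong2[of _ _ _ _ "(*)"] prod.cong) (auto simp: s_def)
  also have "\<dots> = c ^ d * c' ^ e"
    using assms m by (simp add: bihomogeneous_def homogeneous_in_def flip: power_sum)
  finally show "to_ac (Poly_Mapping.lookup F m) * monomial_eval m (case_sum (\<lambda>i. c * v i) (\<lambda>j. c' * w j)) =
      c ^ d * c' ^ e * (to_ac (Poly_Mapping.lookup F m) * monomial_eval m (case_sum v w))"
    unfolding eq monomial_eval_scale by (simp add: mult_ac)
qed


subsection \<open>Local rings\<close>

text \<open>A common shape for the local rings of affine space and of products of projective spaces.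
  Affine space gets a dummy grading in which every degree contains all polynomials.\<close>

definition fraction_stalk :: "('d \<Rightarrow> ('p \<Rightarrow> 'c::field) set) \<Rightarrow> 'p \<Rightarrow> ('p \<Rightarrow> 'c) set" where
  "fraction_stalk P x = {f. \<exists>d. \<exists>F\<in>P d. \<exists>G\<in>P d. G x \<noteq> 0 \<and> (\<forall>z. G z \<noteq> 0 \<longrightarrow> f z = F z / G z)}"

lemma fraction_stalkI:
  assumes "F \<in> P d" "G \<in> P d" "G x \<noteq> 0" "\<And>z. G z \<noteq> 0 \<Longrightarrow> f z = F z / G z"
  shows "f \<in> fraction_stalk P x"
  using assms unfolding fraction_stalk_def by blast

lemma fraction_stalkE:
  assumes "f \<in> fraction_stalk P x"
  obtains d F G where "F \<in> P d" "G \<in> P d" "G x \<noteq> 0" "\<And>z. G z \<noteq> 0 \<Longrightarrow> f z = F z / G z"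
  using assms unfolding fraction_stalk_def by blast

locale graded_functions =
  fixes P :: "'d::comm_monoid_add \<Rightarrow> ('p \<Rightarrow> 'k::field alg_closure) set"
  assumes add: "F \<in> P d \<Longrightarrow> G \<in> P d \<Longrightarrow> (\<lambda>z. F z + G z) \<in> P d"
    and mult: "F \<in> P d \<Longrightarrow> G \<in> P e \<Longrightarrow> (\<lambda>z. F z * G z) \<in> P (d + e)"
    and const: "(\<lambda>_. to_ac c) \<in> P 0"
begin

lemma smult: "F \<in> P d \<Longrightarrow> (\<lambda>z. to_ac c * F z) \<in> P d"
  using mult[OF const, of F d c] by simp

lemma diff: "F \<in> P d \<Longrightarrow> G \<in> P d \<Longrightarrow> (\<lambda>z. F z - G z) \<in> P d"
  using add[OF _ smult[of G d "- 1"], of F] by simp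

lemma stalk_ratio: "F \<in> P d \<Longrightarrow> G \<in> P d \<Longrightarrow> G x \<noteq> 0 \<Longrightarrow> (\<lambda>z. F z / G z) \<in> fraction_stalk P x"
  by (rule fraction_stalkI) auto

lemma stalk_const: "(\<lambda>_. to_ac c) \<in> fraction_stalk P x"
  using stalk_ratio[OF const[of c] const[of 1]] by simp

lemma stalk_add:
  assumes "f \<in> fraction_stalk P x" "g \<in> fraction_stalk P x"
  shows "(\<lambda>z. f z + g z) \<in> fraction_stalk P x"
proof -
  obtain d F G where f: "F \<in> P d" "G \<in> P d" "G x \<noteq> 0" "\<And>z. G z \<noteq> 0 \<Longrightarrow> f z = F z / G z"
    using fraction_stalkE[OF assms(1)] by metis
  obtain e F' G' where g: "F' \<in> P e" "G' \<in> P e" "G' x \<noteq> 0" "\<And>z. G' z \<noteq> 0 \<Longrightarrow> g z = F' z / G' z"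
    using fraction_stalkE[OF assms(2)] by metis
  show ?thesis
  proof (rule fraction_stalkI)
    show "(\<lambda>z. F z * G' z + G z * F' z) \<in> P (d + e)"
      using f g by (intro add mult)
    show "(\<lambda>z. G z * G' z) \<in> P (d + e)" using f g by (intro mult)
  qed (use f g in \<open>auto simp: add_frac_eq mult_ac\<close>)
qed

lemma stalk_mult:
  assumes "f \<in> fraction_stalk P x" "g \<in> fraction_stalk P x"
  shows "(\<lambda>z. f z * g z) \<in> fraction_stalk P x"
proof -
  obtain d F G where f: "F \<in> P d" "G \<in> P d" "G x \<noteq> 0" "\<And>z. G z \<noteq> 0 \<Longrightarrow> f z = F z / G z"
    using fraction_stalkE[OF assms(1)] by metis
  obtain e F' G' where g: "F' \<in> P e" "G' \<in> P e" "G' x \<noteq> 0" "\<And>z. G' z \<noteq> 0 \<Longrightarrow> g z = F' z / G' z"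
    using fraction_stalkE[OF assms(2)] by metis
  show ?thesis
  proof (rule fraction_stalkI)
    show "(\<lambda>z. F z * F' z) \<in> P (d + e)" "(\<lambda>z. G z * G' z) \<in> P (d + e)"
      using f g by (auto intro: mult)
  qed (use f g in auto)
qed

lemma stalk_divide:
  assumes "f \<in> fraction_stalk P x" "g \<in> fraction_stalk P x" "g x \<noteq> 0"
    and h: "\<And>z. g z \<noteq> 0 \<Longrightarrow> h z = f z / g z"
  shows "h \<in> fraction_stalk P x"
proof -
  obtain d F G where f: "F \<in> P d" "G \<in> P d" "G x \<noteq> 0" "\<And>z. G z \<noteq> 0 \<Longrightarrow> f z = F z / G z"
    using fraction_stalkE[OF assms(1)] by metis
  obtain e F' G' where g: "F' \<in> P e" "G' \<in> P e" "G' x \<noteq> 0" "\<And>z. G' z \<noteq> 0 \<Longrightarrow> g z = F' z / G' z"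
    using fraction_stalkE[OF assms(2)] by metis
  show ?thesis
  proof (rule fraction_stalkI)
    show "(\<lambda>z. F z * G' z * G' z) \<in> P (d + e + e)" "(\<lambda>z. G z * F' z * G' z) \<in> P (d + e + e)"
      using f g by (auto intro: mult)
    show "G x * F' x * G' x \<noteq> 0" using f(3) g(3) g(4)[of x] assms(3) by auto
    show "h z = F z * G' z * G' z / (G z * F' z * G' z)" if "G z * F' z * G' z \<noteq> 0" for z
      using that f(4)[of z] g(4)[of z] h[of z] by auto
  qed
qed

lemma stalk_mpoly:
  fixes F :: "('v, 'k) mpoly"
  assumes "\<And>i. w i \<in> fraction_stalk P x"
  shows "(\<lambda>z. mpoly_eval F (\<lambda>i. w i z)) \<in> fraction_stalk P x"
  by (rule mpoly_eval_closure[where C = "\<lambda>f. f \<in> fraction_stalk P x"])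
    (auto intro: stalk_const stalk_add stalk_mult assms)

end

definition affine_functions :: "nat \<Rightarrow> ('k::field alg_closure^'n \<Rightarrow> 'k alg_closure) set" where
  "affine_functions _ = range (\<lambda>(F :: ('n, 'k) mpoly) z. mpoly_eval F (vec_nth z))"

text \<open>These functions depend on the representatives chosen by \<open>rep_proj\<close>; only
  quotients of equal bidegree are intrinsic.\<close>

definition biproj_functions :: "nat \<times> nat \<Rightarrow>
    (('k::field alg_closure, 'm::finite) proj \<times> ('k alg_closure, 'n::finite) proj \<Rightarrow> 'k alg_closure) set" where
  "biproj_functions d = {(\<lambda>z. mpoly_eval F (proj_prod_coords z)) | F :: ('m + 'n, 'k) mpoly.
     bihomogeneous (fst d) (snd d) F}"

lemma biproj_functionsI:
  fixes F :: "('m::finite + 'n::finite, 'k::field) mpoly"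
  shows "bihomogeneous (fst d) (snd d) F \<Longrightarrow> (\<lambda>z. mpoly_eval F (proj_prod_coords z)) \<in> biproj_functions d"
  by (auto simp: biproj_functions_def)

lemma stalk_affine_space: "stalk affine_space x = fraction_stalk affine_functions x"
  unfolding affine_space_def fraction_stalk_def affine_functions_def by auto

lemma stalk_proj_prod:
  fixes x :: "('a::field alg_closure, 'b::finite) proj \<times> ('a alg_closure, 'c::finite) proj"
  shows "stalk proj_prod x = fraction_stalk biproj_functions x"
proof (rule Set.set_eqI)
  fix f
  show "f \<in> stalk proj_prod x \<longleftrightarrow> f \<in> fraction_stalk biproj_functions x"
  proof
    assume "f \<in> stalk proj_prod x"
    then obtain d e and F G :: "('b + 'c, 'a) mpoly" where
      "bihomogeneous d e F" "bihomogeneous d e G" "mpoly_eval G (proj_prod_coords x) \<noteq> 0"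
      "\<forall>z. mpoly_eval G (proj_prod_coords z) \<noteq> 0 \<longrightarrow>
         f z = mpoly_eval F (proj_prod_coords z) / mpoly_eval G (proj_prod_coords z)"
      unfolding proj_prod_def by auto
    then show "f \<in> fraction_stalk biproj_functions x"
      by (intro fraction_stalkI[where P = biproj_functions and d = "(d, e)"
            and F = "\<lambda>z. mpoly_eval F (proj_prod_coords z)" and G = "\<lambda>z. mpoly_eval G (proj_prod_coords z)"]
          biproj_functionsI) auto
  next
    assume f: "f \<in> fraction_stalk biproj_functions x"
    obtain d F G where "F \<in> biproj_functions d" "G \<in> biproj_functions d" "G x \<noteq> 0"
      "\<And>z. G z \<noteq> 0 \<Longrightarrow> f z = F z / G z"
      using fraction_stalkE[OF f] by metis
    moreover from this obtain F' G' :: "('b + 'c, 'a) mpoly" where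
      "F = (\<lambda>z. mpoly_eval F' (proj_prod_coords z))" "bihomogeneous (fst d) (snd d) F'"
      "G = (\<lambda>z. mpoly_eval G' (proj_prod_coords z))" "bihomogeneous (fst d) (snd d) G'"
      by (auto simp: biproj_functions_def)
    ultimately show "f \<in> stalk proj_prod x"
      unfolding proj_prod_def by auto
  qed
qed

global_interpretation affine: graded_functions
  "affine_functions :: nat \<Rightarrow> ('k::field alg_closure^'n \<Rightarrow> 'k alg_closure) set"
proof
  fix F G :: "'k alg_closure^'n \<Rightarrow> 'k alg_closure" and d e c
  assume "F \<in> affine_functions d"
  then obtain F' :: "('n, 'k) mpoly" where F: "F = (\<lambda>z. mpoly_eval F' (vec_nth z))"
    by (auto simp: affine_functions_def)
  { assume "G \<in> affine_functions d"
    then obtain G' :: "('n, 'k) mpoly" where G: "G = (\<lambda>z. mpoly_eval G' (vec_nth z))"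
      by (auto simp: affine_functions_def)
    show "(\<lambda>z. F z + G z) \<in> affine_functions d"
      unfolding F G affine_functions_def mpoly_eval_add[symmetric] by blast }
  { assume "G \<in> affine_functions e"
    then obtain G' :: "('n, 'k) mpoly" where G: "G = (\<lambda>z. mpoly_eval G' (vec_nth z))"
      by (auto simp: affine_functions_def)
    show "(\<lambda>z. F z * G z) \<in> affine_functions (d + e)"
      unfolding F G affine_functions_def mpoly_eval_mult[symmetric] by blast }
next
  fix c :: 'k
  have "(\<lambda>z. mpoly_eval (Poly_Mapping.single 0 c :: ('n, 'k) mpoly) (vec_nth z)) \<in> affine_functions 0"
    unfolding affine_functions_def by blast
  then show "(\<lambda>_ :: 'k alg_closure^'n. to_ac c) \<in> affine_functions 0"
    by (simp add: mpoly_eval_const)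
qed

lemma affine_functions_coord: "(\<lambda>z. z $ i) \<in> affine_functions d"
proof -
  have "(\<lambda>z. mpoly_eval (Poly_Mapping.single (Poly_Mapping.single i 1) 1) (vec_nth z)) \<in> affine_functions d"
    unfolding affine_functions_def by blast
  then show ?thesis unfolding mpoly_eval_var .
qed

global_interpretation biproj: graded_functions
  "biproj_functions :: nat \<times> nat \<Rightarrow>
    (('k::field alg_closure, 'm::finite) proj \<times> ('k alg_closure, 'n::finite) proj \<Rightarrow> 'k alg_closure) set"
proof
  fix F G :: "('k alg_closure, 'm) proj \<times> ('k alg_closure, 'n) proj \<Rightarrow> 'k alg_closure" and d e
  assume "F \<in> biproj_functions d"
  then obtain F' :: "('m + 'n, 'k) mpoly" where
    F: "F = (\<lambda>z. mpoly_eval F' (proj_prod_coords z))" "bihomogeneous (fst d) (snd d) F'"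
    by (auto simp: biproj_functions_def)
  { assume "G \<in> biproj_functions d"
    then obtain G' :: "('m + 'n, 'k) mpoly" where
      G: "G = (\<lambda>z. mpoly_eval G' (proj_prod_coords z))" "bihomogeneous (fst d) (snd d) G'"
      by (auto simp: biproj_functions_def)
    have "bihomogeneous (fst d) (snd d) (F' + G')"
      using F(2) G(2) by (auto simp: bihomogeneous_def intro: homogeneous_in_add)
    then show "(\<lambda>z. F z + G z) \<in> biproj_functions d"
      unfolding F(1) G(1) mpoly_eval_add[symmetric] by (rule biproj_functionsI) }
  { assume "G \<in> biproj_functions e"
    then obtain G' :: "('m + 'n, 'k) mpoly" where
      G: "G = (\<lambda>z. mpoly_eval G' (proj_prod_coords z))" "bihomogeneous (fst e) (snd e) G'"
      by (auto simp: biproj_functions_def)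
    have "bihomogeneous (fst (d + e)) (snd (d + e)) (F' * G')"
      using F(2) G(2) by (auto simp: bihomogeneous_def intro: homogeneous_in_mult)
    then show "(\<lambda>z. F z * G z) \<in> biproj_functions (d + e)"
      unfolding F(1) G(1) mpoly_eval_mult[symmetric] by (rule biproj_functionsI) }
next
  fix c :: 'k
  have "bihomogeneous (fst 0) (snd 0) (Poly_Mapping.single 0 c :: ('m + 'n, 'k) mpoly)"
    by (simp add: bihomogeneous_def homogeneous_in_const)
  then have "(\<lambda>z. mpoly_eval (Poly_Mapping.single 0 c :: ('m + 'n, 'k) mpoly) (proj_prod_coords z))
      \<in> biproj_functions 0"
    by (rule biproj_functionsI)
  then show "(\<lambda>_ :: ('k alg_closure, 'm) proj \<times> ('k alg_closure, 'n) proj. to_ac c) \<in> biproj_functions 0"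
    by (simp add: mpoly_eval_const)
qed

lemma biproj_functions_coord:
  fixes i :: "'m::finite" and j :: "'n::finite"
  defines "P \<equiv> biproj_functions :: nat \<times> nat \<Rightarrow>
    (('k::field alg_closure, 'm) proj \<times> ('k alg_closure, 'n) proj \<Rightarrow> 'k alg_closure) set"
  shows "(\<lambda>z. proj_prod_coords z (Inl i)) \<in> P (1, 0)"
    "(\<lambda>z. proj_prod_coords z (Inr j)) \<in> P (0, 1)"
proof -
  have "(\<lambda>z. mpoly_eval (Poly_Mapping.single (Poly_Mapping.single k 1) 1) (proj_prod_coords z)) \<in>
      P (if k \<in> range Inl then 1 else 0, if k \<in> range Inr then 1 else 0)" for k :: "'m + 'n"
  proof -
    have "bihomogeneous (if k \<in> range Inl then 1 else 0) (if k \<in> range Inr then 1 else 0)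
        (Poly_Mapping.single (Poly_Mapping.single k 1) 1 :: ('m + 'n, 'k) mpoly)"
      unfolding bihomogeneous_def by (intro conjI homogeneous_in_var) auto
    then show ?thesis
      unfolding P_def by (intro biproj_functionsI) (simp only: fst_conv snd_conv)
  qed
  from this[of "Inl i"] this[of "Inr j"]
  show "(\<lambda>z. proj_prod_coords z (Inl i)) \<in> P (1, 0)"
    "(\<lambda>z. proj_prod_coords z (Inr j)) \<in> P (0, 1)"
    unfolding mpoly_eval_var by (auto split: if_splits)
qed


subsection \<open>Projective spaces and the addition map\<close>

lemma proj_rel_refl: "v \<noteq> 0 \<Longrightarrow> proj_rel v v"
  unfolding proj_rel_def by (auto intro: exI[of _ 1])

lemma abs_proj_eq_iff: "v \<noteq> 0 \<Longrightarrow> w \<noteq> 0 \<Longrightarrow> abs_proj v = abs_proj w \<longleftrightarrow> (\<exists>c. w = c *s v)"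
  using Quotient3_rel[OF Quotient3_proj, of v w] proj_rel_refl[of v] proj_rel_refl[of w]
  by (auto simp: proj_rel_def)

lemma rep_proj_nonzero: "rep_proj x \<noteq> 0"
  using Quotient3_rep_reflp[OF Quotient3_proj, of x] by (auto simp: proj_rel_def)

lemma abs_rep_proj: "abs_proj (rep_proj x) = x"
  by (rule Quotient3_abs_rep[OF Quotient3_proj])

lemma rep_abs_proj:
  assumes "v \<noteq> 0"
  obtains c where "c \<noteq> 0" "rep_proj (abs_proj v) = c *s v"
proof -
  obtain c where c: "rep_proj (abs_proj v) = c *s v"
    using abs_proj_eq_iff[OF assms rep_proj_nonzero, of "abs_proj v"] by (auto simp: abs_rep_proj)
  with rep_proj_nonzero[of "abs_proj v"] have "c \<noteq> 0" by auto
  with c show thesis by (rule that[rotated])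
qed

lemma abs_proj_scale: "v \<noteq> 0 \<Longrightarrow> c \<noteq> 0 \<Longrightarrow> abs_proj (c *s v) = abs_proj v"
  by (subst eq_commute, subst abs_proj_eq_iff) auto

text \<open>Trades the representatives chosen by \<open>rep_proj\<close> for arbitrary nonzero
  vectors: numerator and denominator have equal bidegree and change by the same factor.\<close>

lemma proj_prod_stalkE:
  fixes u0 :: "'k::field alg_closure^'m::finite" and w0 :: "'k alg_closure^'n::finite"
  assumes h: "h \<in> stalk proj_prod (abs_proj u0, abs_proj w0)" and nz: "u0 \<noteq> 0" "w0 \<noteq> 0"
  obtains F G :: "('m + 'n, 'k) mpoly" where "mpoly_eval G (case_sum (vec_nth u0) (vec_nth w0)) \<noteq> 0"
    "\<And>u w. u \<noteq> 0 \<Longrightarrow> w \<noteq> 0 \<Longrightarrow> mpoly_eval G (case_sum (vec_nth u) (vec_nth w)) \<noteq> 0 \<Longrightarrow>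
      h (abs_proj u, abs_proj w) = mpoly_eval F (case_sum (vec_nth u) (vec_nth w)) /
        mpoly_eval G (case_sum (vec_nth u) (vec_nth w))"
proof -
  obtain d e and F G :: "('m + 'n, 'k) mpoly" where F: "bihomogeneous d e F" and G: "bihomogeneous d e G"
    and G0: "mpoly_eval G (proj_prod_coords (abs_proj u0, abs_proj w0)) \<noteq> 0"
    and FG: "\<And>z. mpoly_eval G (proj_prod_coords z) \<noteq> 0 \<Longrightarrow>
      h z = mpoly_eval F (proj_prod_coords z) / mpoly_eval G (proj_prod_coords z)"
    using h unfolding proj_prod_def by auto
  have scale: "\<exists>c. c \<noteq> 0 \<and>
      mpoly_eval F (proj_prod_coords (abs_proj u, abs_proj w)) = c * mpoly_eval F (case_sum (vec_nth u) (vec_nth w)) \<and>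
      mpoly_eval G (proj_prod_coords (abs_proj u, abs_proj w)) = c * mpoly_eval G (case_sum (vec_nth u) (vec_nth w))"
    if uw: "u \<noteq> 0" "w \<noteq> 0" for u :: "'k alg_closure^'m" and w :: "'k alg_closure^'n"
  proof -
    obtain c where c: "c \<noteq> 0" "rep_proj (abs_proj u) = c *s u" using rep_abs_proj[OF uw(1)] .
    obtain c' where c': "c' \<noteq> 0" "rep_proj (abs_proj w) = c' *s w" using rep_abs_proj[OF uw(2)] .
    have "proj_prod_coords (abs_proj u, abs_proj w) = case_sum (\<lambda>i. c * u $ i) (\<lambda>j. c' * w $ j)"
      by (rule ext) (simp add: proj_prod_coords_def c c' split: sum.splits)
    then show ?thesis
      using c(1) c'(1) F G by (intro exI[of _ "c ^ d * c' ^ e"]) (simp add: mpoly_eval_bihomogeneous)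
  qed
  show thesis
  proof
    show "mpoly_eval G (case_sum (vec_nth u0) (vec_nth w0)) \<noteq> 0" using scale[OF nz] G0 by auto
    show "h (abs_proj u, abs_proj w) = mpoly_eval F (case_sum (vec_nth u) (vec_nth w)) /
        mpoly_eval G (case_sum (vec_nth u) (vec_nth w))"
      if "u \<noteq> 0" "w \<noteq> 0" "mpoly_eval G (case_sum (vec_nth u) (vec_nth w)) \<noteq> 0" for u w
      using scale[OF that(1,2)] FG[of "(abs_proj u, abs_proj w)"] that(3) by auto
  qed
qed

lemma vector_4 [simp]:
  "(vector [x, y, z, w] :: 'a::zero^4) $ 1 = x"
  "(vector [x, y, z, w] :: 'a::zero^4) $ 2 = y"
  "(vector [x, y, z, w] :: 'a::zero^4) $ 3 = z"
  "(vector [x, y, z, w] :: 'a::zero^4) $ 4 = w"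
  unfolding vector_def by simp_all

text \<open>With [x : y] read as the form x S + y T, the coordinates of a multiset of points are the
  coefficients of the product of its forms; here a linear form is multiplied by a quadratic
  one.\<close>

definition sym_mult :: "'c::comm_semiring_1^2 \<Rightarrow> 'c^3 \<Rightarrow> 'c^4" where
  "sym_mult p D = vector [p $ 1 * D $ 1, p $ 1 * D $ 2 + p $ 2 * D $ 1,
     p $ 1 * D $ 3 + p $ 2 * D $ 2, p $ 2 * D $ 3]"

definition sym_mult2 :: "'c::comm_semiring_1^2 \<Rightarrow> 'c^2 \<Rightarrow> 'c^3" where
  "sym_mult2 q r = vector [q $ 1 * r $ 1, q $ 1 * r $ 2 + q $ 2 * r $ 1, q $ 2 * r $ 2]"

lemma bihom_sym_altdef:
  "bihom_sym i vs = (\<Sum>I\<in>Pow {..<length vs}. if card I = i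
     then (\<Prod>j\<in>I. (vs ! j) $ 1) * (\<Prod>j\<in>{..<length vs} - I. (vs ! j) $ 2) else 0)"
proof -
  have "{I. I \<subseteq> {..<length vs} \<and> card I = i} = {I \<in> Pow {..<length vs}. card I = i}" by auto
  then show ?thesis unfolding bihom_sym_def by (simp only:) (rule sum.inter_filter, simp)
qed

lemma sum_Pow_insert:
  assumes "finite A" "a \<notin> A"
  shows "sum f (Pow (insert a A)) = sum f (Pow A) + (\<Sum>I\<in>Pow A. f (insert a I))"
proof -
  have "inj_on (insert a) (Pow A)"
    using assms(2) by (auto simp: inj_on_def)
  moreover have "Pow A \<inter> insert a ` Pow A = {}" using assms(2) by auto
  ultimately show ?thesis
    using assms(1) by (simp add: Pow_insert sum.union_disjoint sum.reindex)
qed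

lemma sym_coords_2: "sym_coords [q, r] = sym_mult2 q r"
proof -
  have A: "{..<length [q, r]} = {0, 1}" by auto
  show ?thesis
    unfolding sym_coords_def bihom_sym_altdef A sym_mult2_def
    by (simp add: sum_Pow_insert insert_Diff_if mult_ac add_ac)
qed

lemma sym_coords_3: "sym_coords [p, q, r] = sym_mult p (sym_mult2 q r)"
proof -
  have A: "{..<length [p, q, r]} = {0, 1, 2}" by auto
  show ?thesis
    unfolding sym_coords_def bihom_sym_altdef A sym_mult2_def sym_mult_def
    by (simp add: sum_Pow_insert insert_Diff_if algebra_simps numeral_2_eq_2 numeral_3_eq_3)
qed

lemma vec_eq_2: "v = w \<longleftrightarrow> v $ 1 = w $ 1 \<and> v $ 2 = w $ 2" for v w :: "'a^2"
  by (simp add: vec_eq_iff forall_2)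

lemma vec_eq_3: "v = w \<longleftrightarrow> v $ 1 = w $ 1 \<and> v $ 2 = w $ 2 \<and> v $ 3 = w $ 3" for v w :: "'a^3"
  by (simp add: vec_eq_iff forall_3)

lemma vec_eq_4: "v = w \<longleftrightarrow> v $ 1 = w $ 1 \<and> v $ 2 = w $ 2 \<and> v $ 3 = w $ 3 \<and> v $ 4 = w $ 4"
  for v w :: "'a^4"
  by (simp add: vec_eq_iff forall_4)

lemma sym_mult2_nonzero: "q \<noteq> 0 \<Longrightarrow> r \<noteq> 0 \<Longrightarrow> sym_mult2 q r \<noteq> 0" for q r :: "'c::field^2"
  by (auto simp: sym_mult2_def vec_eq_2 vec_eq_3)

lemma sym_mult_nonzero: "p \<noteq> 0 \<Longrightarrow> D \<noteq> 0 \<Longrightarrow> sym_mult p D \<noteq> 0" for p :: "'c::field^2"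
  by (auto simp: sym_mult_def vec_eq_2 vec_eq_3 vec_eq_4)

lemma sym_mult_scale: "sym_mult (c *s p) (c' *s D) = (c * c') *s sym_mult p D"
  by (simp add: sym_mult_def vec_eq_4 algebra_simps)

lemma sym_mult2_scale: "sym_mult2 (c *s q) (c' *s r) = (c * c') *s sym_mult2 q r"
  by (simp add: sym_mult2_def vec_eq_3 algebra_simps)

lemma sym_mult2_surj:
  fixes D :: "'c::alg_closed_field^3"
  assumes "D \<noteq> 0"
  obtains q r where "q \<noteq> 0" "r \<noteq> 0" "D = sym_mult2 q r"
proof (cases "D $ 1 = 0")
  case True
  show thesis
    by (rule that[of "vector [0, 1]" "vector [D $ 2, D $ 3]"])
      (use True assms in \<open>auto simp: sym_mult2_def vec_eq_2 vec_eq_3\<close>)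
next
  case False
  then obtain t where "poly [:D $ 3, D $ 2, D $ 1:] t = 0"
    using alg_closed_imp_poly_has_root[of "[:D $ 3, D $ 2, D $ 1:]"] by auto
  then have "D $ 3 = - (t * (D $ 2 + t * D $ 1))" by (simp add: eq_neg_iff_add_eq_0)
  then show thesis
    by (intro that[of "vector [1, - t]" "vector [D $ 1, D $ 2 + t * D $ 1]"])
      (use False in \<open>auto simp: sym_mult2_def vec_eq_2 vec_eq_3\<close>)
qed

text \<open>The definite description is justified: \<open>D\<close> fixes the product of
  \<open>q\<close> and \<open>r\<close> up to a scalar, and such \<open>q\<close>, \<open>r\<close>
  exist because quadratic forms split over an algebraically closed field.\<close>

lemma add_point_altdef:
  fixes p :: "('c::alg_closed_field, 2) proj"
  shows "add_point (p, D) = abs_proj (sym_mult (rep_proj p) (rep_proj D))"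
proof -
  have sum: "E = abs_proj (sym_mult (rep_proj p) (rep_proj D))"
    if "D = sym_quot [q, r]" "E = sym_quot [p, q, r]" for q r E
  proof -
    have nz: "sym_mult2 (rep_proj q) (rep_proj r) \<noteq> 0"
      by (simp add: sym_mult2_nonzero rep_proj_nonzero)
    have "D = abs_proj (sym_mult2 (rep_proj q) (rep_proj r))"
      using that(1) by (simp add: sym_quot_def sym_coords_2)
    then obtain c where c: "c \<noteq> 0" "rep_proj D = c *s sym_mult2 (rep_proj q) (rep_proj r)"
      using rep_abs_proj[OF nz] by metis
    have "E = abs_proj (sym_mult (rep_proj p) (sym_mult2 (rep_proj q) (rep_proj r)))"
      using that(2) by (simp add: sym_quot_def sym_coords_3)
    also have "\<dots> = abs_proj (c *s sym_mult (rep_proj p) (sym_mult2 (rep_proj q) (rep_proj r)))"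
      using nz c(1) by (simp add: abs_proj_scale sym_mult_nonzero rep_proj_nonzero)
    also have "c *s sym_mult (rep_proj p) (sym_mult2 (rep_proj q) (rep_proj r)) =
        sym_mult (rep_proj p) (rep_proj D)"
      using sym_mult_scale[of 1 "rep_proj p" c] by (simp add: c(2))
    finally show ?thesis .
  qed
  obtain q r where qr: "q \<noteq> 0" "r \<noteq> 0" "rep_proj D = sym_mult2 q r"
    using sym_mult2_surj[OF rep_proj_nonzero] .
  obtain c where c: "c \<noteq> 0" "rep_proj (abs_proj q) = c *s q"
    using rep_abs_proj[OF qr(1)] .
  obtain c' where c': "c' \<noteq> 0" "rep_proj (abs_proj r) = c' *s r"
    using rep_abs_proj[OF qr(2)] .
  have "D = abs_proj (sym_mult2 q r)"
    using abs_rep_proj[of D] qr(3) by simp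
  also have "\<dots> = sym_quot [abs_proj q, abs_proj r]"
    using c c' qr by (simp add: sym_quot_def sym_coords_2 sym_mult2_scale abs_proj_scale sym_mult2_nonzero)
  finally have D: "D = sym_quot [abs_proj q, abs_proj r]" .
  show ?thesis
    unfolding add_point_def prod.case
  proof (rule the_equality)
    show "\<exists>q r. D = sym_quot [q, r] \<and>
        abs_proj (sym_mult (rep_proj p) (rep_proj D)) = sym_quot [p, q, r]"
      using D sum[OF D refl] by metis
    show "E = abs_proj (sym_mult (rep_proj p) (rep_proj D))"
      if "\<exists>q r. D = sym_quot [q, r] \<and> E = sym_quot [p, q, r]" for E
      using that sum by metis
  qed
qed


subsection \<open>The ramification locus\<close>

context graded_functions
begin

context
  fixes V :: "('p, 'k alg_closure) fun_space" and x \<delta>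
  assumes stalk: "stalk V x = fraction_stalk P x" and \<delta>: "tangent_vector V x \<delta>"
begin

lemma tangent_vector_add: "f \<in> fraction_stalk P x \<Longrightarrow> g \<in> fraction_stalk P x \<Longrightarrow>
    \<delta> (\<lambda>z. f z + g z) = \<delta> f + \<delta> g"
  and tangent_vector_mult: "f \<in> fraction_stalk P x \<Longrightarrow> g \<in> fraction_stalk P x \<Longrightarrow>
    \<delta> (\<lambda>z. f z * g z) = f x * \<delta> g + g x * \<delta> f"
  and tangent_vector_const: "\<delta> (\<lambda>_. to_ac c) = 0"
  using \<delta> by (auto simp: tangent_vector_def stalk)

text \<open>\<open>G / G\<close> is the indicator function of the neighbourhood. Being idempotent,
  with value 1 at \<open>x\<close>, it is killed by \<open>\<delta>\<close>, so multiplying a germ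
  by it does not change the derivative.\<close>

lemma tangent_vector_local:
  assumes f: "f \<in> fraction_stalk P x" and g: "g \<in> fraction_stalk P x"
    and G: "G \<in> P d" "G x \<noteq> 0" and eq: "\<And>z. G z \<noteq> 0 \<Longrightarrow> f z = g z"
  shows "\<delta> f = \<delta> g"
proof -
  define \<omega> where "\<omega> = (\<lambda>z. G z / G z)"
  have \<omega>: "\<omega> \<in> fraction_stalk P x" unfolding \<omega>_def by (rule stalk_ratio) fact+
  have x: "\<omega> x = 1" using G by (simp add: \<omega>_def)
  have "(\<lambda>z. \<omega> z * \<omega> z) = \<omega>" by (auto simp: \<omega>_def)
  then have "\<delta> \<omega> = \<delta> \<omega> + \<delta> \<omega>"
    using tangent_vector_mult[OF \<omega> \<omega>] x by simp
  then have "\<delta> \<omega> + 0 = \<delta> \<omega> + \<delta> \<omega>" by (simp only: add_0_right)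
  then have \<delta>\<omega>: "\<delta> \<omega> = 0" by (simp only: add_left_cancel)
  have "(\<lambda>z. f z * \<omega> z) = (\<lambda>z. g z * \<omega> z)"
    using eq by (auto simp: \<omega>_def)
  then show ?thesis
    using tangent_vector_mult[OF f \<omega>] tangent_vector_mult[OF g \<omega>] x \<delta>\<omega> by simp
qed

lemma tangent_vector_mpoly:
  fixes F :: "('v, 'k) mpoly"
  assumes "\<And>i. w i \<in> fraction_stalk P x" "\<And>i. \<delta> (w i) = 0"
  shows "\<delta> (\<lambda>z. mpoly_eval F (\<lambda>i. w i z)) = 0"
proof -
  have "(\<lambda>z. mpoly_eval F (\<lambda>i. w i z)) \<in> fraction_stalk P x \<and> \<delta> (\<lambda>z. mpoly_eval F (\<lambda>i. w i z)) = 0"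
    by (rule mpoly_eval_closure[where C = "\<lambda>f. f \<in> fraction_stalk P x \<and> \<delta> f = 0"])
      (auto simp: tangent_vector_const tangent_vector_add tangent_vector_mult assms
        intro: stalk_const stalk_add stalk_mult)
  then show ?thesis ..
qed

end

end

text \<open>The value of the quadratic form \<open>w\<close> at the root (u2, -u1) of the linear
  form \<open>u\<close>; for nonzero \<open>u\<close> it vanishes exactly if \<open>u\<close>
  divides \<open>w\<close>.\<close>

definition resultant_form :: "'c::comm_ring_1^2 \<Rightarrow> 'c^3 \<Rightarrow> 'c" where
  "resultant_form u w = w $ 1 * (u $ 2)^2 - w $ 2 * u $ 1 * u $ 2 + w $ 3 * (u $ 1)^2"

text \<open>
  The derivative of the product \<open>u w\<close> of a linear and a quadratic form is assumed to be \<open>c u w\<close>.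
  Then \<open>u\<close> divides \<open>u' w\<close> and hence \<open>u'\<close>, as it is coprime to \<open>w\<close>.
\<close>

lemma coprime_product_stationary:
  fixes u1 u2 :: "'c::field"
  assumes "u1 * b1 + w1 * a1 = c * (u1 * w1)"
    and "u1 * b2 + w2 * a1 + (u2 * b1 + w1 * a2) = c * (u1 * w2 + u2 * w1)"
    and "u1 * b3 + w3 * a1 + (u2 * b2 + w2 * a2) = c * (u1 * w3 + u2 * w2)"
    and "u2 * b3 + w3 * a2 = c * (u2 * w3)"
    and res: "w1 * u2^2 - w2 * u1 * u2 + w3 * u1^2 \<noteq> 0"
    and u: "u1 = 1 \<and> a1 = 0 \<or> u2 = 1 \<and> a2 = 0"
    and w: "w1 = 1 \<and> b1 = 0 \<or> w2 = 1 \<and> b2 = 0 \<or> w3 = 1 \<and> b3 = 0"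
  shows "a1 = 0 \<and> a2 = 0 \<and> b1 = 0 \<and> b2 = 0 \<and> b3 = 0"
proof -
  \<comment> \<open>The four relations are combined into their value at the root (u2, -u1) of
    \<open>u\<close>; all terms containing \<open>u\<close> drop out, and the derivative of
    \<open>u\<close> times \<open>w\<close> remains.\<close>
  have "(u1 * a2 - u2 * a1) * (w1 * u2^2 - w2 * u1 * u2 + w3 * u1^2) = 0"
    using assms(1-4) by Groebner_Basis.algebra
  with res have "u1 * a2 = u2 * a1" by simp
  with u have a: "a1 = 0" "a2 = 0" by auto
  have b: "b1 = c * w1 \<and> b2 = c * w2 \<and> b3 = c * w3"
    using u
  proof (elim disjE conjE)
    assume "u1 = 1"
    then show ?thesis using assms(1-3) a by (auto simp: algebra_simps)
  next
    assume "u2 = 1"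
    then show ?thesis using assms(2-4) a by (auto simp: algebra_simps)
  qed
  with w have "c = 0" by auto
  with a b show ?thesis by simp
qed

lemma vec_nonzero_component: "v \<noteq> 0 \<Longrightarrow> \<exists>i. v $ i \<noteq> 0" for v :: "'a::zero^'n"
  by (auto simp: vec_eq_iff)

lemma proj_prod_coords_simps:
  "proj_prod_coords z (Inl i) = rep_proj (fst z) $ i"
  "proj_prod_coords z (Inr j) = rep_proj (snd z) $ j"
  by (simp_all add: proj_prod_coords_def)

text \<open>In affine coordinates around \<open>z\<close>, the products \<open>e m\<close> are
  homogeneous coordinates of the image. Their ratios are pulled back from projective 3-space, so
  \<open>\<delta>\<close> kills them and thus multiplies the whole vector of the \<open>e m\<close>
  by one scalar \<open>c\<close>. By \<open>coprime_product_stationary\<close> it then kills the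
  affine coordinates, hence every germ.\<close>

lemma tangent_vector_etale:
  fixes z :: "('k::field alg_closure, 2) proj \<times> ('k alg_closure, 3) proj"
  assumes \<delta>: "tangent_vector proj_prod z \<delta>"
    and pullback: "\<And>g. g \<in> stalk proj_space (add_point z) \<Longrightarrow> \<delta> (g \<circ> add_point) = 0"
    and res: "resultant_form (rep_proj (fst z)) (rep_proj (snd z)) \<noteq> 0"
    and h: "h \<in> stalk proj_prod z"
  shows "\<delta> h = 0"
proof -
  define S where "S = fraction_stalk biproj_functions z"
  note st = stalk_proj_prod[of z]
  note tv_add = biproj.tangent_vector_add[OF st \<delta>, folded S_def]
  note tv_mult = biproj.tangent_vector_mult[OF st \<delta>, folded S_def]
  note tv_local = biproj.tangent_vector_local[OF st \<delta>, folded S_def]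
  note S_add = biproj.stalk_add[of _ z, folded S_def]
  note S_mult = biproj.stalk_mult[of _ z, folded S_def]
  note coord = biproj_functions_coord[unfolded proj_prod_coords_simps]
  obtain i where i: "rep_proj (fst z) $ i \<noteq> 0"
    using vec_nonzero_component[OF rep_proj_nonzero] by blast
  obtain j where j: "rep_proj (snd z) $ j \<noteq> 0"
    using vec_nonzero_component[OF rep_proj_nonzero] by blast
  define u where "u k y = rep_proj (fst y) $ k / rep_proj (fst y) $ i" for k
    and y :: "('k alg_closure, 2) proj \<times> ('k alg_closure, 3) proj"
  define w where "w l y = rep_proj (snd y) $ l / rep_proj (snd y) $ j" for l
    and y :: "('k alg_closure, 2) proj \<times> ('k alg_closure, 3) proj"
  have uS: "u k \<in> S" for k
    unfolding u_def[abs_def] S_def by (rule biproj.stalk_ratio[OF coord(1) coord(1)]) (rule i)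
  have wS: "w l \<in> S" for l
    unfolding w_def[abs_def] S_def by (rule biproj.stalk_ratio[OF coord(2) coord(2)]) (rule j)
  have one: "(\<lambda>_. to_ac 1) \<in> S"
    unfolding S_def by (rule biproj.stalk_const)
  have \<delta>1: "\<delta> (\<lambda>_. to_ac 1) = 0"
    by (rule biproj.tangent_vector_const[OF st \<delta>])
  \<comment> \<open>The normalised coordinate is 1 near \<open>z\<close> but not everywhere, so
    locality of \<open>\<delta>\<close> is needed.\<close>
  have ui: "u i z = 1" "\<delta> (u i) = 0"
    using tv_local[OF uS one coord(1) i] i \<delta>1 by (auto simp: u_def)
  have wj: "w j z = 1" "\<delta> (w j) = 0"
    using tv_local[OF wS one coord(2) j] j \<delta>1 by (auto simp: w_def)
  define raw :: "('k alg_closure, 2) proj \<times> ('k alg_closure, 3) proj \<Rightarrow> 'k alg_closure^4" where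
    "raw y = sym_mult (rep_proj (fst y)) (rep_proj (snd y))" for y
  have raw_mem: "(\<lambda>y. raw y $ m) \<in> biproj_functions (1, 1)" for m
  proof -
    have "(\<lambda>y :: ('k alg_closure, 2) proj \<times> ('k alg_closure, 3) proj.
        rep_proj (fst y) $ k * rep_proj (snd y) $ l) \<in> biproj_functions (1, 1)" for k l
      using biproj.mult[OF coord(1)[of k] coord(2)[of l]] by simp
    note * = this this[THEN biproj.add]
    show ?thesis
      using exhaust_4[of m] by (auto simp: raw_def sym_mult_def simp del: One_nat_def intro!: *)
  qed
  define e where "e m y = sym_mult (\<chi> k. u k y) (\<chi> l. w l y) $ m" for m y
  have e_eq: "e 1 = (\<lambda>y. u 1 y * w 1 y)" "e 2 = (\<lambda>y. u 1 y * w 2 y + u 2 y * w 1 y)"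
    "e 3 = (\<lambda>y. u 1 y * w 3 y + u 2 y * w 2 y)" "e 4 = (\<lambda>y. u 2 y * w 3 y)"
    by (auto simp: e_def sym_mult_def)
  have eS: "e m \<in> S" for m
    using exhaust_4[of m] by (auto simp: e_eq intro!: S_add S_mult uS wS)
  have e_raw: "raw y $ m = rep_proj (fst y) $ i * rep_proj (snd y) $ j * e m y"
    if "rep_proj (fst y) $ i \<noteq> 0" "rep_proj (snd y) $ j \<noteq> 0" for m y
    using exhaust_4[of m] that by (auto simp: raw_def e_def sym_mult_def u_def w_def field_simps)
  obtain m where "raw z $ m \<noteq> 0"
    using vec_nonzero_component[OF sym_mult_nonzero[OF rep_proj_nonzero rep_proj_nonzero]]
    unfolding raw_def by blast
  then have m: "raw z $ m \<noteq> 0" "e m z \<noteq> 0"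
    using e_raw[OF i j, of m] by auto
  define c where "c = \<delta> (e m) / e m z"
  have \<delta>e: "\<delta> (e m') = c * e m' z" for m'
  proof -
    define r where "r y = raw y $ m' / raw y $ m" for y
    define g :: "('k alg_closure, 4) proj \<Rightarrow> 'k alg_closure" where
      "g E = rep_proj E $ m' / rep_proj E $ m" for E
    have rep: "\<exists>c. c \<noteq> 0 \<and> rep_proj (add_point y) = c *s raw y" for y
      using rep_abs_proj[OF sym_mult_nonzero[OF rep_proj_nonzero rep_proj_nonzero]]
      unfolding raw_def by (metis add_point_altdef prod.collapse)
    have "g \<in> stalk proj_space (add_point z)"
    proof -
      have "homogeneous_in UNIV 1 (Poly_Mapping.single (Poly_Mapping.single k 1) 1 :: (4, 'k) mpoly)" for k
        using homogeneous_in_var[of UNIV k 1] by simp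
      moreover have "rep_proj (add_point z) $ m \<noteq> 0"
        using rep[of z] m(1) by auto
      ultimately show ?thesis
        unfolding proj_space_def fun_space.select_convs
        by - (rule CollectI, rule exI[of _ 1],
            rule exI[of _ "Poly_Mapping.single (Poly_Mapping.single m' 1) 1"],
            rule exI[of _ "Poly_Mapping.single (Poly_Mapping.single m 1) 1"],
            auto simp: g_def mpoly_eval_var simp del: One_nat_def)
    qed
    moreover have "g \<circ> add_point = r"
    proof
      fix y
      show "(g \<circ> add_point) y = r y" using rep[of y] by (auto simp: g_def r_def)
    qed
    ultimately have \<delta>r: "\<delta> r = 0" using pullback by metis
    have rS: "r \<in> S"
      unfolding r_def[abs_def] S_def by (rule biproj.stalk_ratio[OF raw_mem raw_mem m(1)])
    have "\<delta> (e m') = \<delta> (\<lambda>y. r y * e m y)"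
    proof (rule tv_local[OF eS S_mult[OF rS eS]])
      show "(\<lambda>y. rep_proj (fst y) $ i * rep_proj (snd y) $ j * raw y $ m) \<in>
          biproj_functions ((1, 0) + (0, 1) + (1, 1))"
        by (intro biproj.mult coord raw_mem)
    qed (use i j m in \<open>auto simp: r_def e_raw\<close>)
    also have "\<dots> = r z * \<delta> (e m)"
      using tv_mult[OF rS eS] \<delta>r by simp
    also have "\<dots> = c * e m' z"
      using m i j by (simp add: r_def c_def e_raw)
    finally show ?thesis .
  qed
  have "\<delta> (u 1) = 0 \<and> \<delta> (u 2) = 0 \<and> \<delta> (w 1) = 0 \<and> \<delta> (w 2) = 0 \<and> \<delta> (w 3) = 0"
  proof (rule coprime_product_stationary)
    show "u 1 z * \<delta> (w 1) + w 1 z * \<delta> (u 1) = c * (u 1 z * w 1 z)"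
      using \<delta>e[of 1] unfolding e_eq by (simp add: tv_mult uS wS)
    show "u 2 z * \<delta> (w 3) + w 3 z * \<delta> (u 2) = c * (u 2 z * w 3 z)"
      using \<delta>e[of 4] unfolding e_eq by (simp add: tv_mult uS wS)
    show "u 1 z * \<delta> (w 2) + w 2 z * \<delta> (u 1) + (u 2 z * \<delta> (w 1) + w 1 z * \<delta> (u 2)) =
        c * (u 1 z * w 2 z + u 2 z * w 1 z)"
      using \<delta>e[of 2] unfolding e_eq by (simp add: tv_mult tv_add S_mult uS wS)
    show "u 1 z * \<delta> (w 3) + w 3 z * \<delta> (u 1) + (u 2 z * \<delta> (w 2) + w 2 z * \<delta> (u 2)) =
        c * (u 1 z * w 3 z + u 2 z * w 2 z)"
      using \<delta>e[of 3] unfolding e_eq by (simp add: tv_mult tv_add S_mult uS wS)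
    show "w 1 z * (u 2 z)^2 - w 2 z * u 1 z * u 2 z + w 3 z * (u 1 z)^2 \<noteq> 0"
    proof -
      have "w 1 z * (u 2 z)^2 - w 2 z * u 1 z * u 2 z + w 3 z * (u 1 z)^2 =
          resultant_form (rep_proj (fst z)) (rep_proj (snd z)) /
          (rep_proj (snd z) $ j * rep_proj (fst z) $ i * rep_proj (fst z) $ i)"
        by (simp add: resultant_form_def u_def w_def power2_eq_square diff_divide_distrib
            add_divide_distrib mult_ac)
      then show ?thesis using res i j by simp
    qed
    show "u 1 z = 1 \<and> \<delta> (u 1) = 0 \<or> u 2 z = 1 \<and> \<delta> (u 2) = 0"
      using ui exhaust_2[of i] by auto
    show "w 1 z = 1 \<and> \<delta> (w 1) = 0 \<or> w 2 z = 1 \<and> \<delta> (w 2) = 0 \<or> w 3 z = 1 \<and> \<delta> (w 3) = 0"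
      using wj exhaust_3[of j] by auto
  qed
  then have \<delta>0: "\<delta> (u k) = 0" "\<delta> (w l) = 0" for k l
    using exhaust_2[of k] exhaust_3[of l] by auto
  obtain d F G where FG: "F \<in> biproj_functions d" "G \<in> biproj_functions d" "G z \<noteq> 0"
    "\<And>y. G y \<noteq> 0 \<Longrightarrow> h y = F y / G y"
    using fraction_stalkE[OF h[unfolded st]] by metis
  obtain F' :: "(2 + 3, 'k) mpoly" where F': "F = (\<lambda>y. mpoly_eval F' (proj_prod_coords y))"
    "bihomogeneous (fst d) (snd d) F'"
    using FG(1) by (auto simp: biproj_functions_def)
  obtain G' :: "(2 + 3, 'k) mpoly" where G': "G = (\<lambda>y. mpoly_eval G' (proj_prod_coords y))"
    "bihomogeneous (fst d) (snd d) G'"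
    using FG(2) by (auto simp: biproj_functions_def)
  define t where "t = case_sum u w"
  have t: "t k \<in> S" "\<delta> (t k) = 0" for k
    by (auto simp: t_def uS wS \<delta>0 split: sum.splits)
  have teq: "mpoly_eval H (\<lambda>k. t k y) = inverse (rep_proj (fst y) $ i) ^ fst d *
      inverse (rep_proj (snd y) $ j) ^ snd d * mpoly_eval H (proj_prod_coords y)"
    if "bihomogeneous (fst d) (snd d) H" for y and H :: "(2 + 3, 'k) mpoly"
  proof -
    have "(\<lambda>k. t k y) = case_sum (\<lambda>k. inverse (rep_proj (fst y) $ i) * rep_proj (fst y) $ k)
        (\<lambda>l. inverse (rep_proj (snd y) $ j) * rep_proj (snd y) $ l)"
      by (rule ext) (simp add: t_def u_def w_def field_simps split: sum.splits)
    then show ?thesis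
      using mpoly_eval_bihomogeneous[OF that] by (simp add: proj_prod_coords_def)
  qed
  let ?F = "\<lambda>y. mpoly_eval F' (\<lambda>k. t k y)" and ?G = "\<lambda>y. mpoly_eval G' (\<lambda>k. t k y)"
  have FGS: "?F \<in> S" "?G \<in> S"
    unfolding S_def by (rule biproj.stalk_mpoly, rule t(1)[unfolded S_def])+
  have FG0: "\<delta> ?F = 0" "\<delta> ?G = 0"
    by (rule biproj.tangent_vector_mpoly[OF st \<delta>], rule t(1)[unfolded S_def], rule t(2))+
  have hS: "h \<in> S" using h by (simp add: st S_def)
  have "\<delta> (\<lambda>y. h y * ?G y) = \<delta> ?F"
  proof (rule tv_local[OF S_mult[OF hS FGS(2)] FGS(1) FG(2,3)])
    show "h y * ?G y = ?F y" if "G y \<noteq> 0" for y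
      using FG(4)[OF that] that F' G' by (simp add: teq)
  qed
  then have "?G z * \<delta> h = 0"
    using tv_mult[OF hS FGS(2)] FG0 by simp
  moreover have "?G z \<noteq> 0"
    using FG(3) G' i j by (simp add: teq)
  ultimately show ?thesis by simp
qed


section \<open>Tangent vectors from curves\<close>

definition curve_germ :: "('c::field \<Rightarrow> 'p) \<Rightarrow> ('p \<Rightarrow> 'c) \<Rightarrow> 'c poly \<Rightarrow> 'c poly \<Rightarrow> bool" where
  "curve_germ \<gamma> h A B \<longleftrightarrow> poly B 0 \<noteq> 0 \<and> (\<forall>\<epsilon>. poly B \<epsilon> \<noteq> 0 \<longrightarrow> h (\<gamma> \<epsilon>) = poly A \<epsilon> / poly B \<epsilon>)"

text \<open>The derivative along the curve at parameter 0, by the quotient rule. The choice is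
  harmless: two fractions for the same function satisfy A B' = A' B, and this identity and its
  derivative at 0 fix the value.\<close>

definition curve_deriv :: "('c::field \<Rightarrow> 'p) \<Rightarrow> ('p \<Rightarrow> 'c) \<Rightarrow> 'c" where
  "curve_deriv \<gamma> h = (SOME y. \<exists>A B. curve_germ \<gamma> h A B \<and>
     y = (poly (pderiv A) 0 * poly B 0 - poly A 0 * poly (pderiv B) 0) / (poly B 0)^2)"

lemma curve_deriv_eq:
  fixes \<gamma> :: "'c::field_char_0 \<Rightarrow> 'p"
  assumes AB: "curve_germ \<gamma> h A B"
  shows "curve_deriv \<gamma> h = (poly (pderiv A) 0 * poly B 0 - poly A 0 * poly (pderiv B) 0) / (poly B 0)^2"
  unfolding curve_deriv_def
proof (rule some_equality)
  fix y assume "\<exists>A B. curve_germ \<gamma> h A B \<and>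
     y = (poly (pderiv A) 0 * poly B 0 - poly A 0 * poly (pderiv B) 0) / (poly B 0)^2"
  then obtain A' B' where AB': "curve_germ \<gamma> h A' B'"
    and y: "y = (poly (pderiv A') 0 * poly B' 0 - poly A' 0 * poly (pderiv B') 0) / (poly B' 0)^2"
    by blast
  have nz: "poly B 0 \<noteq> 0" "poly B' 0 \<noteq> 0"
    using AB AB' by (auto simp: curve_germ_def)
  have eq: "A * B' = A' * B"
  proof (rule poly_eqI_cofinite[of "B * B'"])
    show "B * B' \<noteq> 0" using nz by auto
    show "poly (A * B') \<epsilon> = poly (A' * B) \<epsilon>" if "poly (B * B') \<epsilon> \<noteq> 0" for \<epsilon>
    proof -
      have "poly A \<epsilon> / poly B \<epsilon> = poly A' \<epsilon> / poly B' \<epsilon>"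
        using that AB AB' unfolding curve_germ_def by (metis mult_eq_0_iff poly_mult)
      then show ?thesis using that by (simp add: field_simps)
    qed
  qed
  define a b a' b' where "a = poly A 0" "b = poly B 0" "a' = poly A' 0" "b' = poly B' 0"
  define da db da' db' where "da = poly (pderiv A) 0" "db = poly (pderiv B) 0"
    "da' = poly (pderiv A') 0" "db' = poly (pderiv B') 0"
  note defs = a_b_a'_b'_def da_db_da'_db'_def
  have 1: "a * b' = a' * b" using arg_cong[OF eq, of "\<lambda>p. poly p 0"] by (simp add: defs)
  have 2: "a * db' + b' * da = a' * db + b * da'"
    using arg_cong[OF eq, of "\<lambda>p. poly (pderiv p) 0"] by (simp add: pderiv_mult defs)
  have "b * b' * ((da' * b' - a' * db') * b^2 - (da * b - a * db) * b'^2) = 0"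
    using 1 2 by Groebner_Basis.algebra
  then have "(da' * b' - a' * db') * b^2 = (da * b - a * db) * b'^2"
    using nz by (simp add: defs)
  then show "y = (poly (pderiv A) 0 * poly B 0 - poly A 0 * poly (pderiv B) 0) / (poly B 0)^2"
    using nz unfolding y by (simp add: defs frac_eq_eq)
qed (use AB in blast)

lemma curve_germ_add:
  assumes "curve_germ \<gamma> f A B" "curve_germ \<gamma> g A' B'"
  shows "curve_germ \<gamma> (\<lambda>z. f z + g z) (A * B' + A' * B) (B * B')"
  using assms by (auto simp: curve_germ_def add_frac_eq)

lemma curve_germ_mult:
  assumes "curve_germ \<gamma> f A B" "curve_germ \<gamma> g A' B'"
  shows "curve_germ \<gamma> (\<lambda>z. f z * g z) (A * A') (B * B')"
  using assms by (auto simp: curve_germ_def)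

lemma quotient_rule_add:
  fixes b b' :: "'c::field"
  assumes "b \<noteq> 0" "b' \<noteq> 0"
  shows "((a * db' + b' * da + (a' * db + b * da')) * (b * b') - (a * b' + a' * b) * (b * db' + b' * db))
      / (b * b')^2 = (da * b - a * db) / b^2 + (da' * b' - a' * db') / b'^2"
proof -
  have "(a * db' + b' * da + (a' * db + b * da')) * (b * b') - (a * b' + a' * b) * (b * db' + b' * db) =
      (da * b - a * db) * b'^2 + (da' * b' - a' * db') * b^2"
    by (simp add: algebra_simps power2_eq_square)
  then show ?thesis using assms by (simp add: add_frac_eq power_mult_distrib)
qed

lemma quotient_rule_mult:
  fixes b b' :: "'c::field"
  assumes "b \<noteq> 0" "b' \<noteq> 0"
  shows "((a * da' + a' * da) * (b * b') - a * a' * (b * db' + b' * db)) / (b * b')^2 =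
    a / b * ((da' * b' - a' * db') / b'^2) + a' / b' * ((da * b - a * db) / b^2)"
proof -
  have "a / b * ((da' * b' - a' * db') / b'^2) + a' / b' * ((da * b - a * db) / b^2) =
      (a * b) * (da' * b' - a' * db') / (b * b')^2 + (a' * b') * (da * b - a * db) / (b * b')^2"
    using assms by (simp add: power2_eq_square mult_ac)
  also have "\<dots> = ((a * b) * (da' * b' - a' * db') + (a' * b') * (da * b - a * db)) / (b * b')^2"
    by (simp only: add_divide_distrib)
  finally show ?thesis by (simp add: algebra_simps)
qed

lemma tangent_vector_curve:
  fixes V :: "('p, 'k::field_char_0 alg_closure) fun_space"
  assumes germ: "\<And>h. h \<in> stalk V x \<Longrightarrow> \<exists>A B. curve_germ \<gamma> h A B" and "\<gamma> 0 = x"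
  shows "tangent_vector V x (curve_deriv \<gamma>)"
  unfolding tangent_vector_def
proof (intro conjI ballI allI)
  fix c :: 'k
  have "curve_germ \<gamma> (\<lambda>_. to_ac c) [:to_ac c:] 1" by (simp add: curve_germ_def)
  from curve_deriv_eq[OF this] show "curve_deriv \<gamma> (\<lambda>_. to_ac c) = 0" by simp
next
  fix f g assume "f \<in> stalk V x" "g \<in> stalk V x"
  then obtain A B A' B' where f: "curve_germ \<gamma> f A B" and g: "curve_germ \<gamma> g A' B'"
    using germ by blast
  then have nz: "poly B 0 \<noteq> 0" "poly B' 0 \<noteq> 0"
    and fx: "f x = poly A 0 / poly B 0" and gx: "g x = poly A' 0 / poly B' 0"
    using \<open>\<gamma> 0 = x\<close> by (auto simp: curve_germ_def)
  show "curve_deriv \<gamma> (\<lambda>z. f z + g z) = curve_deriv \<gamma> f + curve_deriv \<gamma> g"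
    unfolding curve_deriv_eq[OF f] curve_deriv_eq[OF g] curve_deriv_eq[OF curve_germ_add[OF f g]]
      pderiv_mult pderiv_add poly_add poly_mult
    by (rule quotient_rule_add[OF nz])
  show "curve_deriv \<gamma> (\<lambda>z. f z * g z) = f x * curve_deriv \<gamma> g + g x * curve_deriv \<gamma> f"
    unfolding curve_deriv_eq[OF f] curve_deriv_eq[OF g] curve_deriv_eq[OF curve_germ_mult[OF f g]] fx gx
      pderiv_mult poly_add poly_mult
    by (rule quotient_rule_mult[OF nz])
qed

lemma mpoly_eval_line:
  fixes F :: "('v, 'k::field) mpoly"
  shows "\<exists>p. \<forall>\<epsilon>. mpoly_eval F (\<lambda>i. v i + \<epsilon> * a i) = poly p \<epsilon>"
proof (rule mpoly_eval_closure[where C = "\<lambda>f. \<exists>p. \<forall>\<epsilon>. f \<epsilon> = poly p \<epsilon>"])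
  show "\<exists>p. \<forall>\<epsilon>. to_ac c = poly p \<epsilon>" for c :: 'k
    by (rule exI[of _ "[:to_ac c:]"]) simp
  show "\<exists>p. \<forall>\<epsilon>. v i + \<epsilon> * a i = poly p \<epsilon>" for i
    by (rule exI[of _ "[:v i, a i:]"]) simp
qed (metis poly_add, metis poly_mult)

text \<open>Here \<open>u\<close> divides \<open>w\<close>, say w = u m, and (u + \<epsilon> a) (u -
  \<epsilon> a) m = (u^2 - \<epsilon>^2 a^2) m. The curve of factors moves at \<epsilon> = 0, since
  \<open>a\<close> is no multiple of \<open>u\<close>, but its image depends on \<epsilon>^2 only
  and has derivative 0.\<close>

lemma tangent_vector_ramified:
  fixes z :: "('k::field_char_0 alg_closure, 2) proj \<times> ('k alg_closure, 3) proj"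
  assumes res: "resultant_form (rep_proj (fst z)) (rep_proj (snd z)) = 0"
  obtains \<delta> h where "tangent_vector proj_prod z \<delta>" "h \<in> stalk proj_prod z" "\<delta> h \<noteq> 0"
    "\<And>g. g \<in> stalk proj_space (add_point z) \<Longrightarrow> \<delta> (g \<circ> add_point) = 0"
proof -
  define u w where "u = rep_proj (fst z)" and "w = rep_proj (snd z)"
  have u0: "u \<noteq> 0" and w0: "w \<noteq> 0" by (simp_all add: u_def w_def rep_proj_nonzero)
  have res: "w $ 1 * (u $ 2)^2 - w $ 2 * u $ 1 * u $ 2 + w $ 3 * (u $ 1)^2 = 0"
    using res by (simp add: resultant_form_def u_def w_def)
  obtain m a :: "'k alg_closure^2" where wm: "w = sym_mult2 u m" and a: "u $ 1 * a $ 2 - u $ 2 * a $ 1 \<noteq> 0"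
  proof (cases "u $ 1 = 0")
    case True
    then have "u $ 2 \<noteq> 0" using u0 by (auto simp: vec_eq_2)
    with True res show thesis
      by (intro that[of "vector [w $ 2 / u $ 2, w $ 3 / u $ 2]" "vector [1, 0]"])
        (auto simp: sym_mult2_def vec_eq_3)
  next
    case False
    define m1 m2 where "m1 = w $ 1 / u $ 1" and "m2 = (w $ 2 - u $ 2 * m1) / u $ 1"
    have m: "u $ 1 * m1 = w $ 1" "u $ 1 * m2 = w $ 2 - u $ 2 * m1"
      using False by (simp_all add: m1_def m2_def)
    have "u $ 1 ^ 2 * (w $ 3 - u $ 2 * m2) = 0"
      using res m by Groebner_Basis.algebra
    then have "w $ 3 = u $ 2 * m2" using False by simp
    with m False show thesis
      by (intro that[of "vector [m1, m2]" "vector [0, 1]"]) (auto simp: sym_mult2_def vec_eq_3)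
  qed
  have m0: "m \<noteq> 0" using w0 by (auto simp: wm sym_mult2_def vec_eq_3)
  define b where "b = - sym_mult2 a m"
  have line_u: "u + \<epsilon> *s a \<noteq> 0" for \<epsilon>
  proof
    assume "u + \<epsilon> *s a = 0"
    then have "u $ 1 = - \<epsilon> * a $ 1" "u $ 2 = - \<epsilon> * a $ 2"
      by (auto simp: vec_eq_2 eq_neg_iff_add_eq_0)
    then show False using a by simp
  qed
  have "w + \<epsilon> *s b = sym_mult2 (u + (- \<epsilon>) *s a) m" for \<epsilon>
    by (simp add: wm b_def sym_mult2_def vec_eq_3 algebra_simps)
  then have line_w: "w + \<epsilon> *s b \<noteq> 0" for \<epsilon>
    using sym_mult2_nonzero[OF line_u m0] by metis
  have line: "sym_mult (u + \<epsilon> *s a) (w + \<epsilon> *s b) = sym_mult u w + \<epsilon>^2 *s sym_mult a b" for \<epsilon>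
    by (simp add: wm b_def sym_mult2_def sym_mult_def vec_eq_4 algebra_simps power2_eq_square)
  define \<gamma> where "\<gamma> \<epsilon> = (abs_proj (u + \<epsilon> *s a), abs_proj (w + \<epsilon> *s b))" for \<epsilon>
  have \<gamma>0: "\<gamma> 0 = z" by (simp add: \<gamma>_def u_def w_def abs_rep_proj)
  have coords: "\<exists>c c'. c \<noteq> 0 \<and> c' \<noteq> 0 \<and> rep_proj (fst (\<gamma> \<epsilon>)) = c *s (u + \<epsilon> *s a) \<and>
      rep_proj (snd (\<gamma> \<epsilon>)) = c' *s (w + \<epsilon> *s b)" for \<epsilon>
    using rep_abs_proj[OF line_u[of \<epsilon>]] rep_abs_proj[OF line_w[of \<epsilon>]] unfolding \<gamma>_def
    by (metis fst_conv snd_conv)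
  have germ: "\<exists>A B. curve_germ \<gamma> h A B" if h: "h \<in> stalk proj_prod z" for h
  proof -
    have "z = (abs_proj u, abs_proj w)" by (simp add: u_def w_def abs_rep_proj)
    then obtain F G :: "(2 + 3, 'k) mpoly" where FG: "mpoly_eval G (case_sum (vec_nth u) (vec_nth w)) \<noteq> 0"
      "\<And>u w. u \<noteq> 0 \<Longrightarrow> w \<noteq> 0 \<Longrightarrow> mpoly_eval G (case_sum (vec_nth u) (vec_nth w)) \<noteq> 0 \<Longrightarrow>
        h (abs_proj u, abs_proj w) = mpoly_eval F (case_sum (vec_nth u) (vec_nth w)) /
          mpoly_eval G (case_sum (vec_nth u) (vec_nth w))"
      using proj_prod_stalkE[of h u w] h u0 w0 by metis
    define L where "L \<epsilon> = (\<lambda>i. case_sum (vec_nth u) (vec_nth w) i + \<epsilon> * case_sum (vec_nth a) (vec_nth b) i)"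
      for \<epsilon>
    have L: "case_sum (vec_nth (u + \<epsilon> *s a)) (vec_nth (w + \<epsilon> *s b)) = L \<epsilon>" for \<epsilon>
      by (rule ext) (simp add: L_def split: sum.splits)
    obtain A where A: "\<And>\<epsilon>. mpoly_eval F (L \<epsilon>) = poly A \<epsilon>"
      using mpoly_eval_line[of F] unfolding L_def by blast
    obtain B where B: "\<And>\<epsilon>. mpoly_eval G (L \<epsilon>) = poly B \<epsilon>"
      using mpoly_eval_line[of G] unfolding L_def by blast
    have "curve_germ \<gamma> h A B"
      unfolding curve_germ_def
    proof (intro conjI allI impI)
      show "poly B 0 \<noteq> 0" using FG(1) L[of 0] B[of 0] by simp
      show "h (\<gamma> \<epsilon>) = poly A \<epsilon> / poly B \<epsilon>" if "poly B \<epsilon> \<noteq> 0" for \<epsilon>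
        using FG(2)[OF line_u line_w, of \<epsilon> \<epsilon>] that unfolding \<gamma>_def L A B by blast
    qed
    then show ?thesis by blast
  qed
  have tv: "tangent_vector proj_prod z (curve_deriv \<gamma>)"
    by (rule tangent_vector_curve[OF germ \<gamma>0])
  have pullback: "curve_deriv \<gamma> (g \<circ> add_point) = 0" if g: "g \<in> stalk proj_space (add_point z)" for g
  proof -
    obtain d F G where FG: "homogeneous_in UNIV d (F :: (4, 'k) mpoly)" "homogeneous_in UNIV d G"
      "mpoly_eval G (vec_nth (rep_proj (add_point z))) \<noteq> 0"
      "\<And>y. mpoly_eval G (vec_nth (rep_proj y)) \<noteq> 0 \<Longrightarrow>
         g y = mpoly_eval F (vec_nth (rep_proj y)) / mpoly_eval G (vec_nth (rep_proj y))"
      using g unfolding proj_space_def by auto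
    define L where "L \<epsilon> = (\<lambda>i. sym_mult u w $ i + \<epsilon> * sym_mult a b $ i)" for \<epsilon>
    obtain A where A: "\<And>\<epsilon>. mpoly_eval F (L \<epsilon>) = poly A \<epsilon>"
      using mpoly_eval_line[of F] unfolding L_def by blast
    obtain B where B: "\<And>\<epsilon>. mpoly_eval G (L \<epsilon>) = poly B \<epsilon>"
      using mpoly_eval_line[of G] unfolding L_def by blast
    have scale: "\<exists>c. c \<noteq> 0 \<and> mpoly_eval F (vec_nth (rep_proj (add_point (\<gamma> \<epsilon>)))) = c * poly A (\<epsilon>^2) \<and>
        mpoly_eval G (vec_nth (rep_proj (add_point (\<gamma> \<epsilon>)))) = c * poly B (\<epsilon>^2)" for \<epsilon>
    proof -
      obtain c c' where c: "c \<noteq> 0" "c' \<noteq> 0" "rep_proj (fst (\<gamma> \<epsilon>)) = c *s (u + \<epsilon> *s a)"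
        "rep_proj (snd (\<gamma> \<epsilon>)) = c' *s (w + \<epsilon> *s b)"
        using coords by blast
      have nz: "sym_mult (rep_proj (fst (\<gamma> \<epsilon>))) (rep_proj (snd (\<gamma> \<epsilon>))) \<noteq> 0"
        by (simp add: sym_mult_nonzero rep_proj_nonzero)
      obtain s where s: "s \<noteq> 0" "rep_proj (add_point (\<gamma> \<epsilon>)) =
          s *s sym_mult (rep_proj (fst (\<gamma> \<epsilon>))) (rep_proj (snd (\<gamma> \<epsilon>)))"
        using rep_abs_proj[OF nz] add_point_altdef[of "fst (\<gamma> \<epsilon>)" "snd (\<gamma> \<epsilon>)"]
        by (metis prod.collapse)
      have "vec_nth (rep_proj (add_point (\<gamma> \<epsilon>))) = (\<lambda>i. s * (c * c') * L (\<epsilon>^2) i)"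
        unfolding s(2) c(3,4) sym_mult_scale line by (simp add: L_def fun_eq_iff algebra_simps)
      then show ?thesis
        using c(1,2) s(1) FG(1,2) A B
        by (intro exI[of _ "(s * (c * c')) ^ d"]) (simp add: mpoly_eval_homogeneous)
    qed
    define A' B' where "A' = pcompose A [:0, 0, 1:]" and "B' = pcompose B [:0, 0, 1:]"
    have AB': "poly A' \<epsilon> = poly A (\<epsilon>^2)" "poly B' \<epsilon> = poly B (\<epsilon>^2)" for \<epsilon>
      by (simp_all add: A'_def B'_def poly_pcompose power2_eq_square)
    have "curve_germ \<gamma> (g \<circ> add_point) A' B'"
      unfolding curve_germ_def
    proof (intro conjI allI impI)
      show "poly B' 0 \<noteq> 0" using scale[of 0] FG(3) \<gamma>0 by (auto simp: AB')
      show "(g \<circ> add_point) (\<gamma> \<epsilon>) = poly A' \<epsilon> / poly B' \<epsilon>" if "poly B' \<epsilon> \<noteq> 0" for \<epsilon>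
        using scale[of \<epsilon>] FG(4)[of "add_point (\<gamma> \<epsilon>)"] that by (auto simp: AB')
    qed
    moreover have "poly (pderiv A') 0 = 0" "poly (pderiv B') 0 = 0"
      by (simp_all add: A'_def B'_def pderiv_pcompose pderiv_pCons)
    ultimately show ?thesis by (simp add: curve_deriv_eq)
  qed
  obtain k l where kl: "u $ k \<noteq> 0" "a $ l * u $ k - u $ l * a $ k \<noteq> 0"
  proof (cases "u $ 1 = 0")
    case True
    then show thesis using a that[of 2 1] by (auto simp: mult.commute)
  next
    case False
    then show thesis using a that[of 1 2] by (auto simp: mult.commute)
  qed
  define h :: "('k alg_closure, 2) proj \<times> ('k alg_closure, 3) proj \<Rightarrow> 'k alg_closure"
    where "h y = rep_proj (fst y) $ l / rep_proj (fst y) $ k" for y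
  have "h \<in> stalk proj_prod z"
    unfolding stalk_proj_prod h_def[abs_def]
    by (rule biproj.stalk_ratio[OF biproj_functions_coord(1)[unfolded proj_prod_coords_simps]
          biproj_functions_coord(1)[unfolded proj_prod_coords_simps]])
      (use kl(1) in \<open>simp add: u_def\<close>)
  moreover have "curve_germ \<gamma> h [:u $ l, a $ l:] [:u $ k, a $ k:]"
    unfolding curve_germ_def
  proof (intro conjI allI impI)
    show "poly [:u $ k, a $ k:] 0 \<noteq> 0" using kl(1) by simp
    show "h (\<gamma> \<epsilon>) = poly [:u $ l, a $ l:] \<epsilon> / poly [:u $ k, a $ k:] \<epsilon>" for \<epsilon>
    proof -
      obtain c where c: "c \<noteq> 0" "rep_proj (fst (\<gamma> \<epsilon>)) = c *s (u + \<epsilon> *s a)"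
        using coords by blast
      have "h (\<gamma> \<epsilon>) = (c * (u $ l + \<epsilon> * a $ l)) / (c * (u $ k + \<epsilon> * a $ k))"
        unfolding h_def c(2) by (simp add: algebra_simps)
      also have "\<dots> = (u $ l + \<epsilon> * a $ l) / (u $ k + \<epsilon> * a $ k)"
        using c(1) by (rule nonzero_mult_divide_mult_cancel_left)
      finally show ?thesis by simp
    qed
  qed
  then have "curve_deriv \<gamma> h = (a $ l * u $ k - u $ l * a $ k) / (u $ k)^2"
    by (simp add: curve_deriv_eq pderiv_pCons)
  then have "curve_deriv \<gamma> h \<noteq> 0" using kl by simp
  ultimately show thesis using that[OF tv _ _ pullback] by blast
qed

theorem ramification_locus_add_point:
  "ramification_locus proj_prod proj_space
     (add_point :: ('k::field_char_0 alg_closure, 2) proj \<times> ('k alg_closure, 3) proj \<Rightarrow> _) =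
   {z. resultant_form (rep_proj (fst z)) (rep_proj (snd z)) = 0}"
proof (intro equalityI subsetI CollectI)
  fix z :: "('k alg_closure, 2) proj \<times> ('k alg_closure, 3) proj"
  assume "z \<in> ramification_locus proj_prod proj_space add_point"
  then obtain \<delta> h where \<delta>: "tangent_vector proj_prod z \<delta>" "h \<in> stalk proj_prod z" "\<delta> h \<noteq> 0"
    "\<And>g. g \<in> stalk proj_space (add_point z) \<Longrightarrow> \<delta> (g \<circ> add_point) = 0"
    unfolding ramification_locus_def by blast
  then show "resultant_form (rep_proj (fst z)) (rep_proj (snd z)) = 0"
    using tangent_vector_etale[OF \<delta>(1,4) _ \<delta>(2)] by blast
next
  fix z :: "('k alg_closure, 2) proj \<times> ('k alg_closure, 3) proj"
  assume "z \<in> {z. resultant_form (rep_proj (fst z)) (rep_proj (snd z)) = 0}"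
  then obtain \<delta> h where "tangent_vector proj_prod z \<delta>" "h \<in> stalk proj_prod z" "\<delta> h \<noteq> 0"
    "\<And>g. g \<in> stalk proj_space (add_point z) \<Longrightarrow> \<delta> (g \<circ> add_point) = 0"
    using tangent_vector_ramified by blast
  moreover have "z \<in> points proj_prod" by (simp add: proj_prod_def)
  ultimately show "z \<in> ramification_locus proj_prod proj_space add_point"
    unfolding ramification_locus_def by blast
qed


subsection \<open>Morphisms into affine space and into products of projective spaces\<close>

context graded_functions
begin

lemma affine_pullback_stalk:
  fixes f :: "'p \<Rightarrow> 'k alg_closure^'n"
  assumes f: "\<And>i. (\<lambda>z. f z $ i) \<in> fraction_stalk P x"
    and g: "g \<in> stalk affine_space (f x)"
  shows "g \<circ> f \<in> fraction_stalk P x"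
proof -
  obtain F G :: "('n, 'k) mpoly" where G: "mpoly_eval G (vec_nth (f x)) \<noteq> 0"
    and FG: "\<And>z. mpoly_eval G (vec_nth z) \<noteq> 0 \<Longrightarrow>
        g z = mpoly_eval F (vec_nth z) / mpoly_eval G (vec_nth z)"
    using g unfolding affine_space_def by auto
  show ?thesis
    by (rule stalk_divide[OF stalk_mpoly[of "\<lambda>i z. f z $ i", OF f] stalk_mpoly[of "\<lambda>i z. f z $ i", OF f]])
      (use G FG in auto)
qed

lemma stalk_diff:
  assumes "f \<in> fraction_stalk P x" "g \<in> fraction_stalk P x"
  shows "(\<lambda>z. f z - g z) \<in> fraction_stalk P x"
  using stalk_add[OF assms(1) stalk_mult[OF stalk_const[of "- 1"] assms(2)]] by simp

lemma stalk_one: "(\<lambda>_. 1) \<in> fraction_stalk P x"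
  and stalk_numeral: "(\<lambda>_. numeral n) \<in> fraction_stalk P x"
  using stalk_const[of 1] stalk_const[of "numeral n"] by simp_all

lemmas stalk_intros = stalk_const stalk_one stalk_numeral stalk_add stalk_diff stalk_mult

lemma biproj_pullback_stalk:
  fixes u :: "'p \<Rightarrow> 'k alg_closure^'m::finite" and w :: "'p \<Rightarrow> 'k alg_closure^'n::finite"
  assumes nz: "\<And>y. u y \<noteq> 0" "\<And>y. w y \<noteq> 0"
    and uw: "\<And>i. (\<lambda>y. u y $ i) \<in> fraction_stalk P x" "\<And>i. (\<lambda>y. w y $ i) \<in> fraction_stalk P x"
    and h: "h \<in> stalk proj_prod (abs_proj (u x), abs_proj (w x))"
  shows "h \<circ> (\<lambda>y. (abs_proj (u y), abs_proj (w y))) \<in> fraction_stalk P x"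
proof -
  obtain F G :: "('m + 'n, 'k) mpoly" where FG:
    "mpoly_eval G (case_sum (vec_nth (u x)) (vec_nth (w x))) \<noteq> 0"
    "\<And>u w. u \<noteq> 0 \<Longrightarrow> w \<noteq> 0 \<Longrightarrow> mpoly_eval G (case_sum (vec_nth u) (vec_nth w)) \<noteq> 0 \<Longrightarrow>
      h (abs_proj u, abs_proj w) = mpoly_eval F (case_sum (vec_nth u) (vec_nth w)) /
        mpoly_eval G (case_sum (vec_nth u) (vec_nth w))"
    using proj_prod_stalkE[OF h nz] by metis
  define t where "t y = case_sum (vec_nth (u y)) (vec_nth (w y))" for y
  have tS: "(\<lambda>y. t y k) \<in> fraction_stalk P x" for k
    using uw by (cases k) (simp_all add: t_def)
  show ?thesis
    by (rule stalk_divide[OF stalk_mpoly[of "\<lambda>k y. t y k", OF tS] stalk_mpoly[of "\<lambda>k y. t y k", OF tS]])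
      (use FG(1) FG(2)[OF nz] in \<open>simp_all add: t_def\<close>)
qed

end


subsection \<open>Changes of coordinates\<close>

definition lin :: "'c::comm_ring_1^2 \<Rightarrow> 'c^2 \<Rightarrow> 'c" where
  "lin l u = l $ 1 * u $ 1 + l $ 2 * u $ 2"

text \<open>For \<open>w\<close> the product of \<open>q\<close> and \<open>r\<close>, this is \<open>l(q) m(r) + m(q) l(r)\<close>.\<close>

definition polar :: "'c::comm_ring_1^2 \<Rightarrow> 'c^2 \<Rightarrow> 'c^3 \<Rightarrow> 'c" where
  "polar l m w = 2 * l $ 1 * m $ 1 * w $ 1 + (l $ 1 * m $ 2 + l $ 2 * m $ 1) * w $ 2
     + 2 * l $ 2 * m $ 2 * w $ 3"

text \<open>On the product of \<open>q\<close> and \<open>r\<close> this takes the value l(q)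
  l(r).\<close>

definition quad :: "'c::comm_ring_1^2 \<Rightarrow> 'c^3 \<Rightarrow> 'c" where
  "quad l w = (l $ 1)^2 * w $ 1 + l $ 1 * l $ 2 * w $ 2 + (l $ 2)^2 * w $ 3"

definition frame1 :: "'c::comm_ring_1^2 \<Rightarrow> 'c^2 \<Rightarrow> 'c^2 \<Rightarrow> 'c^2" where
  "frame1 l m u = vector [lin l u, lin m u]"

text \<open>The map on quadratic forms induced by \<open>frame1\<close>: it sends the product of
  \<open>q\<close> and \<open>r\<close> to the product of their images.\<close>

definition frame2 :: "'c::comm_ring_1^2 \<Rightarrow> 'c^2 \<Rightarrow> 'c^3 \<Rightarrow> 'c^3" where
  "frame2 l m w = vector [quad l w, polar l m w, quad m w]"

definition frame_det :: "'c::comm_ring_1^2 \<Rightarrow> 'c^2 \<Rightarrow> 'c" where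
  "frame_det l m = l $ 1 * m $ 2 - l $ 2 * m $ 1"

text \<open>The adjugate frame inverts \<open>frame1\<close> up to the determinant without division;
  the scalar does not matter for points of projective space.\<close>

definition coframe1 where
  "coframe1 l m = frame1 (vector [m $ 2, - l $ 2]) (vector [- m $ 1, l $ 1])"

definition coframe2 where
  "coframe2 l m = frame2 (vector [m $ 2, - l $ 2]) (vector [- m $ 1, l $ 1])"

lemmas frame_defs = frame1_def frame2_def coframe1_def coframe2_def lin_def quad_def polar_def frame_det_def

lemma frame_inverse:
  "coframe1 l m (frame1 l m u) = frame_det l m *s u" "frame1 l m (coframe1 l m u) = frame_det l m *s u"
  "coframe2 l m (frame2 l m w) = (frame_det l m)^2 *s w"
  "frame2 l m (coframe2 l m w) = (frame_det l m)^2 *s w"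
  by (simp_all add: frame_defs vec_eq_2 vec_eq_3 algebra_simps power2_eq_square)

lemma frame_scale:
  "frame1 l m (c *s u) = c *s frame1 l m u" "coframe1 l m (c *s u) = c *s coframe1 l m u"
  "frame2 l m (c *s w) = c *s frame2 l m w" "coframe2 l m (c *s w) = c *s coframe2 l m w"
  by (simp_all add: frame_defs vec_eq_2 vec_eq_3 algebra_simps)

lemma frame_zero: "frame1 l m 0 = 0" "frame2 l m 0 = 0"
  by (simp_all add: frame_defs vec_eq_2 vec_eq_3)

lemma frame_nonzero:
  fixes l :: "'c::field^2"
  assumes "frame_det l m \<noteq> 0"
  shows "u \<noteq> 0 \<Longrightarrow> frame1 l m u \<noteq> 0" "w \<noteq> 0 \<Longrightarrow> frame2 l m w \<noteq> 0"
proof -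
  show "frame1 l m u \<noteq> 0" if "u \<noteq> 0"
  proof
    assume "frame1 l m u = 0"
    then have "frame_det l m *s u = 0"
      using frame_inverse(1)[of l m u] by (simp add: coframe1_def frame_zero)
    with that assms show False by simp
  qed
  show "frame2 l m w \<noteq> 0" if "w \<noteq> 0"
  proof
    assume "frame2 l m w = 0"
    then have "(frame_det l m)^2 *s w = 0"
      using frame_inverse(3)[of l m w] by (simp add: coframe2_def frame_zero)
    with that assms show False by simp
  qed
qed

lemma coframe_nonzero:
  fixes l :: "'c::field^2"
  assumes "frame_det l m \<noteq> 0"
  shows "u \<noteq> 0 \<Longrightarrow> coframe1 l m u \<noteq> 0" "w \<noteq> 0 \<Longrightarrow> coframe2 l m w \<noteq> 0"
proof -
  show "coframe1 l m u \<noteq> 0" if "u \<noteq> 0"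
  proof
    assume "coframe1 l m u = 0"
    then have "frame_det l m *s u = 0" using frame_inverse(2)[of l m u] by (simp add: frame_zero)
    with that assms show False by simp
  qed
  show "coframe2 l m w \<noteq> 0" if "w \<noteq> 0"
  proof
    assume "coframe2 l m w = 0"
    then have "(frame_det l m)^2 *s w = 0" using frame_inverse(4)[of l m w] by (simp add: frame_zero)
    with that assms show False by simp
  qed
qed

lemma resultant_form_frame:
  "resultant_form (frame1 l m u) (frame2 l m w) = (frame_det l m)^2 * resultant_form u w"
  by (simp add: resultant_form_def frame_defs algebra_simps power2_eq_square)

lemma resultant_form_scale:
  "resultant_form (c *s u) (c' *s w) = c^2 * c' * resultant_form u w"
  by (simp add: resultant_form_def algebra_simps power2_eq_square)

section \<open>The equations of U in coordinates\<close>

definition hyper_form :: "'c::comm_ring_1^4 \<Rightarrow> 'c^2 \<Rightarrow> 'c^3 \<Rightarrow> 'c" where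
  "hyper_form a u w = (\<Sum>i\<in>UNIV. a $ i * sym_mult u w $ i)"

lemma hyper_form_altdef:
  "hyper_form a u w = a $ 1 * (u $ 1 * w $ 1) + a $ 2 * (u $ 1 * w $ 2 + u $ 2 * w $ 1)
     + a $ 3 * (u $ 1 * w $ 3 + u $ 2 * w $ 2) + a $ 4 * (u $ 2 * w $ 3)"
  by (simp add: hyper_form_def sum_4 sym_mult_def)

definition vec_ac :: "'k::field^'n \<Rightarrow> 'k alg_closure^'n" where
  "vec_ac v = (\<chi> i. to_ac (v $ i))"

lemma vec_ac_nth [simp]: "vec_ac v $ i = to_ac (v $ i)"
  by (simp add: vec_ac_def)

definition good_points :: "'k::field^4 \<Rightarrow> (('k alg_closure, 2) proj \<times> ('k alg_closure, 3) proj) set" where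
  "good_points a = {z. resultant_form (rep_proj (fst z)) (rep_proj (snd z)) \<noteq> 0 \<and>
     hyper_form (vec_ac a) (rep_proj (fst z)) (rep_proj (snd z)) \<noteq> 0}"

lemma good_points_eq:
  fixes a :: "'k::field_char_0^4"
  shows "UNIV - (ramification_locus proj_prod proj_space
      (add_point :: ('k alg_closure, 2) proj \<times> ('k alg_closure, 3) proj \<Rightarrow> ('k alg_closure, 4) proj)
      \<union> add_point -` hyperplane a) = good_points a"
proof -
  have "add_point z \<in> hyperplane a \<longleftrightarrow> hyper_form (vec_ac a) (rep_proj (fst z)) (rep_proj (snd z)) = 0"
    for z :: "('k alg_closure, 2) proj \<times> ('k alg_closure, 3) proj"
  proof -
    have nz: "sym_mult (rep_proj (fst z)) (rep_proj (snd z)) \<noteq> 0"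
      by (simp add: sym_mult_nonzero rep_proj_nonzero)
    obtain c where c: "c \<noteq> 0" "rep_proj (add_point z) = c *s sym_mult (rep_proj (fst z)) (rep_proj (snd z))"
      using rep_abs_proj[OF nz] add_point_altdef[of "fst z" "snd z"] by (metis prod.collapse)
    have "(\<Sum>i\<in>UNIV. to_ac (a $ i) * rep_proj (add_point z) $ i) =
        c * hyper_form (vec_ac a) (rep_proj (fst z)) (rep_proj (snd z))"
      unfolding c(2) hyper_form_def by (simp add: sum_distrib_left mult_ac)
    then show ?thesis using c(1) by (simp add: hyperplane_def)
  qed
  then show ?thesis
    unfolding ramification_locus_add_point good_points_def by auto
qed

lemma open_subspace_simps:
  "points (open_subspace proj_prod U) = U" "stalk (open_subspace V U) = stalk V"
  by (simp_all add: open_subspace_def proj_prod_def)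

lemma points_affine_space: "points affine_space = UNIV"
  by (simp add: affine_space_def)

definition frame_point ::
    "'c::field^2 \<Rightarrow> 'c^2 \<Rightarrow> 'c^2 \<Rightarrow> 'c^3 \<Rightarrow> ('c, 2) proj \<times> ('c, 3) proj" where
  "frame_point l m u w = (abs_proj (coframe1 l m u), abs_proj (coframe2 l m w))"

lemma frame_point_coords:
  fixes l :: "'c::field^2"
  assumes det: "frame_det l m \<noteq> 0" and nz: "u \<noteq> 0" "w \<noteq> 0"
  obtains c c' where "c \<noteq> 0" "c' \<noteq> 0"
    "rep_proj (fst (frame_point l m u w)) = c *s coframe1 l m u"
    "rep_proj (snd (frame_point l m u w)) = c' *s coframe2 l m w"
    "frame1 l m (rep_proj (fst (frame_point l m u w))) = (c * frame_det l m) *s u"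
    "frame2 l m (rep_proj (snd (frame_point l m u w))) = (c' * (frame_det l m)^2) *s w"
proof -
  obtain c where c: "c \<noteq> 0" "rep_proj (abs_proj (coframe1 l m u)) = c *s coframe1 l m u"
    using rep_abs_proj[OF coframe_nonzero(1)[OF det nz(1)]] .
  obtain c' where c': "c' \<noteq> 0" "rep_proj (abs_proj (coframe2 l m w)) = c' *s coframe2 l m w"
    using rep_abs_proj[OF coframe_nonzero(2)[OF det nz(2)]] .
  show thesis
    by (rule that[OF c(1) c'(1)])
      (simp_all add: frame_point_def c(2) c'(2) frame_scale frame_inverse)
qed

lemma frame_point_scale:
  fixes l :: "'c::field^2"
  assumes "frame_det l m \<noteq> 0" "u \<noteq> 0" "w \<noteq> 0" "c \<noteq> 0" "c' \<noteq> 0"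
  shows "frame_point l m (c *s u) (c' *s w) = frame_point l m u w"
  using assms by (simp add: frame_point_def frame_scale abs_proj_scale coframe_nonzero)

lemma frame_point_frame:
  fixes l :: "'c::field^2"
  assumes "frame_det l m \<noteq> 0"
  shows "frame_point l m (frame1 l m (rep_proj (fst z))) (frame2 l m (rep_proj (snd z))) = z"
  using assms by (simp add: frame_point_def frame_inverse abs_proj_scale rep_proj_nonzero abs_rep_proj)

lemma biproj_coords:
  "(\<lambda>z. rep_proj (fst z) $ i) \<in> biproj_functions (1, 0)"
  "(\<lambda>z. rep_proj (snd z) $ j) \<in> biproj_functions (0, 1)"
  using biproj_functions_coord[unfolded proj_prod_coords_simps] by blast+

lemma biproj_bilinear:
  "(\<lambda>z. rep_proj (fst z) $ i * rep_proj (snd z) $ j) \<in> biproj_functions (1, 1)"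
  using biproj.mult[OF biproj_coords, of i j] by simp

lemma biproj_hyper_form:
  "(\<lambda>z. hyper_form (vec_ac a) (rep_proj (fst z)) (rep_proj (snd z))) \<in> biproj_functions (1, 1)"
  unfolding hyper_form_altdef vec_ac_nth
  by (intro biproj.add biproj.smult biproj_bilinear)

lemma biproj_resultant_form:
  "(\<lambda>z. resultant_form (rep_proj (fst z)) (rep_proj (snd z))) \<in> biproj_functions (2, 1)"
proof -
  have *: "(\<lambda>z. rep_proj (snd z) $ j * (rep_proj (fst z) $ i * rep_proj (fst z) $ k)) \<in> biproj_functions (2, 1)"
    for i k j
    using biproj.mult[OF biproj_coords(2)[of j] biproj.mult[OF biproj_coords(1)[of i] biproj_coords(1)[of k]]]
    by (simp add: numeral_2_eq_2)
  show ?thesis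
    unfolding resultant_form_def power2_eq_square mult.assoc
    by (intro biproj.add biproj.diff *)
qed

lemma biproj_lin: "(\<lambda>z. lin (vec_ac l) (rep_proj (fst z))) \<in> biproj_functions (1, 0)"
  unfolding lin_def vec_ac_nth by (intro biproj.add biproj.smult biproj_coords)

lemma biproj_quad: "(\<lambda>z. quad (vec_ac l) (rep_proj (snd z))) \<in> biproj_functions (0, 1)"
  unfolding quad_def vec_ac_nth to_ac_power[symmetric] to_ac_mult[symmetric]
  by (intro biproj.add biproj.smult biproj_coords)

lemma biproj_polar: "(\<lambda>z. polar (vec_ac l) (vec_ac m) (rep_proj (snd z))) \<in> biproj_functions (0, 1)"
proof -
  have "polar (vec_ac l) (vec_ac m) w = to_ac (2 * l $ 1 * m $ 1) * w $ 1
      + to_ac (l $ 1 * m $ 2 + l $ 2 * m $ 1) * w $ 2 + to_ac (2 * l $ 2 * m $ 2) * w $ 3" for w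
    by (simp add: polar_def)
  then show ?thesis by (simp only:) (intro biproj.add biproj.smult biproj_coords)
qed

text \<open>
  Homogeneous coordinates are normalised by the condition that the equations of \<open>H\<close> and of \<open>R\<close>
  take the value 1; these have the degrees \<open>(1, 1)\<close> and \<open>(2, 1)\<close>, a basis of \<open>\<int>\<^sup>2\<close>.
\<close>

lemma normalised_stalk:
  fixes a :: "'k::field^4"
  defines "L \<equiv> \<lambda>z. hyper_form (vec_ac a) (rep_proj (fst z)) (rep_proj (snd z))"
    and "Q \<equiv> \<lambda>z. resultant_form (rep_proj (fst z)) (rep_proj (snd z))"
  assumes z: "z \<in> good_points a"
  shows "F \<in> biproj_functions (1, 0) \<Longrightarrow> (\<lambda>z. F z * L z / Q z) \<in> fraction_stalk biproj_functions z"
    and "F \<in> biproj_functions (0, 1) \<Longrightarrow> (\<lambda>z. F z * Q z / (L z)^2) \<in> fraction_stalk biproj_functions z"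
proof -
  have nz: "L z \<noteq> 0" "Q z \<noteq> 0" using z by (auto simp: good_points_def L_def Q_def)
  have L: "L \<in> biproj_functions (1, 1)" and Q: "Q \<in> biproj_functions (2, 1)"
    unfolding L_def Q_def by (rule biproj_hyper_form, rule biproj_resultant_form)
  show "(\<lambda>z. F z * L z / Q z) \<in> fraction_stalk biproj_functions z" if "F \<in> biproj_functions (1, 0)"
  proof (rule biproj.stalk_ratio[of _ "(2, 1)"])
    show "(\<lambda>z. F z * L z) \<in> biproj_functions (2, 1)"
      using biproj.mult[OF that L] by (simp add: numeral_2_eq_2)
  qed (use nz Q in auto)
  show "(\<lambda>z. F z * Q z / (L z)^2) \<in> fraction_stalk biproj_functions z" if "F \<in> biproj_functions (0, 1)"
  proof (rule biproj.stalk_ratio[of _ "(2, 2)"])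
    show "(\<lambda>z. F z * Q z) \<in> biproj_functions (2, 2)"
      using biproj.mult[OF that Q] by (simp add: numeral_2_eq_2)
    show "(\<lambda>z. (L z)^2) \<in> biproj_functions (2, 2)"
      using biproj.mult[OF L L] by (simp add: numeral_2_eq_2 power2_eq_square)
  qed (use nz in auto)
qed


subsection \<open>Tangent hyperplanes\<close>

text \<open>Each new variable is a quotient by x: y times the first equation minus the second gives
  y - 1 = x u, the first equation then gives 1 - A = x v, and the definition of u gives 3 u - 2 v =
  x w. So x, u, w remain free, and v is recovered by dividing by 2.\<close>

lemma tangent_normal_form_forward:
  fixes x :: "'c::field"
  assumes "y * A + x * N = 1" "y^2 * A - x * y * N + x^2 * B = 1"
    and u: "u = 2 * y * N - x * B" and v: "v = N + u * A" and w: "w = 2 * u * v + 2 * u * N - B"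
  shows "1 + x * u = y" "3 * u - x * w = 2 * v" "1 - x * v = A" "v - u * A = N" "2 * u * v + 2 * u * N - w = B"
proof -
  show y: "1 + x * u = y" using assms(1,2) u by Groebner_Basis.algebra
  show A: "1 - x * v = A" using assms(1) v y by Groebner_Basis.algebra
  show "v - u * A = N" "2 * u * v + 2 * u * N - w = B" by (simp_all add: v w)
  show "3 * u - x * w = 2 * v" using assms(1) u v w y A by Groebner_Basis.algebra
qed

lemma tangent_normal_form_backward:
  fixes x :: "'c::field"
  assumes y: "y = 1 + x * u" and v: "2 * v = 3 * u - x * w" and A: "A = 1 - x * v" and N: "N = v - u * A"
    and B: "B = 2 * u * v + 2 * u * N - w"
  shows "y * A + x * N = 1" "y^2 * A - x * y * N + x^2 * B = 1" "2 * y * N - x * B = u"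
    "N + u * A = v" "2 * u * v + 2 * u * N - B = w"
proof -
  show "y * A + x * N = 1" using y A N by Groebner_Basis.algebra
  show "y^2 * A - x * y * N + x^2 * B = 1" using y A N B v by Groebner_Basis.algebra
  show "2 * y * N - x * B = u" using y A N B v by Groebner_Basis.algebra
  show "N + u * A = v" by (simp add: N)
  show "2 * u * v + 2 * u * N - B = w" by (simp add: B)
qed

lemma affine_stalk_coord: "(\<lambda>z. z $ i) \<in> fraction_stalk affine_functions x"
  using affine.stalk_ratio[OF affine_functions_coord[of i 0] affine.const[of 1]] by simp

text \<open>The hypotheses say that the cubic of \<open>a\<close> is l^2 m; its middle coefficients
  carry the binomial factor 3. As \<open>l\<close> and \<open>m\<close> are defined over
  \<open>k\<close>, so are both maps, as germs require.\<close>

theorem tangent_isomorphic_affine_space: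
  fixes a :: "'k::field_char_0^4"
  assumes det: "frame_det l m \<noteq> 0"
    and a: "a $ 1 = l $ 1 ^ 2 * m $ 1" "3 * a $ 2 = l $ 1 ^ 2 * m $ 2 + 2 * l $ 1 * l $ 2 * m $ 1"
      "3 * a $ 3 = l $ 2 ^ 2 * m $ 1 + 2 * l $ 1 * l $ 2 * m $ 2" "a $ 4 = l $ 2 ^ 2 * m $ 2"
  shows "isomorphic_varieties (open_subspace proj_prod (good_points a))
    (affine_space :: ('k alg_closure^3, 'k alg_closure) fun_space)"
proof -
  define d where "d = frame_det (vec_ac l) (vec_ac m)"
  have d: "d = to_ac (frame_det l m)" by (simp add: d_def frame_det_def)
  then have d0: "d \<noteq> 0" using det by simp
  have det_ac: "frame_det (vec_ac l) (vec_ac m) \<noteq> 0" using d0 by (simp add: d_def)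
  have char: "(3 :: 'k alg_closure) \<noteq> 0" "(2 :: 'k alg_closure) \<noteq> 0" by simp_all
  define Lf where "Lf z = hyper_form (vec_ac a) (rep_proj (fst z)) (rep_proj (snd z))" for z
  define Qf :: "('k alg_closure, 2) proj \<times> ('k alg_closure, 3) proj \<Rightarrow> _" where
    "Qf z = resultant_form (rep_proj (fst z)) (rep_proj (snd z))" for z
  define Xf Yf where "Xf z = lin (vec_ac l) (rep_proj (fst z))" and "Yf z = lin (vec_ac m) (rep_proj (fst z))"
    for z :: "('k alg_closure, 2) proj \<times> ('k alg_closure, 3) proj"
  define Af Nf Bf where "Af z = quad (vec_ac l) (rep_proj (snd z))"
    and "Nf z = polar (vec_ac l) (vec_ac m) (rep_proj (snd z))" and "Bf z = quad (vec_ac m) (rep_proj (snd z))"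
    for z :: "('k alg_closure, 2) proj \<times> ('k alg_closure, 3) proj"
  note frame_coord_defs = Xf_def Yf_def Af_def Nf_def Bf_def
  \<comment> \<open>Polarising l^2 m at three points gives three terms, whence the factor 3; two of
    them combine to \<open>Xf z * Nf z\<close>.\<close>
  have Lf_eq: "3 * Lf z = Yf z * Af z + Xf z * Nf z" for z
  proof -
    have ac: "vec_ac a $ 1 = to_ac (l $ 1) ^ 2 * to_ac (m $ 1)"
      "3 * vec_ac a $ 2 = to_ac (l $ 1) ^ 2 * to_ac (m $ 2) + 2 * to_ac (l $ 1) * to_ac (l $ 2) * to_ac (m $ 1)"
      "3 * vec_ac a $ 3 = to_ac (l $ 2) ^ 2 * to_ac (m $ 1) + 2 * to_ac (l $ 1) * to_ac (l $ 2) * to_ac (m $ 2)"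
      "vec_ac a $ 4 = to_ac (l $ 2) ^ 2 * to_ac (m $ 2)"
      using a[THEN arg_cong[of _ _ to_ac]] by simp_all
    define u w where "u = rep_proj (fst z)" and "w = rep_proj (snd z)"
    show ?thesis
      unfolding Lf_def frame_coord_defs u_def[symmetric] w_def[symmetric] hyper_form_altdef
        lin_def quad_def polar_def vec_ac_nth[of l] vec_ac_nth[of m]
      using ac by Groebner_Basis.algebra
  qed
  have Qf_eq: "d^2 * Qf z = Af z * Yf z^2 - Nf z * Xf z * Yf z + Bf z * Xf z^2" for z
    using resultant_form_frame[of "vec_ac l" "vec_ac m" "rep_proj (fst z)" "rep_proj (snd z)"]
    by (simp add: Qf_def d_def frame_coord_defs resultant_form_def frame1_def frame2_def)
  define U where "U = good_points a"
  have U: "z \<in> U \<longleftrightarrow> Qf z \<noteq> 0 \<and> Lf z \<noteq> 0" for z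
    by (simp add: U_def good_points_def Qf_def Lf_def)
  \<comment> \<open>The scalings satisfy s t = 1/3 and d^2 s^2 t = 1, so both normalised equations
    get the value 1.\<close>
  define s t where "s = to_ac (3 / frame_det l m ^ 2)" and "t = to_ac (frame_det l m ^ 2 / 9)"
  have st: "s = 3 / d^2" "t = d^2 / 9" by (simp_all add: s_def t_def d)
  define x y where "x z = s * (Xf z * Lf z / Qf z)" and "y z = s * (Yf z * Lf z / Qf z)" for z
  define A' N' B' where "A' z = t * (Af z * Qf z / (Lf z)^2)" and "N' z = t * (Nf z * Qf z / (Lf z)^2)"
    and "B' z = t * (Bf z * Qf z / (Lf z)^2)" for z
  define u where "u z = 2 * y z * N' z - x z * B' z" for z
  define v where "v z = N' z + u z * A' z" for z
  define w where "w z = 2 * u z * v z + 2 * u z * N' z - B' z" for z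
  define f where "f z = (vector [x z, u z, w z] :: 'k alg_closure^3)" for z
  define yi vi where "yi p = 1 + p $ 1 * p $ 2" and "vi p = to_ac (1 / 2) * (3 * p $ 2 - p $ 1 * p $ 3)"
    for p :: "'k alg_closure^3"
  define Ai where "Ai p = 1 - p $ 1 * vi p" for p
  define Ni where "Ni p = vi p - p $ 2 * Ai p" for p
  define Bi where "Bi p = 2 * p $ 2 * vi p + 2 * p $ 2 * Ni p - p $ 3" for p
  define ui :: "'k alg_closure^3 \<Rightarrow> 'k alg_closure^2" where "ui p = vector [p $ 1, yi p]" for p
  define wi :: "'k alg_closure^3 \<Rightarrow> 'k alg_closure^3" where "wi p = vector [Ai p, Ni p, Bi p]" for p
  define g where "g p = frame_point (vec_ac l) (vec_ac m) (ui p) (wi p)" for p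
  have "2 * vi p = 3 * p $ 2 - p $ 1 * p $ 3" for p
    by (simp add: vi_def)
  note bwd = tangent_normal_form_backward[OF yi_def this Ai_def Ni_def Bi_def]
  have uw_nz: "ui p \<noteq> 0" "wi p \<noteq> 0" for p
    using bwd(1)[of p] by (auto simp: ui_def wi_def vec_eq_2 vec_eq_3)
  have gf_id: "g p \<in> U \<and> f (g p) = p" for p
  proof -
    obtain c c' where c: "c \<noteq> 0" "c' \<noteq> 0"
      "frame1 (vec_ac l) (vec_ac m) (rep_proj (fst (g p))) = (c * d) *s ui p"
      "frame2 (vec_ac l) (vec_ac m) (rep_proj (snd (g p))) = (c' * d^2) *s wi p"
      using frame_point_coords[OF det_ac uw_nz] unfolding g_def d_def by metis
    define \<sigma> \<tau> where "\<sigma> = c * d" and "\<tau> = c' * d^2"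
    have \<sigma>\<tau>: "\<sigma> \<noteq> 0" "\<tau> \<noteq> 0" using c d0 by (simp_all add: \<sigma>_def \<tau>_def)
    have co: "Xf (g p) = \<sigma> * p $ 1" "Yf (g p) = \<sigma> * yi p" "Af (g p) = \<tau> * Ai p" "Nf (g p) = \<tau> * Ni p"
      "Bf (g p) = \<tau> * Bi p"
      using c(3,4) by (auto simp: frame1_def frame2_def ui_def wi_def vec_eq_2 vec_eq_3 frame_coord_defs
          \<sigma>_def \<tau>_def)
    have "3 * Lf (g p) = \<sigma> * \<tau> * (yi p * Ai p + p $ 1 * Ni p)"
      unfolding Lf_eq co by (simp add: algebra_simps)
    then have Lg: "Lf (g p) = \<sigma> * \<tau> / 3" unfolding bwd(1) by (simp add: field_simps)
    have "d^2 * Qf (g p) = \<sigma>^2 * \<tau> * ((yi p)^2 * Ai p - p $ 1 * yi p * Ni p + (p $ 1)^2 * Bi p)"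
      unfolding Qf_eq co by (simp add: algebra_simps power2_eq_square)
    then have Qg: "Qf (g p) = \<sigma>^2 * \<tau> / d^2" unfolding bwd(2) using d0 by (simp add: field_simps)
    have inU: "g p \<in> U" using \<sigma>\<tau> d0 by (simp add: U Lg Qg)
    have 1: "s * (\<sigma> * q * Lf (g p) / Qf (g p)) = q" for q
      unfolding Lg Qg st using \<sigma>\<tau> d0 by (simp add: field_simps power2_eq_square)
    have 2: "t * (\<tau> * q * Qf (g p) / (Lf (g p))^2) = q" for q
      unfolding Lg Qg st using \<sigma>\<tau> d0 by (simp add: field_simps power2_eq_square)
    have xg: "x (g p) = p $ 1" "y (g p) = yi p" "A' (g p) = Ai p" "N' (g p) = Ni p" "B' (g p) = Bi p"
      unfolding x_def y_def A'_def N'_def B'_def co by (rule 1 2)+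
    have ug: "u (g p) = p $ 2" unfolding u_def xg by (rule bwd(3))
    have vg: "v (g p) = vi p" unfolding v_def xg ug by (rule bwd(4))
    have wg: "w (g p) = p $ 3" unfolding w_def xg ug vg by (rule bwd(5))
    show ?thesis
      using inU by (simp add: f_def xg ug wg vec_eq_3)
  qed
  have fg_id: "g (f z) = z" if z: "z \<in> U" for z
  proof -
    have nz: "Qf z \<noteq> 0" "Lf z \<noteq> 0" using z U by auto
    have "y z * A' z + x z * N' z = (Yf z * Af z + Xf z * Nf z) * (s * t / Lf z)"
      using nz by (simp add: x_def y_def A'_def N'_def field_simps power2_eq_square)
    also have "\<dots> = 1"
      unfolding Lf_eq[symmetric] st using nz d0 by (simp add: field_simps)
    finally have 1: "y z * A' z + x z * N' z = 1" .
    have "(y z)^2 * A' z - x z * y z * N' z + (x z)^2 * B' z =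
        (Af z * Yf z^2 - Nf z * Xf z * Yf z + Bf z * Xf z^2) * (s^2 * t / Qf z)"
      using nz by (simp add: x_def y_def A'_def N'_def B'_def field_simps power2_eq_square)
    also have "\<dots> = 1"
      unfolding Qf_eq[symmetric] st using nz d0 by (simp add: field_simps power2_eq_square)
    finally have 2: "(y z)^2 * A' z - x z * y z * N' z + (x z)^2 * B' z = 1" .
    note fwd = tangent_normal_form_forward[OF 1 2 u_def v_def w_def]
    have fz: "f z $ 1 = x z" "f z $ 2 = u z" "f z $ 3 = w z" by (simp_all add: f_def)
    have yf: "yi (f z) = y z" unfolding yi_def fz by (rule fwd(1))
    have vf: "vi (f z) = v z" unfolding vi_def fz fwd(2) by simp
    have Af: "Ai (f z) = A' z" unfolding Ai_def fz vf by (rule fwd(3))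
    have Nf: "Ni (f z) = N' z" unfolding Ni_def fz vf Af by (rule fwd(4))
    have Bf: "Bi (f z) = B' z" unfolding Bi_def fz vf Nf by (rule fwd(5))
    have "ui (f z) = (s * Lf z / Qf z) *s frame1 (vec_ac l) (vec_ac m) (rep_proj (fst z))"
      by (simp add: ui_def yf fz frame1_def vec_eq_2 x_def y_def frame_coord_defs)
    moreover have "wi (f z) = (t * Qf z / (Lf z)^2) *s frame2 (vec_ac l) (vec_ac m) (rep_proj (snd z))"
      by (simp add: wi_def Af Nf Bf frame2_def vec_eq_3 A'_def N'_def B'_def frame_coord_defs)
    moreover have "s * Lf z / Qf z \<noteq> 0" "t * Qf z / (Lf z)^2 \<noteq> 0"
      using nz d0 by (simp_all add: st)
    moreover have "frame1 (vec_ac l) (vec_ac m) (rep_proj (fst z)) \<noteq> 0"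
      "frame2 (vec_ac l) (vec_ac m) (rep_proj (snd z)) \<noteq> 0"
      by (simp_all add: frame_nonzero[OF det_ac] rep_proj_nonzero)
    ultimately show ?thesis
      by (simp add: g_def frame_point_scale[OF det_ac] frame_point_frame[OF det_ac])
  qed
  have f_mor: "variety_morphism (open_subspace proj_prod U) affine_space f"
    unfolding variety_morphism_def open_subspace_simps points_affine_space
  proof (intro conjI ballI)
    fix z :: "('k alg_closure, 2) proj \<times> ('k alg_closure, 3) proj" and h
    assume z: "z \<in> U" and h: "h \<in> stalk affine_space (f z)"
    note ns = normalised_stalk[OF z[unfolded U_def], folded Lf_def Qf_def]
    have xyS: "x \<in> fraction_stalk biproj_functions z" "y \<in> fraction_stalk biproj_functions z"
      unfolding x_def[abs_def] y_def[abs_def] s_def Xf_def Yf_def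
      by (intro biproj.stalk_mult biproj.stalk_const ns biproj_lin)+
    have AS: "A' \<in> fraction_stalk biproj_functions z" "N' \<in> fraction_stalk biproj_functions z"
      "B' \<in> fraction_stalk biproj_functions z"
      unfolding A'_def[abs_def] N'_def[abs_def] B'_def[abs_def] t_def Af_def Nf_def Bf_def
      by (intro biproj.stalk_mult biproj.stalk_const ns biproj_quad biproj_polar)+
    have uS: "u \<in> fraction_stalk biproj_functions z"
      unfolding u_def[abs_def] by (intro biproj.stalk_intros xyS AS)
    then have vS: "v \<in> fraction_stalk biproj_functions z"
      unfolding v_def[abs_def] by (intro biproj.stalk_intros AS)
    with uS have wS: "w \<in> fraction_stalk biproj_functions z"
      unfolding w_def[abs_def] by (intro biproj.stalk_intros AS)
    have "(\<lambda>z. f z $ i) \<in> fraction_stalk biproj_functions z" for i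
      using exhaust_3[of i] xyS(1) uS wS by (auto simp: f_def)
    then show "h \<circ> f \<in> stalk proj_prod z"
      unfolding stalk_proj_prod using h by (rule biproj.affine_pullback_stalk)
  qed auto
  have g_mor: "variety_morphism affine_space (open_subspace proj_prod U) g"
    unfolding variety_morphism_def open_subspace_simps points_affine_space
  proof (intro conjI ballI)
    show "g \<in> UNIV \<rightarrow> U" using gf_id by auto
    fix p :: "'k alg_closure^3" and h
    assume h: "h \<in> stalk proj_prod (g p)"
    note co = affine_stalk_coord
    have vi: "vi \<in> fraction_stalk affine_functions p"
      unfolding vi_def[abs_def] by (intro affine.stalk_intros co)
    then have Ai: "Ai \<in> fraction_stalk affine_functions p"
      unfolding Ai_def[abs_def] by (intro affine.stalk_intros co)
    with vi have Ni: "Ni \<in> fraction_stalk affine_functions p"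
      unfolding Ni_def[abs_def] by (intro affine.stalk_intros co)
    with vi have Bi: "Bi \<in> fraction_stalk affine_functions p"
      unfolding Bi_def[abs_def] by (intro affine.stalk_intros co)
    have yi: "yi \<in> fraction_stalk affine_functions p"
      unfolding yi_def[abs_def] by (intro affine.stalk_intros co)
    have neg: "(\<lambda>p. - h p) \<in> fraction_stalk affine_functions p" if "h \<in> fraction_stalk affine_functions p" for h
      using affine.stalk_mult[OF affine.stalk_const[of "- 1"] that] by simp
    have "(\<lambda>p. coframe1 (vec_ac l) (vec_ac m) (ui p) $ i) \<in> fraction_stalk affine_functions p" for i
      using exhaust_2[of i]
      by (auto simp: coframe1_def frame1_def lin_def ui_def intro!: affine.stalk_intros co yi neg)
    moreover have "(\<lambda>p. coframe2 (vec_ac l) (vec_ac m) (wi p) $ i) \<in> fraction_stalk affine_functions p" for i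
      using exhaust_3[of i]
      by (auto simp: coframe2_def frame2_def quad_def polar_def wi_def simp flip: to_ac_power
          intro!: affine.stalk_intros co Ai Ni Bi neg)
    ultimately show "h \<circ> g \<in> stalk affine_space p"
      using h coframe_nonzero[OF det_ac] uw_nz
      unfolding stalk_affine_space g_def[abs_def] frame_point_def
      by (intro affine.biproj_pullback_stalk) auto
  qed
  show ?thesis
    unfolding isomorphic_varieties_def U_def[symmetric]
  proof (intro exI conjI)
    show "\<forall>z\<in>points (open_subspace proj_prod U). g (f z) = z"
      using fg_id by (simp add: open_subspace_simps)
    show "\<forall>p\<in>points affine_space. f (g p) = p" using gf_id by simp
  qed (fact f_mor g_mor)+
qed


subsection \<open>Consequences of an isomorphism with affine space\<close>

definition vec3 :: "(nat \<Rightarrow> 'c::zero) \<Rightarrow> 'c^3" where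
  "vec3 x = vector [x 0, x 1, x 2]"

lemma vec3_surj: "vec3 (\<lambda>i. if i = 0 then p $ 1 else if i = 1 then p $ 2 else if i = 2 then p $ 3 else 0) = p"
  by (simp add: vec3_def vec_eq_3)

lemma polyfun_vec3: "polyfun (\<lambda>x. vec3 x $ i)"
  using exhaust_3[of i] by (auto simp: vec3_def intro: polyfun_intros)

lemma regular_function_polyfun:
  fixes h :: "'k::field_char_0 alg_closure^3 \<Rightarrow> 'k alg_closure"
  assumes h: "\<And>p. h \<in> stalk affine_space p"
  shows "polyfun (\<lambda>x. h (vec3 x))"
proof -
  have "\<exists>m E. polyfun E \<and>
    (\<forall>x\<in>basic_open 1. (\<forall>i\<ge>3. x i = 0) \<longrightarrow> poly 1 (x 0) ^ m * h (vec3 x) = E x)"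
  proof (rule locally_rational_polynomial)
    fix x :: "nat \<Rightarrow> 'k alg_closure"
    obtain F G :: "(3, 'k) mpoly" where FG: "mpoly_eval G (vec_nth (vec3 x)) \<noteq> 0"
      "\<And>z. mpoly_eval G (vec_nth z) \<noteq> 0 \<Longrightarrow> h z = mpoly_eval F (vec_nth z) / mpoly_eval G (vec_nth z)"
      using h[of "vec3 x"] unfolding affine_space_def by auto
    show "\<exists>F G. polyfun F \<and> polyfun G \<and> G x \<noteq> 0 \<and>
        (\<forall>z\<in>basic_open 1. G z \<noteq> 0 \<longrightarrow> h (vec3 z) = F z / G z)"
      using FG by (intro exI[of _ "\<lambda>x. mpoly_eval F (vec_nth (vec3 x))"]
          exI[of _ "\<lambda>x. mpoly_eval G (vec_nth (vec3 x))"] conjI ballI impI polyfun_mpoly_eval polyfun_vec3) auto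
  qed auto
  then obtain E where E: "polyfun E" "\<And>x. (\<And>i. i \<ge> 3 \<Longrightarrow> x i = 0) \<Longrightarrow> h (vec3 x) = E x"
    by (auto simp: basic_open_def)
  \<comment> \<open>\<open>E\<close> is controlled only where the coordinates from 3 on vanish;
    cutting them off is itself a polynomial substitution.\<close>
  have "h (vec3 x) = E (\<lambda>i. if i < 3 then x i else 0)" for x
    using E(2)[of "\<lambda>i. if i < 3 then x i else 0"] by (simp add: vec3_def)
  moreover have "polyfun (\<lambda>x. E (\<lambda>i. if i < 3 then x i else 0))"
  proof (rule polyfun_subst[OF E(1)])
    show "polyfun (\<lambda>x. if i < 3 then x i else (0 :: 'k alg_closure))" for i :: nat
      by (cases "i < 3") (auto intro: polyfun_intros)
  qed
  ultimately show ?thesis by simp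
qed

lemma unit_polyfun_constant:
  fixes f g :: "(nat \<Rightarrow> 'c::field_char_0) \<Rightarrow> 'c"
  assumes "polyfun f" "polyfun g" "\<And>x. f x * g x = 1"
  shows "f (x(i := t)) = f x"
proof -
  obtain p where p: "\<And>t. f (x(i := t)) = poly p t"
    using polyfun_axis[OF assms(1)] by meson
  obtain q where q: "\<And>t. g (x(i := t)) = poly q t"
    using polyfun_axis[OF assms(2)] by meson
  have "p * q = 1"
    by (rule poly_eqI_cofinite[of 1]) (use assms(3) p q in \<open>auto simp flip: p q\<close>)
  then have "degree p = 0"
    by (metis degree_mult_eq_0 degree_1 mult_zero_left mult_zero_right zero_neq_one)
  then obtain c where "p = [:c:]" by (meson degree_eq_zeroE)
  then show ?thesis using p[of t] p[of "x i"] by simp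
qed

locale affine_iso =
  fixes a :: "'k::field_char_0^4"
    and f :: "('k alg_closure, 2) proj \<times> ('k alg_closure, 3) proj \<Rightarrow> 'k alg_closure^3" and g
  assumes f_mor: "variety_morphism (open_subspace proj_prod (good_points a)) affine_space f"
    and g_mor: "variety_morphism affine_space (open_subspace proj_prod (good_points a)) g"
    and gf: "\<And>z. z \<in> good_points a \<Longrightarrow> g (f z) = z"
    and fg: "\<And>p. f (g p) = p"
begin

lemma g_in: "g p \<in> good_points a"
  using g_mor by (auto simp: variety_morphism_def open_subspace_simps points_affine_space)

lemma pullback_polyfun:
  assumes "\<And>z. z \<in> good_points a \<Longrightarrow> h \<in> fraction_stalk biproj_functions z"
  shows "polyfun (\<lambda>x. h (g (vec3 x)))"
proof -
  have "h \<circ> g \<in> stalk affine_space p" for p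
    using assms[OF g_in[of p]] g_mor
    by (auto simp: variety_morphism_def open_subspace_simps points_affine_space stalk_proj_prod)
  from regular_function_polyfun[OF this] show ?thesis by simp
qed

lemma coordinate_regular:
  assumes "z \<in> good_points a"
  shows "(\<lambda>z. f z $ i) \<in> fraction_stalk biproj_functions z"
proof -
  have "(\<lambda>p. p $ i) \<circ> f \<in> stalk proj_prod z"
    using f_mor assms affine_stalk_coord[of i "f z"]
    unfolding variety_morphism_def open_subspace_simps stalk_affine_space by blast
  then show ?thesis by (simp add: stalk_proj_prod comp_def)
qed

lemma unit_constant:
  assumes h: "\<And>z. z \<in> good_points a \<Longrightarrow> h \<in> fraction_stalk biproj_functions z"
    and h': "\<And>z. z \<in> good_points a \<Longrightarrow> h' \<in> fraction_stalk biproj_functions z"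
    and unit: "\<And>z. z \<in> good_points a \<Longrightarrow> h z * h' z = 1"
    and z: "z \<in> good_points a" and z': "z' \<in> good_points a"
  shows "h z = h z'"
proof -
  note const = unit_polyfun_constant[OF pullback_polyfun[OF h] pullback_polyfun[OF h'] unit[OF g_in]]
  have *: "h (g (vec3 x)) = h (g (vec3 (\<lambda>_. 0)))" for x
  proof -
    have "vec3 (x(0 := 0, 1 := 0, 2 := 0)) = vec3 (\<lambda>_. 0)" by (simp add: vec3_def)
    then show ?thesis
      using const[of x 0 0] const[of "x(0 := 0)" 1 0] const[of "x(0 := 0, 1 := 0)" 2 0] by simp
  qed
  have "h y = h (g (vec3 (\<lambda>_. 0)))" if y: "y \<in> good_points a" for y
  proof -
    obtain x where "vec3 x = f y" using vec3_surj[of "f y"] by blast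
    then show ?thesis using *[of x] gf[OF y] by simp
  qed
  from this[OF z] this[OF z'] show ?thesis by simp
qed

end

lemma affine_isoI:
  assumes "isomorphic_varieties (open_subspace proj_prod (good_points a))
    (affine_space :: ('k::field_char_0 alg_closure^3, 'k alg_closure) fun_space)"
  shows "\<exists>f g. affine_iso a f g"
  using assms unfolding isomorphic_varieties_def affine_iso_def open_subspace_simps points_affine_space
  by blast


subsection \<open>Osculating hyperplanes\<close>

text \<open>The equation of H is a constant times X A. So X^2 A has no zeros on U, and it has the
  same bidegree (2, 1) as Q; their quotient is a unit.\<close>

theorem osculating_not_affine_space:
  fixes a :: "'k::field_char_0^4" and l :: "'k^2"
  assumes iso: "affine_iso a f g" and c: "c \<noteq> 0" and l: "l \<noteq> 0"
    and a: "a $ 1 = c * l $ 1 ^ 3" "a $ 2 = c * l $ 1 ^ 2 * l $ 2" "a $ 3 = c * l $ 1 * l $ 2 ^ 2"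
      "a $ 4 = c * l $ 2 ^ 3"
  shows False
proof -
  interpret affine_iso a f g by fact
  define m :: "'k^2" where "m = (if l $ 1 = 0 then vector [1, 0] else vector [0, 1])"
  have "frame_det l m \<noteq> 0"
    using l by (auto simp: m_def frame_det_def vec_eq_2)
  then have det: "frame_det (vec_ac l) (vec_ac m) \<noteq> 0"
    by (simp add: frame_det_def flip: to_ac_mult to_ac_diff)
  define d where "d = frame_det (vec_ac l) (vec_ac m)"
  define Lf Qf where "Lf z = hyper_form (vec_ac a) (rep_proj (fst z)) (rep_proj (snd z))"
    and "Qf z = resultant_form (rep_proj (fst z)) (rep_proj (snd z))"
    for z :: "('k alg_closure, 2) proj \<times> ('k alg_closure, 3) proj"
  define Xf Af where "Xf z = lin (vec_ac l) (rep_proj (fst z))" and "Af z = quad (vec_ac l) (rep_proj (snd z))"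
    for z :: "('k alg_closure, 2) proj \<times> ('k alg_closure, 3) proj"
  have Lf_eq: "Lf z = to_ac c * Xf z * Af z" for z
    by (simp add: Lf_def Xf_def Af_def hyper_form_altdef lin_def quad_def a algebra_simps
        power2_eq_square power3_eq_cube)
  have good: "z \<in> good_points a \<longleftrightarrow> Qf z \<noteq> 0 \<and> Xf z \<noteq> 0 \<and> Af z \<noteq> 0" for z
    using Lf_eq[of z] c by (auto simp: good_points_def Qf_def Lf_def)
  have XA: "(\<lambda>z. (Xf z * Xf z) * Af z) \<in> biproj_functions (2, 1)"
    using biproj.mult[OF biproj.mult[OF biproj_lin[of l] biproj_lin[of l]] biproj_quad[of l]]
    by (simp add: Xf_def Af_def numeral_2_eq_2)
  have Qm: "Qf \<in> biproj_functions (2, 1)"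
    unfolding Qf_def[abs_def] by (rule biproj_resultant_form)
  have const: "Qf z / ((Xf z * Xf z) * Af z) = Qf z' / ((Xf z' * Xf z') * Af z')"
    if "z \<in> good_points a" "z' \<in> good_points a" for z z'
  proof (rule unit_constant[OF _ _ _ that])
    fix z assume z: "z \<in> good_points a"
    then show "(\<lambda>z. Qf z / ((Xf z * Xf z) * Af z)) \<in> fraction_stalk biproj_functions z"
      "(\<lambda>z. ((Xf z * Xf z) * Af z) / Qf z) \<in> fraction_stalk biproj_functions z"
      by (auto simp: good intro!: biproj.stalk_ratio[OF Qm XA] biproj.stalk_ratio[OF XA Qm])
    show "Qf z / ((Xf z * Xf z) * Af z) * (((Xf z * Xf z) * Af z) / Qf z) = 1"
      using z by (simp add: good)
  qed
  \<comment> \<open>In the frame this is X = 1, Y = 0, A = 1, N = 0, B = b, where the unit has the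
    value b up to the factor d^2; b = 1 and b = 2 show that it is not constant.\<close>
  define pt where "pt b = frame_point (vec_ac l) (vec_ac m) (vector [1, 0]) (vector [1, 0, b])" for b
  have pt: "pt b \<in> good_points a \<and> d^2 * (Qf (pt b) / ((Xf (pt b) * Xf (pt b)) * Af (pt b))) = b"
    if b: "b \<noteq> 0" for b
  proof -
    have nz: "(vector [1, 0] :: 'k alg_closure^2) \<noteq> 0" "(vector [1, 0, b] :: 'k alg_closure^3) \<noteq> 0"
      by (auto simp: vec_eq_2 vec_eq_3)
    obtain c c' where c: "c \<noteq> 0" "c' \<noteq> 0"
      "frame1 (vec_ac l) (vec_ac m) (rep_proj (fst (pt b))) = (c * d) *s vector [1, 0]"
      "frame2 (vec_ac l) (vec_ac m) (rep_proj (snd (pt b))) = (c' * d^2) *s vector [1, 0, b]"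
      using frame_point_coords[OF det nz] unfolding pt_def d_def by metis
    have "Xf (pt b) = c * d" "Af (pt b) = c' * d^2"
      using c(3,4) by (auto simp: frame1_def frame2_def vec_eq_2 vec_eq_3 Xf_def Af_def)
    moreover have "d^2 * Qf (pt b) = (c * d)^2 * (c' * d^2) * b"
      using resultant_form_frame[of "vec_ac l" "vec_ac m" "rep_proj (fst (pt b))" "rep_proj (snd (pt b))", symmetric]
      unfolding c(3,4) resultant_form_scale by (simp add: d_def Qf_def resultant_form_def)
    ultimately show ?thesis
      using c(1,2) b det unfolding good d_def[symmetric]
      by (auto simp: power2_eq_square)
  qed
  have "pt 1 \<in> good_points a" "pt 2 \<in> good_points a"
    using pt[of 1] pt[of 2] by auto
  from const[OF this] have "(1 :: 'k alg_closure) = 2"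
    using pt[of 1] pt[of 2] by (metis zero_neq_numeral zero_neq_one)
  then show False by simp
qed


subsection \<open>Generic hyperplanes\<close>

text \<open>The cone over U in the space of all (X, Y, A, N, B), where both equations are merely
  nonzero; the threefold lies in it as the locus where they are 1.\<close>

definition generic_cone :: "(nat \<Rightarrow> 'c::comm_ring_1) set" where
  "generic_cone = {v. v 0 * v 2 + v 1 * v 4 \<noteq> 0 \<and> v 1 ^ 2 * v 2 + v 0 ^ 2 * v 4 - v 0 * v 1 * v 3 \<noteq> 0}"

definition rational_on_cone :: "((nat \<Rightarrow> 'c::field) \<Rightarrow> 'c) \<Rightarrow> bool" where
  "rational_on_cone h \<longleftrightarrow> (\<forall>v\<in>generic_cone. \<exists>F G. polyfun F \<and> polyfun G \<and> G v \<noteq> 0 \<and>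
     (\<forall>v'\<in>generic_cone. G v' \<noteq> 0 \<longrightarrow> h v' = F v' / G v'))"

lemma rational_on_coneE:
  assumes "rational_on_cone h" "v \<in> generic_cone"
  obtains F G where "polyfun F" "polyfun G" "G v \<noteq> 0"
    "\<And>v'. v' \<in> generic_cone \<Longrightarrow> G v' \<noteq> 0 \<Longrightarrow> h v' = F v' / G v'"
proof -
  from assms obtain F G where "polyfun F \<and> polyfun G \<and> G v \<noteq> 0 \<and>
      (\<forall>v'\<in>generic_cone. G v' \<noteq> 0 \<longrightarrow> h v' = F v' / G v')"
    unfolding rational_on_cone_def by (elim ballE exE) auto
  then show thesis by (intro that[of F G]) simp_all
qed

text \<open>Invariance under scaling the quadratic form alone; this permits replacing (A, N, B) by
  its multiple with X^5, which has no denominators in the chart.\<close>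

definition homogeneous_on_cone :: "((nat \<Rightarrow> 'c::field) \<Rightarrow> 'c) \<Rightarrow> bool" where
  "homogeneous_on_cone h \<longleftrightarrow> (\<forall>v\<in>generic_cone. \<forall>v' c. c \<noteq> 0 \<longrightarrow> v' 0 = v 0 \<longrightarrow> v' 1 = v 1 \<longrightarrow>
     v' 2 = c * v 2 \<longrightarrow> v' 3 = c * v 3 \<longrightarrow> v' 4 = c * v 4 \<longrightarrow> h v' = h v)"

text \<open>
  On the chart \<open>X \<noteq> 0\<close> of the threefold, \<open>(X, Y, c)\<close> with \<open>c = X\<^sup>2 N - Y + Y\<^sup>2 B\<close> are coordinates;
  the following point has the coordinates \<open>(X, Y, X\<^sup>5 A, X\<^sup>5 N, X\<^sup>5 B)\<close>.
\<close>

definition generic_chart_cone :: "(nat \<Rightarrow> 'c::comm_ring_1) \<Rightarrow> nat \<Rightarrow> 'c" where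
  "generic_chart_cone x i = (if i = 0 then x 0 else if i = 1 then x 1
     else if i = 2 then x 0 ^ 4 - x 0 ^ 2 * x 1 - x 0 * x 1 ^ 2 * x 2
     else if i = 3 then x 0 ^ 3 * x 1 - x 0 * x 1 ^ 2 + (x 0 ^ 3 - x 1 ^ 3) * x 2
     else if i = 4 then x 0 ^ 3 + x 0 ^ 2 * x 1 * x 2 else 0)"

text \<open>Pulled back by \<open>generic_chart_cone\<close>, \<open>h\<close> is regular in (X, Y,
  c) where X \<noteq> 0, hence a polynomial divided by a power of X; homogeneity identifies the
  pullback with \<open>h\<close> on the threefold.\<close>

lemma generic_chart_polynomial:
  fixes h :: "(nat \<Rightarrow> 'c::{alg_closed_field, field_char_0}) \<Rightarrow> 'c"
  assumes h: "rational_on_cone h" "homogeneous_on_cone h"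
  shows "\<exists>m E. polyfun E \<and> (\<forall>v\<in>generic_threefold. v 0 ^ m * h v = E v)"
proof -
  have poly: "polyfun (\<lambda>x :: nat \<Rightarrow> 'c. generic_chart_cone x i)" for i
    unfolding generic_chart_cone_def
    by (cases "i = 0"; cases "i = 1"; cases "i = 2"; cases "i = 3"; cases "i = 4")
      (auto intro!: polyfun_intros)
  have cone: "generic_chart_cone x \<in> generic_cone" if "x 0 \<noteq> 0" for x :: "nat \<Rightarrow> 'c"
  proof -
    let ?v = "generic_chart_cone x"
    have eq: "?v 0 * ?v 2 + ?v 1 * ?v 4 = x 0 ^ 5"
      "?v 1 ^ 2 * ?v 2 + ?v 0 ^ 2 * ?v 4 - ?v 0 * ?v 1 * ?v 3 = x 0 ^ 5"
      by (simp_all add: generic_chart_cone_def) (Groebner_Basis.algebra)+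
    show ?thesis unfolding generic_cone_def mem_Collect_eq eq using that by simp
  qed
  have "\<exists>m E. polyfun E \<and> (\<forall>x\<in>basic_open [:0, 1:]. (\<forall>i\<ge>3. x i = 0) \<longrightarrow>
      poly [:0, 1:] (x 0) ^ m * h (generic_chart_cone x) = E x)"
  proof (rule locally_rational_polynomial)
    fix x :: "nat \<Rightarrow> 'c" assume "x \<in> basic_open [:0, 1:]"
    then have "generic_chart_cone x \<in> generic_cone" by (intro cone) (simp add: basic_open_def)
    from rational_on_coneE[OF h(1) this] obtain F G where FG: "polyfun F" "polyfun G" "G (generic_chart_cone x) \<noteq> 0"
      "\<And>v'. v' \<in> generic_cone \<Longrightarrow> G v' \<noteq> 0 \<Longrightarrow> h v' = F v' / G v'"
      by metis
    show "\<exists>F G. polyfun F \<and> polyfun G \<and> G x \<noteq> 0 \<and>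
        (\<forall>z\<in>basic_open [:0, 1:]. G z \<noteq> 0 \<longrightarrow> h (generic_chart_cone z) = F z / G z)"
    proof (rule exI[of _ "\<lambda>x. F (generic_chart_cone x)"], rule exI[of _ "\<lambda>x. G (generic_chart_cone x)"],
        intro conjI ballI impI)
      show "polyfun (\<lambda>x. F (generic_chart_cone x))"
        using polyfun_subst[of F "\<lambda>i x. generic_chart_cone x i", OF FG(1) poly] by simp
      show "polyfun (\<lambda>x. G (generic_chart_cone x))"
        using polyfun_subst[of G "\<lambda>i x. generic_chart_cone x i", OF FG(2) poly] by simp
      show "h (generic_chart_cone z) = F (generic_chart_cone z) / G (generic_chart_cone z)"
        if "z \<in> basic_open [:0, 1:]" "G (generic_chart_cone z) \<noteq> 0" for z
        using that by (intro FG(4) cone) (auto simp: basic_open_def)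
    qed fact
  qed auto
  then obtain m E where E: "polyfun E" "\<And>x. x 0 \<noteq> 0 \<Longrightarrow> (\<And>i. i \<ge> 3 \<Longrightarrow> x i = 0) \<Longrightarrow>
      x 0 ^ m * h (generic_chart_cone x) = E x"
    by (auto simp: basic_open_def)
  define s where "s i v = (if i = 0 then v 0 else if i = 1 then v 1
    else if i = 2 then v 0 ^ 2 * v 3 - v 1 + v 1 ^ 2 * v 4 else 0)" for i :: nat and v :: "nat \<Rightarrow> 'c"
  have ps: "polyfun (s i)" for i
    unfolding s_def[abs_def] by (cases "i = 0"; cases "i = 1"; cases "i = 2") (auto intro!: polyfun_intros)
  \<comment> \<open>The extra factor \<open>v 0\<close> makes the equation hold where
    \<open>v 0 = 0\<close>, a place about which the chart says nothing.\<close>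
  define E' where "E' v = v 0 * E (\<lambda>i. s i v)" for v
  have "polyfun E'"
    unfolding E'_def[abs_def] by (rule polyfun_mult[OF polyfun_var polyfun_subst[OF E(1), of s, OF ps]])
  moreover have "v 0 ^ Suc m * h v = E' v" if v: "v \<in> generic_threefold" for v
  proof (cases "v 0 = 0")
    case True
    then show ?thesis by (simp add: E'_def)
  next
    case False
    have 1: "v 0 * v 2 + v 1 * v 4 = 1" "v 1 ^ 2 * v 2 + v 0 ^ 2 * v 4 - v 0 * v 1 * v 3 = 1"
      using v by (auto simp: generic_threefold_def)
    have vc: "v \<in> generic_cone" unfolding generic_cone_def mem_Collect_eq 1 by simp
    define c where "c = v 0 ^ 2 * v 3 - v 1 + v 1 ^ 2 * v 4"
    have co: "v 0 ^ 4 - v 0 ^ 2 * v 1 - v 0 * v 1 ^ 2 * c = v 0 ^ 5 * v 2"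
      "v 0 ^ 3 * v 1 - v 0 * v 1 ^ 2 + (v 0 ^ 3 - v 1 ^ 3) * c = v 0 ^ 5 * v 3"
      "v 0 ^ 3 + v 0 ^ 2 * v 1 * c = v 0 ^ 5 * v 4"
      using 1 c_def by (Groebner_Basis.algebra)+
    have "h (generic_chart_cone (\<lambda>i. s i v)) = h v"
    proof (rule h(2)[unfolded homogeneous_on_cone_def, rule_format, OF vc])
      show "v 0 ^ 5 \<noteq> 0" using False by simp
    qed (use co in \<open>simp_all add: generic_chart_cone_def s_def c_def\<close>)
    then show ?thesis
      using E(2)[of "\<lambda>i. s i v"] False by (simp add: E'_def s_def mult.assoc)
  qed
  ultimately show ?thesis by blast
qed

definition swap_vars :: "nat \<Rightarrow> nat" where
  "swap_vars = id(0 := 1, 1 := 0, 2 := 4, 4 := 2)"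

lemma swap_vars_simps [simp]:
  "swap_vars 0 = 1" "swap_vars (Suc 0) = 0" "swap_vars 2 = 4" "swap_vars 3 = 3" "swap_vars 4 = 2"
  "swap_vars (swap_vars i) = i" "i \<ge> 5 \<Longrightarrow> swap_vars i = i"
  by (auto simp: swap_vars_def)

lemma generic_cone_swap: "(\<lambda>i. v (swap_vars i)) \<in> generic_cone \<longleftrightarrow> v \<in> generic_cone"
  by (simp add: generic_cone_def algebra_simps)

lemma generic_threefold_swap: "v \<in> generic_threefold \<Longrightarrow> (\<lambda>i. v (swap_vars i)) \<in> generic_threefold"
  by (simp add: generic_threefold_def algebra_simps)

lemma polyfun_swap: "polyfun F \<Longrightarrow> polyfun (\<lambda>v. F (\<lambda>i. v (swap_vars i)))"
  by (rule polyfun_subst) (auto intro: polyfun_intros)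

text \<open>On \<open>S\<close> the product of \<open>p\<close> and \<open>a\<close> is 1 modulo
  \<open>q\<close>, so the powers of \<open>p\<close> remain comaximal with
  \<open>q\<close>.\<close>

lemma unimodular_power:
  assumes poly: "polyfun p" "polyfun q" "polyfun a" "polyfun b"
    and eq: "\<And>v. v \<in> S \<Longrightarrow> p v * a v + q v * b v = 1"
  shows "\<exists>a b. polyfun a \<and> polyfun b \<and> (\<forall>v\<in>S. p v ^ n * a v + q v * b v = 1)"
proof (induction n)
  case 0
  show ?case
    by (intro exI[of _ "\<lambda>_. 1"] exI[of _ "\<lambda>_. 0"]) (auto intro: polyfun_intros)
next
  case (Suc n)
  then obtain a' b' where a'b': "polyfun a'" "polyfun b'" "\<And>v. v \<in> S \<Longrightarrow> p v ^ n * a' v + q v * b' v = 1"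
    by blast
  have "p v ^ Suc n * (a' v * a v) + q v * (p v ^ n * a' v * b v + b' v) = 1" if v: "v \<in> S" for v
  proof -
    have "p v ^ Suc n * (a' v * a v) + q v * (p v ^ n * a' v * b v + b' v) =
        p v ^ n * a' v * (p v * a v + q v * b v) + q v * b' v"
      by (simp add: algebra_simps)
    then show ?thesis using eq[OF v] a'b'(3)[OF v] by simp
  qed
  moreover have "polyfun (\<lambda>v. a' v * a v)" "polyfun (\<lambda>v. p v ^ n * a' v * b v + b' v)"
    by (intro polyfun_intros poly a'b')+
  ultimately show ?case by blast
qed

lemma generic_threefold_unimodular_powers:
  "\<exists>p q. polyfun p \<and> polyfun q \<and> (\<forall>v\<in>generic_threefold. v 0 ^ m * p v + v 1 ^ n * q v = (1 :: 'c::comm_ring_1))"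
proof -
  have "\<exists>a b. polyfun a \<and> polyfun b \<and>
      (\<forall>v\<in>generic_threefold. (v 0 :: 'c) ^ m * a v + v 1 * b v = 1)"
    by (rule unimodular_power[of _ _ "\<lambda>v. v 2" "\<lambda>v. v 4"])
      (auto simp: generic_threefold_def intro: polyfun_intros)
  then obtain a b where ab: "polyfun a" "polyfun b"
    "\<And>v. v \<in> generic_threefold \<Longrightarrow> (v 0 :: 'c) ^ m * a v + v 1 * b v = 1"
    by blast
  have "\<exists>b' a'. polyfun b' \<and> polyfun a' \<and>
      (\<forall>v\<in>generic_threefold. (v 1 :: 'c) ^ n * b' v + v 0 ^ m * a' v = 1)"
    by (rule unimodular_power[of _ _ b a]) (use ab in \<open>auto simp: add.commute intro: polyfun_intros\<close>)
  then obtain b' a' where "polyfun b'" "polyfun a'"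
    "\<forall>v\<in>generic_threefold. (v 1 :: 'c) ^ n * b' v + v 0 ^ m * a' v = 1"
    by blast
  then show ?thesis
    by (intro exI[of _ a'] exI[of _ b']) (simp add: add.commute)
qed

text \<open>The charts X \<noteq> 0 and Y \<noteq> 0 show that some power of X times
  \<open>h\<close>, and some power of Y times \<open>h\<close>, are polynomial on the threefold.
  These powers are comaximal because X A + Y B = 1, and a combination gives \<open>h\<close>
  itself.\<close>

lemma generic_polynomial:
  fixes h :: "(nat \<Rightarrow> 'c::{alg_closed_field, field_char_0}) \<Rightarrow> 'c"
  assumes h: "rational_on_cone h" "homogeneous_on_cone h"
  shows "\<exists>E. polyfun E \<and> (\<forall>v\<in>generic_threefold. h v = E v)"
proof -
  obtain m E where E: "polyfun E" "\<And>v. v \<in> generic_threefold \<Longrightarrow> v 0 ^ m * h v = E v"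
    using generic_chart_polynomial[OF h] by blast
  have "\<exists>m E. polyfun E \<and> (\<forall>v\<in>generic_threefold. v 0 ^ m * h (\<lambda>i. v (swap_vars i)) = E v)"
  proof (rule generic_chart_polynomial)
    show "rational_on_cone (\<lambda>v. h (\<lambda>i. v (swap_vars i)))"
      unfolding rational_on_cone_def
    proof
      fix v :: "nat \<Rightarrow> 'c" assume "v \<in> generic_cone"
      then have "(\<lambda>i. v (swap_vars i)) \<in> generic_cone" by (simp add: generic_cone_swap)
      from rational_on_coneE[OF h(1) this] obtain F G where FG: "polyfun F" "polyfun G" "G (\<lambda>i. v (swap_vars i)) \<noteq> 0"
        "\<And>v'. v' \<in> generic_cone \<Longrightarrow> G v' \<noteq> 0 \<Longrightarrow> h v' = F v' / G v'"
        by metis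
      show "\<exists>F G. polyfun F \<and> polyfun G \<and> G v \<noteq> 0 \<and>
          (\<forall>v'\<in>generic_cone. G v' \<noteq> 0 \<longrightarrow> h (\<lambda>i. v' (swap_vars i)) = F v' / G v')"
      proof (rule exI[of _ "\<lambda>v. F (\<lambda>i. v (swap_vars i))"], rule exI[of _ "\<lambda>v. G (\<lambda>i. v (swap_vars i))"],
          intro conjI ballI impI)
        show "polyfun (\<lambda>v. F (\<lambda>i. v (swap_vars i)))" "polyfun (\<lambda>v. G (\<lambda>i. v (swap_vars i)))"
          by (intro polyfun_swap FG)+
        show "h (\<lambda>i. v' (swap_vars i)) = F (\<lambda>i. v' (swap_vars i)) / G (\<lambda>i. v' (swap_vars i))"
          if "v' \<in> generic_cone" "G (\<lambda>i. v' (swap_vars i)) \<noteq> 0" for v'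
          using that by (intro FG(4)) (simp_all add: generic_cone_swap)
      qed (fact FG(3))
    qed
    show "homogeneous_on_cone (\<lambda>v. h (\<lambda>i. v (swap_vars i)))"
      unfolding homogeneous_on_cone_def
    proof (intro ballI allI impI)
      fix v v' :: "nat \<Rightarrow> 'c" and c
      assume "v \<in> generic_cone" "c \<noteq> 0" "v' 0 = v 0" "v' 1 = v 1" "v' 2 = c * v 2" "v' 3 = c * v 3"
        "v' 4 = c * v 4"
      then show "h (\<lambda>i. v' (swap_vars i)) = h (\<lambda>i. v (swap_vars i))"
        using h(2)[unfolded homogeneous_on_cone_def, rule_format, of "\<lambda>i. v (swap_vars i)" c
            "\<lambda>i. v' (swap_vars i)"]
        by (simp add: generic_cone_swap)
    qed
  qed
  then obtain m' E' where E': "polyfun E'"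
    "\<And>v. v \<in> generic_threefold \<Longrightarrow> v 0 ^ m' * h (\<lambda>i. v (swap_vars i)) = E' v"
    by blast
  define E'' where "E'' v = E' (\<lambda>i. v (swap_vars i))" for v
  have E'': "polyfun E''"
    unfolding E''_def[abs_def] by (rule polyfun_swap) (rule E'(1))
  have E''_eq: "v 1 ^ m' * h v = E'' v" if "v \<in> generic_threefold" for v
    using E'(2)[OF generic_threefold_swap[OF that]] by (simp add: E''_def)
  obtain p q where pq: "polyfun p" "polyfun q"
    "\<And>v. v \<in> generic_threefold \<Longrightarrow> v 0 ^ m * p v + v 1 ^ m' * q v = (1 :: 'c)"
    using generic_threefold_unimodular_powers by blast
  have "h v = p v * E v + q v * E'' v" if v: "v \<in> generic_threefold" for v
  proof -
    have "h v = (v 0 ^ m * p v + v 1 ^ m' * q v) * h v" using pq(3)[OF v] by simp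
    also have "\<dots> = p v * (v 0 ^ m * h v) + q v * (v 1 ^ m' * h v)" by (simp add: algebra_simps)
    finally show ?thesis using E(2)[OF v] E''_eq[OF v] by simp
  qed
  moreover have "polyfun (\<lambda>v. p v * E v + q v * E'' v)"
    by (intro polyfun_intros pq E(1) E'')
  ultimately show ?thesis by blast
qed

text \<open>The frame exists over the closure only, whereas germs have coefficients in
  \<open>k\<close>. So the coordinates over \<open>k\<close> are pulled back to affine space first,
  and the frame is applied to the resulting polynomial functions.\<close>

theorem generic_not_affine_space:
  fixes a :: "'k::field_char_0^4" and l m :: "'k alg_closure^2"
  assumes iso: "affine_iso a f g" and det: "frame_det l m \<noteq> 0"
    and a: "vec_ac a $ 1 = l $ 1 ^ 3 + m $ 1 ^ 3" "vec_ac a $ 2 = l $ 1 ^ 2 * l $ 2 + m $ 1 ^ 2 * m $ 2"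
      "vec_ac a $ 3 = l $ 1 * l $ 2 ^ 2 + m $ 1 * m $ 2 ^ 2" "vec_ac a $ 4 = l $ 2 ^ 3 + m $ 2 ^ 3"
  shows False
proof -
  interpret affine_iso a f g by fact
  define d where "d = frame_det l m"
  have d0: "d \<noteq> 0" using det by (simp add: d_def)
  define Lf Qf where "Lf z = hyper_form (vec_ac a) (rep_proj (fst z)) (rep_proj (snd z))"
    and "Qf z = resultant_form (rep_proj (fst z)) (rep_proj (snd z))"
    for z :: "('k alg_closure, 2) proj \<times> ('k alg_closure, 3) proj"
  define Xf Yf where "Xf z = lin l (rep_proj (fst z))" and "Yf z = lin m (rep_proj (fst z))"
    for z :: "('k alg_closure, 2) proj \<times> ('k alg_closure, 3) proj"
  define Af Nf Bf where "Af z = quad l (rep_proj (snd z))" and "Nf z = polar l m (rep_proj (snd z))"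
    and "Bf z = quad m (rep_proj (snd z))" for z :: "('k alg_closure, 2) proj \<times> ('k alg_closure, 3) proj"
  note frame_coord_defs = Xf_def Yf_def Af_def Nf_def Bf_def
  have Lf_eq: "Lf z = Xf z * Af z + Yf z * Bf z" for z
    unfolding Lf_def hyper_form_altdef a frame_coord_defs lin_def quad_def
    by (simp add: algebra_simps power2_eq_square power3_eq_cube)
  have Qf_eq: "d^2 * Qf z = Af z * Yf z^2 - Nf z * Xf z * Yf z + Bf z * Xf z^2" for z
    using resultant_form_frame[of l m "rep_proj (fst z)" "rep_proj (snd z)"]
    by (simp add: Qf_def d_def frame_coord_defs resultant_form_def frame1_def frame2_def)
  have good: "z \<in> good_points a \<longleftrightarrow> Qf z \<noteq> 0 \<and> Lf z \<noteq> 0" for z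
    by (simp add: good_points_def Qf_def Lf_def)
  define px where "px i x = (let z = g (vec3 x) in rep_proj (fst z) $ i * Lf z / Qf z)"
    for i :: 2 and x :: "nat \<Rightarrow> 'k alg_closure"
  define pw where "pw j x = (let z = g (vec3 x) in rep_proj (snd z) $ j * Qf z / (Lf z)^2)"
    for j :: 3 and x :: "nat \<Rightarrow> 'k alg_closure"
  have px: "polyfun (px i)" for i
    unfolding px_def[abs_def] Let_def Lf_def Qf_def
    by (rule pullback_polyfun, rule normalised_stalk(1)) (assumption, rule biproj_coords(1))
  have pw: "polyfun (pw j)" for j
    unfolding pw_def[abs_def] Let_def Lf_def Qf_def
    by (rule pullback_polyfun, rule normalised_stalk(2)) (assumption, rule biproj_coords(2))
  \<comment> \<open>The factors 1/d^2 and d^2 in the next four definitions compensate the factor d^2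
    that the resultant acquires in the frame, so that both equations take the value 1.\<close>
  define fX where "fX x = inverse (d^2) * (l $ 1 * px 1 x + l $ 2 * px 2 x)" for x
  define fY where "fY x = inverse (d^2) * (m $ 1 * px 1 x + m $ 2 * px 2 x)" for x
  define fA where "fA x = d^2 * (l $ 1 ^ 2 * pw 1 x + l $ 1 * l $ 2 * pw 2 x + l $ 2 ^ 2 * pw 3 x)" for x
  define fB where "fB x = d^2 * (m $ 1 ^ 2 * pw 1 x + m $ 1 * m $ 2 * pw 2 x + m $ 2 ^ 2 * pw 3 x)" for x
  have polys: "polyfun fX" "polyfun fY" "polyfun fA" "polyfun fB"
    unfolding fX_def[abs_def] fY_def[abs_def] fA_def[abs_def] fB_def[abs_def]
    by (intro polyfun_add polyfun_mult polyfun_const px pw)+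
  have val: "fX x = inverse (d^2) * (Xf (g (vec3 x)) * Lf (g (vec3 x)) / Qf (g (vec3 x)))"
    "fY x = inverse (d^2) * (Yf (g (vec3 x)) * Lf (g (vec3 x)) / Qf (g (vec3 x)))"
    "fA x = d^2 * (Af (g (vec3 x)) * Qf (g (vec3 x)) / (Lf (g (vec3 x)))^2)"
    "fB x = d^2 * (Bf (g (vec3 x)) * Qf (g (vec3 x)) / (Lf (g (vec3 x)))^2)" for x
    by (simp_all add: fX_def fY_def fA_def fB_def px_def pw_def Let_def frame_coord_defs lin_def quad_def
        add_divide_distrib algebra_simps)
  have unimodular: "fX x * fA x + fY x * fB x = 1" for x
  proof -
    let ?z = "g (vec3 x)"
    have nz: "Qf ?z \<noteq> 0" "Lf ?z \<noteq> 0" using g_in[of "vec3 x"] good by auto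
    then have "fX x * fA x + fY x * fB x = (Xf ?z * Af ?z + Yf ?z * Bf ?z) / Lf ?z"
      unfolding val using d0 by (simp add: field_simps power2_eq_square)
    then show ?thesis using nz by (simp flip: Lf_eq)
  qed
  define u where "u v = (vector [v 0, v 1] :: 'k alg_closure^2)" for v :: "nat \<Rightarrow> 'k alg_closure"
  define w where "w v = (vector [v 2, v 3, v 4] :: 'k alg_closure^3)" for v :: "nat \<Rightarrow> 'k alg_closure"
  define \<tau> where "\<tau> v = frame_point l m (u v) (w v)" for v
  have nz: "u v \<noteq> 0" "w v \<noteq> 0" if "v \<in> generic_cone" for v
    using that by (auto simp: generic_cone_def u_def w_def vec_eq_2 vec_eq_3)
  have coords: "\<exists>s t. s \<noteq> 0 \<and> t \<noteq> 0 \<and> Xf (\<tau> v) = s * v 0 \<and> Yf (\<tau> v) = s * v 1 \<and>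
      Lf (\<tau> v) = s * t * (v 0 * v 2 + v 1 * v 4) \<and>
      d^2 * Qf (\<tau> v) = s^2 * t * (v 1 ^ 2 * v 2 + v 0 ^ 2 * v 4 - v 0 * v 1 * v 3)"
    if v: "v \<in> generic_cone" for v
  proof -
    obtain c c' where c: "c \<noteq> 0" "c' \<noteq> 0"
      "frame1 l m (rep_proj (fst (\<tau> v))) = (c * d) *s u v"
      "frame2 l m (rep_proj (snd (\<tau> v))) = (c' * d^2) *s w v"
      using frame_point_coords[OF det nz[OF v]] unfolding \<tau>_def d_def by metis
    have co: "Xf (\<tau> v) = (c * d) * v 0" "Yf (\<tau> v) = (c * d) * v 1" "Af (\<tau> v) = (c' * d^2) * v 2"
      "Nf (\<tau> v) = (c' * d^2) * v 3" "Bf (\<tau> v) = (c' * d^2) * v 4"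
      using c(3,4) by (auto simp: frame1_def frame2_def u_def w_def vec_eq_2 vec_eq_3 frame_coord_defs)
    show ?thesis
      unfolding Lf_eq Qf_eq co using c(1,2) d0
      by (intro exI[of _ "c * d"] exI[of _ "c' * d^2"]) (simp add: algebra_simps power2_eq_square)
  qed
  have \<tau>_good: "\<tau> v \<in> good_points a" if v: "v \<in> generic_cone" for v
    using coords[OF v] v d0 unfolding good generic_cone_def by auto
  have "\<exists>E. polyfun E \<and> (\<forall>v\<in>generic_threefold. f (\<tau> v) $ i = E v)" for i
  proof (rule generic_polynomial)
    show "homogeneous_on_cone (\<lambda>v. f (\<tau> v) $ i)"
      unfolding homogeneous_on_cone_def
    proof (intro ballI allI impI)
      fix v v' :: "nat \<Rightarrow> 'k alg_closure" and c
      assume v: "v \<in> generic_cone" and c: "c \<noteq> 0"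
        and "v' 0 = v 0" "v' 1 = v 1" "v' 2 = c * v 2" "v' 3 = c * v 3" "v' 4 = c * v 4"
      then have "u v' = 1 *s u v" "w v' = c *s w v"
        by (simp_all add: u_def w_def vec_eq_2 vec_eq_3)
      then have "\<tau> v' = \<tau> v"
        unfolding \<tau>_def by (simp only:) (rule frame_point_scale[OF det nz[OF v] one_neq_zero c])
      then show "f (\<tau> v') $ i = f (\<tau> v) $ i" by simp
    qed
    show "rational_on_cone (\<lambda>v. f (\<tau> v) $ i)"
      unfolding rational_on_cone_def
    proof
      fix v :: "nat \<Rightarrow> 'k alg_closure" assume v: "v \<in> generic_cone"
      have "(\<lambda>z. f z $ i) \<in> stalk proj_prod (abs_proj (coframe1 l m (u v)), abs_proj (coframe2 l m (w v)))"
        using coordinate_regular[OF \<tau>_good[OF v]] by (simp add: stalk_proj_prod \<tau>_def frame_point_def)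
      then obtain F G :: "(2 + 3, 'k) mpoly" where FG:
        "mpoly_eval G (case_sum (vec_nth (coframe1 l m (u v))) (vec_nth (coframe2 l m (w v)))) \<noteq> 0"
        "\<And>u w. u \<noteq> 0 \<Longrightarrow> w \<noteq> 0 \<Longrightarrow> mpoly_eval G (case_sum (vec_nth u) (vec_nth w)) \<noteq> 0 \<Longrightarrow>
          f (abs_proj u, abs_proj w) $ i = mpoly_eval F (case_sum (vec_nth u) (vec_nth w)) /
            mpoly_eval G (case_sum (vec_nth u) (vec_nth w))"
        using proj_prod_stalkE[OF _ coframe_nonzero(1)[OF det nz(1)[OF v]] coframe_nonzero(2)[OF det nz(2)[OF v]]] by metis
      define t where "t v = case_sum (vec_nth (coframe1 l m (u v))) (vec_nth (coframe2 l m (w v)))" for v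
      have pt: "polyfun (\<lambda>v. t v k)" for k
      proof (cases k)
        case (Inl i)
        then show ?thesis
          using exhaust_2[of i] by (auto simp: t_def coframe1_def frame1_def lin_def u_def intro!: polyfun_intros)
      next
        case (Inr j)
        then show ?thesis
          using exhaust_3[of j]
          by (auto simp: t_def coframe2_def frame2_def quad_def polar_def w_def intro!: polyfun_intros)
      qed
      show "\<exists>F G. polyfun F \<and> polyfun G \<and> G v \<noteq> 0 \<and>
          (\<forall>v'\<in>generic_cone. G v' \<noteq> 0 \<longrightarrow> f (\<tau> v') $ i = F v' / G v')"
      proof (rule exI[of _ "\<lambda>v. mpoly_eval F (\<lambda>k. t v k)"], rule exI[of _ "\<lambda>v. mpoly_eval G (\<lambda>k. t v k)"],
          intro conjI ballI impI)
        show "mpoly_eval G (\<lambda>k. t v k) \<noteq> 0" using FG(1) by (simp add: t_def)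
        show "f (\<tau> v') $ i = mpoly_eval F (\<lambda>k. t v' k) / mpoly_eval G (\<lambda>k. t v' k)"
          if "v' \<in> generic_cone" "mpoly_eval G (\<lambda>k. t v' k) \<noteq> 0" for v'
          using FG(2)[OF coframe_nonzero(1)[OF det nz(1)[OF that(1)]] coframe_nonzero(2)[OF det nz(2)[OF that(1)]]] that(2)
          by (simp add: \<tau>_def frame_point_def t_def)
      qed (rule polyfun_mpoly_eval, rule pt)+
    qed
  qed
  then obtain E where E: "\<And>i. polyfun (E i)" "\<And>i v. v \<in> generic_threefold \<Longrightarrow> f (\<tau> v) $ i = E i v"
    by metis
  define \<Gamma> where "\<Gamma> i = (if i = 0 then E 1 else if i = 1 then E 2 else E 3)" for i :: nat
  have \<Gamma>: "polyfun (\<Gamma> i)" for i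
    using E(1) by (simp add: \<Gamma>_def)
  have inv: "fX (\<lambda>i. if i < 3 then \<Gamma> i v else 0) = v 0 \<and> fY (\<lambda>i. if i < 3 then \<Gamma> i v else 0) = v 1"
    if v: "v \<in> generic_threefold" for v
  proof -
    have eq: "v 0 * v 2 + v 1 * v 4 = 1" "v 1 ^ 2 * v 2 + v 0 ^ 2 * v 4 - v 0 * v 1 * v 3 = 1"
      using v by (auto simp: generic_threefold_def)
    have vc: "v \<in> generic_cone" unfolding generic_cone_def mem_Collect_eq eq by simp
    have "vec3 (\<lambda>i. if i < 3 then \<Gamma> i v else 0) = f (\<tau> v)"
      using E(2)[OF v] by (simp add: vec3_def vec_eq_3 \<Gamma>_def)
    then have z: "g (vec3 (\<lambda>i. if i < 3 then \<Gamma> i v else 0)) = \<tau> v"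
      using gf[OF \<tau>_good[OF vc]] by simp
    obtain s t where st: "s \<noteq> 0" "t \<noteq> 0" "Xf (\<tau> v) = s * v 0" "Yf (\<tau> v) = s * v 1"
      "Lf (\<tau> v) = s * t" "d^2 * Qf (\<tau> v) = s^2 * t"
      using coords[OF vc] unfolding eq by auto
    then have Q: "Qf (\<tau> v) = s^2 * t / d^2" using d0 by (simp add: field_simps)
    have "inverse (d^2) * (s * q * (s * t) / (s^2 * t / d^2)) = q" for q
      using st(1,2) d0 by (simp add: field_simps power2_eq_square)
    then show ?thesis unfolding val z st(3-5) Q by blast
  qed
  show False
    by (rule generic_threefold_not_affine_space[where g = \<Gamma>, OF polys \<Gamma> unimodular]) (use inv in auto)
qed


subsection \<open>Binary cubics\<close>

text \<open>In characteristic 0 the order at a root drops by exactly one under derivation.\<close>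

lemma order_eq_2_iff:
  fixes p :: "'c::field_char_0 poly"
  assumes "p \<noteq> 0"
  shows "Polynomial.order r p = 2 \<longleftrightarrow>
    poly p r = 0 \<and> poly (pderiv p) r = 0 \<and> poly (pderiv (pderiv p)) r \<noteq> 0"
proof -
  have step: "Polynomial.order r q = Suc n \<longleftrightarrow>
      poly q r = 0 \<and> pderiv q \<noteq> 0 \<and> Polynomial.order r (pderiv q) = n"
    if "q \<noteq> 0" for q :: "'c poly" and n
  proof (cases "poly q r = 0")
    case False
    then show ?thesis using that by (simp add: order_0I)
  next
    case True
    have "pderiv q \<noteq> 0"
    proof
      assume "pderiv q = 0"
      then obtain c where "q = [:c:]" by (meson degree_eq_zeroE pderiv_eq_0_iff)
      with True that show False by simp
    qed
    moreover have "Polynomial.order r q \<noteq> 0" using True that by (simp add: order_root)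
    ultimately have "Polynomial.order r q = Suc (Polynomial.order r (pderiv q))"
      using True by (intro order_pderiv) auto
    then show ?thesis using True \<open>pderiv q \<noteq> 0\<close> by auto
  qed
  have "Polynomial.order r p = 2 \<longleftrightarrow> poly p r = 0 \<and> pderiv p \<noteq> 0 \<and> Polynomial.order r (pderiv p) = Suc 0"
    using step[OF assms, of 1] by (simp add: numeral_2_eq_2)
  also have "\<dots> \<longleftrightarrow> poly p r = 0 \<and> poly (pderiv p) r = 0 \<and> pderiv p \<noteq> 0 \<and> pderiv (pderiv p) \<noteq> 0
      \<and> Polynomial.order r (pderiv (pderiv p)) = 0"
    using step[of "pderiv p" 0] by auto
  also have "\<dots> \<longleftrightarrow> poly p r = 0 \<and> poly (pderiv p) r = 0 \<and> poly (pderiv (pderiv p)) r \<noteq> 0"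
    by (auto simp: order_root)
  finally show ?thesis .
qed

lemma diag_pullback_altdef:
  "diag_pullback a (vector [[:0, 1:], 1]) = [:to_ac (a $ 4), 3 * to_ac (a $ 3), 3 * to_ac (a $ 2), to_ac (a $ 1):]"
  "diag_pullback a (vector [1, [:0, 1:]]) = [:to_ac (a $ 1), 3 * to_ac (a $ 2), 3 * to_ac (a $ 3), to_ac (a $ 4):]"
  by (simp_all add: diag_pullback_def sum_4 sym_coords_3 sym_mult_def sym_mult2_def algebra_simps)

text \<open>At \<open>r\<close> the pullback and its first two derivatives are r P1 + P2, 3 P1 and 6
  P3, so contact of order exactly 2 means P1 = P2 = 0 and P3 \<noteq> 0. The second alternative is
  the point [1 : 0].\<close>

lemma tangent_not_osculating_iff:
  fixes a :: "'k::field_char_0^4"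
  assumes "a \<noteq> 0"
  shows "tangent_not_osculating a \<longleftrightarrow>
    (\<exists>r. to_ac (a $ 1) * r^2 + 2 * to_ac (a $ 2) * r + to_ac (a $ 3) = 0 \<and>
         to_ac (a $ 2) * r^2 + 2 * to_ac (a $ 3) * r + to_ac (a $ 4) = 0 \<and>
         to_ac (a $ 1) * r + to_ac (a $ 2) \<noteq> 0) \<or>
    a $ 1 = 0 \<and> a $ 2 = 0 \<and> a $ 3 \<noteq> 0"
proof -
  let ?p = "[:to_ac (a $ 4), 3 * to_ac (a $ 3), 3 * to_ac (a $ 2), to_ac (a $ 1):]"
  let ?q = "[:to_ac (a $ 1), 3 * to_ac (a $ 2), 3 * to_ac (a $ 3), to_ac (a $ 4):]"
  define root where "root r \<longleftrightarrow> to_ac (a $ 1) * r^2 + 2 * to_ac (a $ 2) * r + to_ac (a $ 3) = 0 \<and>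
         to_ac (a $ 2) * r^2 + 2 * to_ac (a $ 3) * r + to_ac (a $ 4) = 0 \<and>
         to_ac (a $ 1) * r + to_ac (a $ 2) \<noteq> 0" for r
  have nz: "?p \<noteq> 0" "?q \<noteq> 0" using assms by (auto simp: vec_eq_4)
  have finite: "Polynomial.order r ?p = 2 \<longleftrightarrow> root r" for r
  proof -
    define P1 P2 where "P1 = to_ac (a $ 1) * r^2 + 2 * to_ac (a $ 2) * r + to_ac (a $ 3)"
      and "P2 = to_ac (a $ 2) * r^2 + 2 * to_ac (a $ 3) * r + to_ac (a $ 4)"
    define P3 where "P3 = to_ac (a $ 1) * r + to_ac (a $ 2)"
    have e0: "poly ?p r = r * P1 + P2"
      by (simp add: P1_def P2_def algebra_simps power2_eq_square)
    have e1: "poly (pderiv ?p) r = 3 * P1"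
      by (simp add: pderiv_pCons P1_def algebra_simps power2_eq_square)
    have e2: "poly (pderiv (pderiv ?p)) r = 6 * P3"
      by (simp add: pderiv_pCons P3_def algebra_simps)
    show ?thesis
      unfolding order_eq_2_iff[OF nz(1)] root_def e0 e1 e2 P1_def[symmetric] P2_def[symmetric]
        P3_def[symmetric] by auto
  qed
  have infinite: "Polynomial.order 0 ?q = 2 \<longleftrightarrow> a $ 1 = 0 \<and> a $ 2 = 0 \<and> a $ 3 \<noteq> 0"
    unfolding order_eq_2_iff[OF nz(2)] by (simp add: pderiv_pCons)
  have contact: "contact_order a p = (if rep_proj p $ 2 \<noteq> 0
      then Polynomial.order (rep_proj p $ 1 / rep_proj p $ 2) ?p else Polynomial.order 0 ?q)" for p
    by (simp add: contact_order_def Let_def diag_pullback_altdef)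
  have "\<exists>p :: ('k alg_closure, 2) proj. rep_proj p $ 2 \<noteq> 0 \<and> rep_proj p $ 1 / rep_proj p $ 2 = r" for r :: "'k alg_closure"
  proof -
    have "(vector [r, 1] :: 'k alg_closure^2) \<noteq> 0" by (auto simp: vec_eq_2)
    then obtain c where "c \<noteq> 0" "rep_proj (abs_proj (vector [r, 1] :: 'k alg_closure^2)) = c *s vector [r, 1]"
      by (rule rep_abs_proj)
    then show ?thesis by (intro exI[of _ "abs_proj (vector [r, 1] :: 'k alg_closure^2)"]) simp
  qed
  moreover have "\<exists>p :: ('k alg_closure, 2) proj. rep_proj p $ 2 = 0"
  proof -
    have "(vector [1, 0] :: 'k alg_closure^2) \<noteq> 0" by (auto simp: vec_eq_2)
    then obtain c where "c \<noteq> 0" "rep_proj (abs_proj (vector [1, 0] :: 'k alg_closure^2)) = c *s vector [1, 0]"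
      by (rule rep_abs_proj)
    then show ?thesis by (intro exI[of _ "abs_proj (vector [1, 0] :: 'k alg_closure^2)"]) simp
  qed
  ultimately have "tangent_not_osculating a \<longleftrightarrow>
      (\<exists>r. Polynomial.order r ?p = 2) \<or> Polynomial.order 0 ?q = 2"
    unfolding tangent_not_osculating_def tangent_to_order_def contact by metis
  then show ?thesis unfolding finite infinite root_def .
qed

text \<open>
  Below, \<open>h1\<close>, \<open>h2\<close>, \<open>h3\<close> are the coefficients of the Hessian of the binary cubic \<open>(a1, 3 a2, 3 a3, a4)\<close>.
  They vanish for a cube only, and the discriminant of the Hessian is that of the cubic up to a
  constant.  In the tangent case, the double root \<open>- h2 / (2 h1)\<close> is therefore rational.
\<close>

lemma tangent_normal_form:
  fixes a :: "'k::field_char_0^4"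
  assumes "a \<noteq> 0" "tangent_not_osculating a"
  obtains l m :: "'k^2" where "frame_det l m \<noteq> 0"
    "a $ 1 = l $ 1 ^ 2 * m $ 1" "3 * a $ 2 = l $ 1 ^ 2 * m $ 2 + 2 * l $ 1 * l $ 2 * m $ 1"
    "3 * a $ 3 = l $ 2 ^ 2 * m $ 1 + 2 * l $ 1 * l $ 2 * m $ 2" "a $ 4 = l $ 2 ^ 2 * m $ 2"
proof -
  note iff = tangent_not_osculating_iff[OF assms(1)]
  from assms(2)[unfolded iff] show thesis
  proof (elim disjE exE conjE)
    fix s
    assume s: "to_ac (a $ 1) * s^2 + 2 * to_ac (a $ 2) * s + to_ac (a $ 3) = 0"
      "to_ac (a $ 2) * s^2 + 2 * to_ac (a $ 3) * s + to_ac (a $ 4) = 0"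
      "to_ac (a $ 1) * s + to_ac (a $ 2) \<noteq> 0"
    define h1 h2 where "h1 = a $ 1 * a $ 3 - a $ 2 ^ 2" and "h2 = a $ 1 * a $ 4 - a $ 2 * a $ 3"
    \<comment> \<open>So -h1 is a nonzero square; the relation after it is linear in
      \<open>s\<close> with invertible coefficient and solves for \<open>s\<close> over
      \<open>k\<close>.\<close>
    have "(to_ac (a $ 1) * s + to_ac (a $ 2))^2 + to_ac h1 = 0"
      using s(1) unfolding h1_def to_ac_diff to_ac_mult to_ac_power by Groebner_Basis.algebra
    with s(3) have h1: "h1 \<noteq> 0" by (auto simp: add_eq_0_iff)
    have "2 * to_ac h1 * s + to_ac h2 = 0"
      using s(1,2) unfolding h1_def h2_def to_ac_diff to_ac_mult to_ac_power by Groebner_Basis.algebra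
    then have "s = to_ac (- h2 / (2 * h1))"
      using h1 by (simp add: field_simps eq_neg_iff_add_eq_0)
    then obtain r where r: "s = to_ac r" by blast
    have "to_ac (a $ 1 * r^2 + 2 * a $ 2 * r + a $ 3) = 0" "to_ac (a $ 2 * r^2 + 2 * a $ 3 * r + a $ 4) = 0"
      "to_ac (a $ 1 * r + a $ 2) \<noteq> 0"
      using s by (simp_all add: r)
    then have e: "a $ 1 * r^2 + 2 * a $ 2 * r + a $ 3 = 0" "a $ 2 * r^2 + 2 * a $ 3 * r + a $ 4 = 0"
      "a $ 1 * r + a $ 2 \<noteq> 0"
      unfolding to_ac_eq_0_iff by blast+
    show thesis
    \<comment> \<open>The cubic is divided by (t - r)^2; the cofactor is linear with leading
      coefficient a1.\<close>
    proof (rule that[of "vector [1, - r]" "vector [a $ 1, 3 * a $ 2 + 2 * r * a $ 1]"])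
      have "frame_det (vector [1, - r]) (vector [a $ 1, 3 * a $ 2 + 2 * r * a $ 1]) = 3 * (a $ 1 * r + a $ 2)"
        by (simp add: frame_det_def algebra_simps)
      then show "frame_det (vector [1, - r]) (vector [a $ 1, 3 * a $ 2 + 2 * r * a $ 1]) \<noteq> 0"
        using e(3) by (metis mult_eq_0_iff zero_neq_numeral)
      have "3 * a $ 3 = r^2 * a $ 1 + 2 * (- r) * (3 * a $ 2 + 2 * r * a $ 1)"
        using e(1) by Groebner_Basis.algebra
      then show "3 * a $ 3 = (vector [1, - r] :: 'k^2) $ 2 ^ 2 * vector [a $ 1, 3 * a $ 2 + 2 * r * a $ 1] $ 1
          + 2 * (vector [1, - r] :: 'k^2) $ 1 * (vector [1, - r] :: 'k^2) $ 2 * (vector [a $ 1, 3 * a $ 2 + 2 * r * a $ 1] :: 'k^2) $ 2"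
        by simp
      have "a $ 4 = r^2 * (3 * a $ 2 + 2 * r * a $ 1)"
        using e(1,2) by Groebner_Basis.algebra
      then show "a $ 4 = (vector [1, - r] :: 'k^2) $ 2 ^ 2 * (vector [a $ 1, 3 * a $ 2 + 2 * r * a $ 1] :: 'k^2) $ 2"
        by simp
    qed simp_all
  next
    assume "a $ 1 = 0" "a $ 2 = 0" "a $ 3 \<noteq> 0"
    then show thesis
      by (intro that[of "vector [0, 1]" "vector [3 * a $ 3, a $ 4]"]) (simp_all add: frame_det_def)
  qed
qed

text \<open>Sylvester's method: (h3, -h2, h1) is orthogonal to (a1, a2, a3) and (a2, a3, a4), so the
  coefficients obey a recurrence of order two with characteristic roots \<rho> and \<sigma>. These
  are distinct by the discriminant, so the i-th coefficient, counted from 0, is \<alpha> \<rho>^i +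
  \<beta> \<sigma>^i; cube roots of \<alpha> and \<beta> give the linear forms.\<close>

lemma sum_of_cubes:
  fixes a1 a2 a3 a4 :: "'c::{alg_closed_field, field_char_0}"
  defines "h1 \<equiv> a1 * a3 - a2^2" and "h2 \<equiv> a1 * a4 - a2 * a3" and "h3 \<equiv> a2 * a4 - a3^2"
  assumes disc: "h2^2 \<noteq> 4 * h1 * h3" and h1: "h1 \<noteq> 0"
  shows "\<exists>s t u v. s * v - t * u \<noteq> 0 \<and> a1 = s^3 + u^3 \<and> a2 = s^2 * t + u^2 * v \<and>
    a3 = s * t^2 + u * v^2 \<and> a4 = t^3 + v^3"
proof -
  obtain \<rho> where "poly [:h3, - h2, h1:] \<rho> = 0"
    using alg_closed_imp_poly_has_root[of "[:h3, - h2, h1:]"] h1 by auto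
  then have \<rho>: "h1 * \<rho>^2 - h2 * \<rho> + h3 = 0"
    by (simp add: algebra_simps power2_eq_square)
  define \<sigma> where "\<sigma> = h2 / h1 - \<rho>"
  have sum: "h1 * (\<rho> + \<sigma>) = h2" using h1 by (simp add: \<sigma>_def field_simps)
  have prod: "h1 * (\<rho> * \<sigma>) = h3" using \<rho> sum by Groebner_Basis.algebra
  have "h1^2 * (\<rho> - \<sigma>)^2 = h2^2 - 4 * h1 * h3"
    unfolding sum[symmetric] prod[symmetric] by (simp add: algebra_simps power2_eq_square)
  with disc have ne: "\<rho> - \<sigma> \<noteq> 0" by auto
  define \<alpha> \<beta> where "\<alpha> = (a2 - \<sigma> * a1) / (\<rho> - \<sigma>)" and "\<beta> = (\<rho> * a1 - a2) / (\<rho> - \<sigma>)"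
  have \<alpha>\<beta>: "\<alpha> * (\<rho> - \<sigma>) = a2 - \<sigma> * a1" "\<beta> * (\<rho> - \<sigma>) = \<rho> * a1 - a2"
    using ne by (simp_all add: \<alpha>_def \<beta>_def)
  have "(\<rho> - \<sigma>) * (\<alpha> + \<beta>) = (\<rho> - \<sigma>) * a1" using \<alpha>\<beta> by Groebner_Basis.algebra
  then have e1: "a1 = \<alpha> + \<beta>" using ne by simp
  have "(\<rho> - \<sigma>) * (\<alpha> * \<rho> + \<beta> * \<sigma>) = (\<rho> - \<sigma>) * a2" using \<alpha>\<beta> by Groebner_Basis.algebra
  then have e2: "a2 = \<alpha> * \<rho> + \<beta> * \<sigma>" using ne by simp
  have "h1 * a3 = h1 * ((\<rho> + \<sigma>) * a2 - \<rho> * \<sigma> * a1)"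
    using sum prod unfolding h1_def h2_def h3_def by Groebner_Basis.algebra
  then have "a3 = (\<rho> + \<sigma>) * a2 - \<rho> * \<sigma> * a1" using h1 by simp
  then have e3: "a3 = \<alpha> * \<rho>^2 + \<beta> * \<sigma>^2" using e1 e2 by Groebner_Basis.algebra
  have "h1 * a4 = h1 * ((\<rho> + \<sigma>) * a3 - \<rho> * \<sigma> * a2)"
    using sum prod unfolding h1_def h2_def h3_def by Groebner_Basis.algebra
  then have "a4 = (\<rho> + \<sigma>) * a3 - \<rho> * \<sigma> * a2" using h1 by simp
  then have e4: "a4 = \<alpha> * \<rho>^3 + \<beta> * \<sigma>^3" using e2 e3 by Groebner_Basis.algebra
  obtain s where s: "s^3 = \<alpha>" using nth_root_exists[of 3 \<alpha>] by auto
  obtain u where u: "u^3 = \<beta>" using nth_root_exists[of 3 \<beta>] by auto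
  \<comment> \<open>Hence neither \<alpha> nor \<beta> is 0, and the two linear forms are
    independent.\<close>
  have "h1 = \<alpha> * \<beta> * (\<rho> - \<sigma>)^2"
    unfolding h1_def e1 e2 e3 by Groebner_Basis.algebra
  with h1 have "s \<noteq> 0" "u \<noteq> 0" using s u by auto
  then have "s * (u * \<sigma>) - (s * \<rho>) * u \<noteq> 0"
    using ne by (auto simp: mult_ac)
  moreover have "a2 = s^2 * (s * \<rho>) + u^2 * (u * \<sigma>)"
    unfolding e2 s[symmetric] u[symmetric] by Groebner_Basis.algebra
  moreover have "a3 = s * (s * \<rho>)^2 + u * (u * \<sigma>)^2"
    unfolding e3 s[symmetric] u[symmetric] by Groebner_Basis.algebra
  moreover have "a4 = (s * \<rho>)^3 + (u * \<sigma>)^3"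
    unfolding e4 s[symmetric] u[symmetric] by Groebner_Basis.algebra
  moreover have "a1 = s^3 + u^3" using e1 s u by simp
  ultimately show ?thesis by blast
qed

lemma generic_normal_form:
  fixes a1 a2 a3 a4 :: "'c::{alg_closed_field, field_char_0}"
  assumes disc: "(a1 * a4 - a2 * a3)^2 \<noteq> 4 * (a1 * a3 - a2^2) * (a2 * a4 - a3^2)"
  obtains l m :: "'c^2" where "frame_det l m \<noteq> 0"
    "a1 = l $ 1 ^ 3 + m $ 1 ^ 3" "a2 = l $ 1 ^ 2 * l $ 2 + m $ 1 ^ 2 * m $ 2"
    "a3 = l $ 1 * l $ 2 ^ 2 + m $ 1 * m $ 2 ^ 2" "a4 = l $ 2 ^ 3 + m $ 2 ^ 3"
proof -
  have "\<exists>s t u v. s * v - t * u \<noteq> 0 \<and> a1 = s^3 + u^3 \<and> a2 = s^2 * t + u^2 * v \<and>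
    a3 = s * t^2 + u * v^2 \<and> a4 = t^3 + v^3"
  proof -
    consider "a1 * a3 - a2^2 \<noteq> 0" | "a2 * a4 - a3^2 \<noteq> 0" | "a1 * a3 = a2^2" "a2 * a4 = a3^2" by auto
    then show ?thesis
    proof cases
      case 1
      then show ?thesis using disc by (intro sum_of_cubes) auto
    next
      case 2
      \<comment> \<open>Reversing the order of the coefficients exchanges h1 and h3.\<close>
      have "\<exists>s t u v. s * v - t * u \<noteq> 0 \<and> a4 = s^3 + u^3 \<and> a3 = s^2 * t + u^2 * v \<and>
          a2 = s * t^2 + u * v^2 \<and> a1 = t^3 + v^3"
      proof (rule sum_of_cubes)
        have "(a4 * a1 - a3 * a2)^2 = (a1 * a4 - a2 * a3)^2"
          "4 * (a4 * a2 - a3^2) * (a3 * a1 - a2^2) = 4 * (a1 * a3 - a2^2) * (a2 * a4 - a3^2)"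
          by (simp_all only: mult_ac)
        then show "(a4 * a1 - a3 * a2)^2 \<noteq> 4 * (a4 * a2 - a3^2) * (a3 * a1 - a2^2)"
          using disc by (simp only: not_False_eq_True)
        show "a4 * a2 - a3^2 \<noteq> 0" using 2 by (simp only: mult.commute not_False_eq_True)
      qed
      then obtain s t u v where "s * v - t * u \<noteq> 0" "a4 = s^3 + u^3" "a3 = s^2 * t + u^2 * v"
          "a2 = s * t^2 + u * v^2" "a1 = t^3 + v^3"
        by blast
      then show ?thesis
        by (intro exI[of _ t] exI[of _ s] exI[of _ v] exI[of _ u]) (auto simp: mult_ac)
    next
      case 3
      \<comment> \<open>With h1 = h3 = 0 the discriminant leaves h2 nonzero. This forces the middle
        coefficients to vanish, so the cubic is visibly a sum of two cubes.\<close>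
      then have ne: "a1 * a4 - a2 * a3 \<noteq> 0" using disc by auto
      have "a2 * a3 * (a1 * a4 - a2 * a3) = 0" using 3 by Groebner_Basis.algebra
      with ne have "a2 * a3 = 0" by simp
      with 3 have a23: "a2 = 0" "a3 = 0" by auto
      obtain s where s: "s^3 = a1" using nth_root_exists[of 3 a1] by auto
      obtain v where v: "v^3 = a4" using nth_root_exists[of 3 a4] by auto
      show ?thesis
        using ne a23 s v by (intro exI[of _ s] exI[of _ 0] exI[of _ 0] exI[of _ v]) auto
    qed
  qed
  then obtain s t u v where "s * v - t * u \<noteq> 0" "a1 = s^3 + u^3" "a2 = s^2 * t + u^2 * v"
    "a3 = s * t^2 + u * v^2" "a4 = t^3 + v^3"
    by blast
  then show thesis
    by (intro that[of "vector [s, t]" "vector [u, v]"]) (auto simp: frame_det_def)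
qed

text \<open>A vanishing Hessian makes the four coefficients a geometric progression, whose ratio
  lies in \<open>k\<close>; if the first is 0, so are the middle two.\<close>

lemma osculating_normal_form:
  fixes a :: "'k::field_char_0^4"
  assumes "a \<noteq> 0" "a $ 1 * a $ 3 = a $ 2 ^ 2" "a $ 1 * a $ 4 = a $ 2 * a $ 3" "a $ 2 * a $ 4 = a $ 3 ^ 2"
  obtains c and l :: "'k^2" where "c \<noteq> 0" "l \<noteq> 0" "a $ 1 = c * l $ 1 ^ 3" "a $ 2 = c * l $ 1 ^ 2 * l $ 2"
    "a $ 3 = c * l $ 1 * l $ 2 ^ 2" "a $ 4 = c * l $ 2 ^ 3"
proof (cases "a $ 1 = 0")
  case True
  with assms(2,4) have "a $ 2 = 0" "a $ 3 = 0" by auto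
  with True assms(1) show thesis
    by (intro that[of "a $ 4" "vector [0, 1]"]) (auto simp: vec_eq_2 vec_eq_4)
next
  case False
  have "a $ 1 * (a $ 1 * a $ 4) = a $ 2 * (a $ 2 ^ 2)"
    using assms(2,3) by Groebner_Basis.algebra
  then have "a $ 4 = a $ 1 * (a $ 2 / a $ 1) ^ 3" "a $ 3 = a $ 1 * (a $ 2 / a $ 1) ^ 2"
    using False assms(2) by (simp_all add: field_simps power2_eq_square power3_eq_cube)
  with False show thesis
    by (intro that[of "a $ 1" "vector [1, a $ 2 / a $ 1]"]) (auto simp: vec_eq_2)
qed

text \<open>A nonzero Hessian with discriminant 0 has a double root, which is the double root of the
  cubic; it lies at infinity if h1 = 0.\<close>

lemma tangent_if_discriminant_zero:
  fixes a :: "'k::field_char_0^4"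
  assumes "a \<noteq> 0"
    and disc: "(a $ 1 * a $ 4 - a $ 2 * a $ 3)^2 = 4 * (a $ 1 * a $ 3 - a $ 2 ^ 2) * (a $ 2 * a $ 4 - a $ 3 ^ 2)"
    and nz: "\<not> (a $ 1 * a $ 3 = a $ 2 ^ 2 \<and> a $ 1 * a $ 4 = a $ 2 * a $ 3 \<and> a $ 2 * a $ 4 = a $ 3 ^ 2)"
  shows "tangent_not_osculating a"
proof (cases "a $ 1 * a $ 3 - a $ 2 ^ 2 = 0")
  case True
  then have 1: "a $ 1 * a $ 3 = a $ 2 ^ 2" by simp
  then have 2: "a $ 1 * a $ 4 = a $ 2 * a $ 3" using disc by simp
  have 3: "a $ 2 * a $ 4 - a $ 3 ^ 2 \<noteq> 0" using 1 2 nz by simp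
  have "a $ 1 * (a $ 2 * a $ 4 - a $ 3 ^ 2) = 0" using 1 2 by Groebner_Basis.algebra
  with 3 have a1: "a $ 1 = 0" by simp
  with 1 have "a $ 2 = 0" by simp
  with 3 a1 show ?thesis unfolding tangent_not_osculating_iff[OF assms(1)] by auto
next
  case False
  define h1 h2 h3 where "h1 = a $ 1 * a $ 3 - a $ 2 ^ 2" and "h2 = a $ 1 * a $ 4 - a $ 2 * a $ 3"
    and "h3 = a $ 2 * a $ 4 - a $ 3 ^ 2"
  define r where "r = - h2 / (2 * h1)"
  have h1: "h1 \<noteq> 0" using False by (simp add: h1_def)
  then have r: "2 * h1 * r = - h2" by (simp add: r_def)
  have disc': "h2^2 = 4 * h1 * h3" using disc by (simp add: h1_def h2_def h3_def)
  have "h1 * r^2 = h3"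
  proof -
    have "4 * h1 * (h1 * r^2 - h3) = 0" using r disc' by Groebner_Basis.algebra
    then show ?thesis using h1 by simp
  qed
  moreover have "h1 * (b * r^2 + 2 * b' * r + b'') = b * (h1 * r^2) + b' * (2 * h1 * r) + b'' * h1" for b b' b''
    by (simp add: algebra_simps)
  ultimately have key: "h1 * (b * r^2 + 2 * b' * r + b'') = b * h3 - b' * h2 + b'' * h1" for b b' b''
    using r by simp
  \<comment> \<open>These are expansions of 3 by 3 determinants with a repeated row.\<close>
  have "a $ 1 * h3 - a $ 2 * h2 + a $ 3 * h1 = 0" "a $ 2 * h3 - a $ 3 * h2 + a $ 4 * h1 = 0"
    unfolding h1_def h2_def h3_def by (Groebner_Basis.algebra)+
  then have e: "a $ 1 * r^2 + 2 * a $ 2 * r + a $ 3 = 0" "a $ 2 * r^2 + 2 * a $ 3 * r + a $ 4 = 0"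
    using h1 key[of "a $ 1" "a $ 2" "a $ 3"] key[of "a $ 2" "a $ 3" "a $ 4"] by auto
  have "(a $ 1 * r + a $ 2)^2 = - h1" using e(1) unfolding h1_def by Groebner_Basis.algebra
  then have "a $ 1 * r + a $ 2 \<noteq> 0" using h1 by auto
  then have "to_ac (a $ 1 * r + a $ 2) \<noteq> 0" by (simp only: to_ac_eq_0_iff not_False_eq_True)
  moreover have "to_ac (a $ 1 * r^2 + 2 * a $ 2 * r + a $ 3) = 0" "to_ac (a $ 2 * r^2 + 2 * a $ 3 * r + a $ 4) = 0"
    by (simp_all only: e to_ac_0)
  ultimately show ?thesis
    unfolding tangent_not_osculating_iff[OF assms(1)] by (intro disjI1 exI[of _ "to_ac r"]) simp
qed

theorem theoremA7:
  fixes a :: "'k::field_char_0 ^ 4"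
  defines "R \<equiv> ramification_locus proj_prod proj_space
      (add_point :: ('k alg_closure, 2) proj \<times> ('k alg_closure, 3) proj \<Rightarrow> ('k alg_closure, 4) proj)"
  defines "H \<equiv> hyperplane a"
  assumes "a \<noteq> 0"
  shows "isomorphic_varieties
      (open_subspace proj_prod (UNIV - (R \<union> add_point -` H)))
      (affine_space :: ('k alg_closure ^ 3, 'k alg_closure) fun_space)
    \<longleftrightarrow> tangent_not_osculating a"
  unfolding R_def H_def good_points_eq
proof
  assume "tangent_not_osculating a"
  from tangent_normal_form[OF assms(3) this]
  show "isomorphic_varieties (open_subspace proj_prod (good_points a))
      (affine_space :: ('k alg_closure ^ 3, 'k alg_closure) fun_space)"
    using tangent_isomorphic_affine_space by metis
next
  assume "isomorphic_varieties (open_subspace proj_prod (good_points a))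
      (affine_space :: ('k alg_closure ^ 3, 'k alg_closure) fun_space)"
  then obtain f g where iso: "affine_iso a f g" using affine_isoI by blast
  show "tangent_not_osculating a"
  proof (rule ccontr)
    assume "\<not> tangent_not_osculating a"
    then consider "a $ 1 * a $ 3 = a $ 2 ^ 2" "a $ 1 * a $ 4 = a $ 2 * a $ 3" "a $ 2 * a $ 4 = a $ 3 ^ 2"
      | "(a $ 1 * a $ 4 - a $ 2 * a $ 3)^2 \<noteq> 4 * (a $ 1 * a $ 3 - a $ 2 ^ 2) * (a $ 2 * a $ 4 - a $ 3 ^ 2)"
      using tangent_if_discriminant_zero[OF assms(3)] by blast
    then show False
    proof cases
      case 1
      from osculating_normal_form[OF assms(3) this] show False
        using osculating_not_affine_space[OF iso] by metis
    next
      case 2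
      then have "to_ac ((a $ 1 * a $ 4 - a $ 2 * a $ 3)^2) \<noteq>
          to_ac (4 * (a $ 1 * a $ 3 - a $ 2 ^ 2) * (a $ 2 * a $ 4 - a $ 3 ^ 2))"
        by (simp only: to_ac_eq_iff not_False_eq_True)
      then have "(vec_ac a $ 1 * vec_ac a $ 4 - vec_ac a $ 2 * vec_ac a $ 3)^2 \<noteq>
          4 * (vec_ac a $ 1 * vec_ac a $ 3 - vec_ac a $ 2 ^ 2) * (vec_ac a $ 2 * vec_ac a $ 4 - vec_ac a $ 3 ^ 2)"
        by simp
      then obtain l m :: "'k alg_closure^2" where "frame_det l m \<noteq> 0"
        "vec_ac a $ 1 = l $ 1 ^ 3 + m $ 1 ^ 3" "vec_ac a $ 2 = l $ 1 ^ 2 * l $ 2 + m $ 1 ^ 2 * m $ 2"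
        "vec_ac a $ 3 = l $ 1 * l $ 2 ^ 2 + m $ 1 * m $ 2 ^ 2" "vec_ac a $ 4 = l $ 2 ^ 3 + m $ 2 ^ 3"
        by (rule generic_normal_form)
      then show False by (rule generic_not_affine_space[OF iso])
    qed
  qed
qed

end
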